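(* Let $d\ge3$ and $q\ge3$ be integers, and let $G_n$ be a $d$-regular graph on $n$ vertices such that $G_n$ converges locally to the infinite $d$-regular tree as $n\to\infty$. Then for all $\beta\ge0$ and $B\ge0$, the Potts pressure per particle converges to the Bethe prediction: $$\lim_{n\to\infty}\frac1n\log Z^{\mathrm{Potts}}_{G_n}(q,\beta,B)=\Phi^\star(\beta,B).$$
   Context: The Potts partition function of a finite graph $G$ is $$Z^{\mathrm{Potts}}_G(q,\beta,B)=\sum_{\sigma\in\{1,\dots,q\}^{V(G)}}\exp\Big(\beta\sum_{\{u,v\}\in E(G)}\mathbf 1_{\{\sigma_u=\sigma_v\}}+B\sum_{v\in V(G)}\mathbf 1_{\{\sigma_v=1\}}\Big).$$ Local convergence to the infinite $d$-regular tree means: for each $r\ge0$, the proportion of vertices of $G_n$ whose $r$-neighbourhood is a tree tends to $1$ (in probability, if $G_n$ is random, in which case the limit in the claim is also in probability). The Bethe prediction $\Phi^\star(\beta,B)$ is defined as follows. For a probability vector $\nu$ on $\{1,\dots,q\}$ let $$\Phi(\nu)=\log\Big\{\sum_{\sigma=1}^q e^{B\mathbf 1_{\{\sigma=1\}}}\Big(\sum_{\sigma'=1}^q e^{\beta\mathbf 1_{\{\sigma=\sigma'\}}}\nu(\sigma')\Big)^d\Big\}-\frac d2\log\Big\{\sum_{\sigma,\sigma'=1}^q e^{\beta\mathbf 1_{\{\sigma=\sigma'\}}}\nu(\sigma)\nu(\sigma')\Big\}.$$ Let $\mathcal H^\star$ be the set of probability vectors $\nu$ on $\{1,\dots,q\}$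 that are fixed points of the belief propagation recursion, i.e., for some normalising constant $z>0$, $$\nu(\sigma)=\frac1z\,e^{B\mathbf 1_{\{\sigma=1\}}}\Big(\sum_{\sigma'=1}^q e^{\beta\mathbf 1_{\{\sigma=\sigma'\}}}\nu(\sigma')\Big)^{d-1},\qquad \sigma=1,\dots,q.$$ Then $\Phi^\star(\beta,B)=\sup_{\nu\in\mathcal H^\star}\Phi(\nu)$. *)

theory Defs
  imports "HOL-Probability.Probability"
begin

section \<open>Finite simple graphs\<close>

datatype 'v ugraph = UGraph (verts: "'v set") (edges: "'v set set")

definition finite_simple_graph :: "'v ugraph \<Rightarrow> bool" where
  "finite_simple_graph G \<longleftrightarrow>
     finite (verts G) \<and> (\<forall>e\<in>edges G. e \<subseteq> verts G \<and> card e = 2)"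

definition degree_in :: "'v ugraph \<Rightarrow> 'v \<Rightarrow> nat" where
  "degree_in G v = card {e \<in> edges G. v \<in> e}"

definition regular_graph :: "nat \<Rightarrow> nat \<Rightarrow> 'v ugraph \<Rightarrow> bool" where
  "regular_graph d n G \<longleftrightarrow>
     finite_simple_graph G \<and> card (verts G) = n \<and> (\<forall>v\<in>verts G. degree_in G v = d)"

definition walk_in :: "'v ugraph \<Rightarrow> 'v list \<Rightarrow> bool" where
  "walk_in G xs \<longleftrightarrow>
     xs \<noteq> [] \<and> set xs \<subseteq> verts G \<and> successively (\<lambda>u v. {u, v} \<in> edges G) xs"

definition connected_graph :: "'v ugraph \<Rightarrow> bool" where
  "connected_graph G \<longleftrightarrow>
     verts G \<noteq> {} \<and> (\<forall>u\<in>verts G. \<forall>v\<in>verts G. \<exists>xs. walk_in G xs \<and> hd xs = u \<and> last xs = v)"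

text \<open>A cycle is listed without repeating its first vertex at the end.\<close>

definition cycle_in :: "'v ugraph \<Rightarrow> 'v list \<Rightarrow> bool" where
  "cycle_in G xs \<longleftrightarrow>
     walk_in G xs \<and> distinct xs \<and> 3 \<le> length xs \<and> {last xs, hd xs} \<in> edges G"

definition tree_graph :: "'v ugraph \<Rightarrow> bool" where
  "tree_graph G \<longleftrightarrow> connected_graph G \<and> (\<nexists>xs. cycle_in G xs)"

definition induced_subgraph :: "'v ugraph \<Rightarrow> 'v set \<Rightarrow> 'v ugraph" where
  "induced_subgraph G W = UGraph (verts G \<inter> W) {e \<in> edges G. e \<subseteq> W}"

text \<open>A walk with \<open>k\<close> steps is a list of \<open>k + 1\<close> vertices.\<close>

definition graph_ball :: "'v ugraph \<Rightarrow> 'v \<Rightarrow> nat \<Rightarrow> 'v set" where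
  "graph_ball G v r =
     {u. \<exists>xs. walk_in G xs \<and> hd xs = v \<and> last xs = u \<and> length xs \<le> r + 1}"

definition neighbourhood :: "'v ugraph \<Rightarrow> 'v \<Rightarrow> nat \<Rightarrow> 'v ugraph" where
  "neighbourhood G v r = induced_subgraph G (graph_ball G v r)"

definition tree_proportion :: "nat \<Rightarrow> 'v ugraph \<Rightarrow> real" where
  "tree_proportion r G =
     real (card {v \<in> verts G. tree_graph (neighbourhood G v r)}) / real (card (verts G))"


section \<open>Limits along a set of graph sizes\<close>

text \<open>
  A \<open>d\<close>-regular graph on \<open>n\<close> vertices only exists for some \<open>n\<close> (\<open>n * d\<close> must be even), so a
  graph sequence is indexed by an infinite set \<open>I\<close> of sizes and \<open>n \<rightarrow> \<infinity>\<close> within \<open>I\<close>.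
\<close>

definition at_top_along :: "nat set \<Rightarrow> nat filter" where
  "at_top_along I = inf at_top (principal I)"

definition converges_to_regular_tree :: "nat set \<Rightarrow> (nat \<Rightarrow> 'v ugraph) \<Rightarrow> bool" where
  "converges_to_regular_tree I G \<longleftrightarrow>
     (\<forall>r. ((\<lambda>n. tree_proportion r (G n)) \<longlongrightarrow> 1) (at_top_along I))"

text \<open>The random variables \<open>X n\<close> may live on different probability spaces \<open>M n\<close>.\<close>

definition tendsto_in_probability ::
  "(nat \<Rightarrow> 'w measure) \<Rightarrow> (nat \<Rightarrow> 'w \<Rightarrow> real) \<Rightarrow> real \<Rightarrow> nat filter \<Rightarrow> bool" where
  "tendsto_in_probability M X c F \<longleftrightarrow>
     (\<forall>\<epsilon>>0. ((\<lambda>n. measure (M n) {\<omega> \<in> space (M n). \<bar>X n \<omega> - c\<bar> > \<epsilon>}) \<longlongrightarrow> 0) F)"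

definition converges_to_regular_tree_in_probability ::
  "(nat \<Rightarrow> 'w measure) \<Rightarrow> nat set \<Rightarrow> (nat \<Rightarrow> 'w \<Rightarrow> 'v ugraph) \<Rightarrow> bool" where
  "converges_to_regular_tree_in_probability M I G \<longleftrightarrow>
     (\<forall>r. tendsto_in_probability M (\<lambda>n \<omega>. tree_proportion r (G n \<omega>)) 1 (at_top_along I))"

definition random_regular_graph ::
  "nat \<Rightarrow> nat \<Rightarrow> 'w measure \<Rightarrow> ('w \<Rightarrow> 'v ugraph) \<Rightarrow> bool" where
  "random_regular_graph d n M G \<longleftrightarrow>
     prob_space M \<and> G \<in> measurable M (count_space UNIV) \<and> (AE \<omega> in M. regular_graph d n (G \<omega>))"


section \<open>The Potts model\<close>

definition Z_Potts :: "'v ugraph \<Rightarrow> nat \<Rightarrow> real \<Rightarrow> real \<Rightarrow> real" where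
  "Z_Potts G q \<beta> B =
     (\<Sum>\<sigma> \<in> verts G \<rightarrow>\<^sub>E {1..q}.
        exp (\<beta> * (\<Sum>e\<in>edges G. of_bool (\<forall>u\<in>e. \<forall>v\<in>e. \<sigma> u = \<sigma> v))
             + B * (\<Sum>v\<in>verts G. of_bool (\<sigma> v = 1))))"


section \<open>The Bethe prediction\<close>

text \<open>Outside \<open>{1..q}\<close> a probability vector takes the value \<open>undefined\<close>.\<close>

definition prob_vectors :: "nat \<Rightarrow> (nat \<Rightarrow> real) set" where
  "prob_vectors q = {\<nu> \<in> {1..q} \<rightarrow>\<^sub>E {0..}. (\<Sum>s=1..q. \<nu> s) = 1}"

definition Bethe_functional ::
  "nat \<Rightarrow> nat \<Rightarrow> real \<Rightarrow> real \<Rightarrow> (nat \<Rightarrow> real) \<Rightarrow> real" where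
  "Bethe_functional d q \<beta> B \<nu> =
     ln (\<Sum>s=1..q. exp (B * of_bool (s = 1)) *
           (\<Sum>t=1..q. exp (\<beta> * of_bool (s = t)) * \<nu> t) ^ d)
     - real d / 2 * ln (\<Sum>s=1..q. \<Sum>t=1..q. exp (\<beta> * of_bool (s = t)) * \<nu> s * \<nu> t)"

definition BP_fixed_points :: "nat \<Rightarrow> nat \<Rightarrow> real \<Rightarrow> real \<Rightarrow> (nat \<Rightarrow> real) set" where
  "BP_fixed_points d q \<beta> B =
     {\<nu> \<in> prob_vectors q. \<exists>z>0. \<forall>s\<in>{1..q}.
        \<nu> s = 1 / z * exp (B * of_bool (s = 1)) *
                (\<Sum>t=1..q. exp (\<beta> * of_bool (s = t)) * \<nu> t) ^ (d - 1)}"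

text \<open>
  This is the supremum in the reals, which is meaningful here: for \<open>\<beta>, B \<ge> 0\<close> the functional is
  bounded on probability vectors, and a fixed point of the form \<open>(a, b, \<dots>, b)\<close> always exists.
\<close>

definition Bethe_prediction :: "nat \<Rightarrow> nat \<Rightarrow> real \<Rightarrow> real \<Rightarrow> real" where
  "Bethe_prediction d q \<beta> B =
     (SUP \<nu> \<in> BP_fixed_points d q \<beta> B. Bethe_functional d q \<beta> B \<nu>)"

end

theory Submission
  imports Defs
begin

text \<open>
  Write \<open>w = exp \<beta> - 1\<close> and expand the Potts partition function over edge subsets \<open>A\<close>. On a locally
  tree-like graph the components of \<open>A\<close> are, up to a few, small trees. Give all other components the
  color \<open>1\<close>; for the small ones decide between the color \<open>1\<close> and the remaining \<open>q - 1\<close> colors;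
  since a forest with \<open>k\<close> vertices and \<open>e\<close> edges has \<open>(q - 1) ^ (k - e)\<close> colorings constant on its
  trees, the second choice again factorises over vertices and edges. Up to a factor \<open>exp (o(n))\<close> the
  partition function is thus that of a ferromagnetic two-spin model, that is, of an Ising model in a
  field (an idea of Bencs, Borbenyi and Csikvari).

  For the Ising model, let \<open>u\<close> maximise the Bethe functional. Splitting the bond matrix as
  \<open>a a\<^sup>T + b b\<^sup>T\<close> with \<open>a\<close> the normalised image of \<open>u\<close> turns the partition function into a sum over edge
  subsets of products of vertex weights that depend on the degrees only. Stationarity kills degree
  \<open>1\<close> and makes all products nonnegative, so the empty subset gives a lower bound on every
  regular graph. For the upper bound raise the coupling from \<open>0\<close> in small steps: by the second
  Griffiths inequality a bond correlation in the graph is at most the one in a tree ball with plus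
  boundary condition. In a positive field the latter converges to the bond correlation of \<open>u\<close>,
  which is the derivative of the maximal Bethe functional.

  Finally, for fixed sum and sum of squares of \<open>\<nu>\<close> the Potts Bethe functional is largest at a vector
  \<open>(a, b, \<dots>, b)\<close> with \<open>a \<ge> b\<close>, where it coincides with the Ising one.
\<close>


section \<open>Balls and locally tree-like neighbourhoods\<close>

text \<open>For \<open>q \<ge> 3\<close> the Potts recursion may have several competing fixed
  points, and a comparison with trees under extremal boundary conditions is then not sharp. In the
  two-spin model the competition is governed by the field: for \<open>l > 1\<close> only one message
  ratio in \<open>(0, 1]\<close> is possible, \<open>l < 1\<close> reduces to this by a global flip,
  and \<open>l = 1\<close>, where two maximisers may coexist, is reached from above because the
  pressure is Lipschitz in \<open>ln l\<close>.

  The two colour classes give bonds of unequal diagonal weight. Equalising them costs a factor per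
  edge end at a plus vertex, which turns into a field only because all degrees are equal; this is
  the origin of \<open>D\<close>.

  In the interpolation the graph is controlled by the correlation at the right end of a step, the
  Bethe functional by the one at its left end. The mismatch telescopes, so no regularity of the
  maximiser in the coupling enters. All estimates are stated with a radius and a proportion of bad
  vertices for an arbitrary single graph, which serves deterministic and random sequences
  alike.\<close>

fun hop :: "'v set set \<Rightarrow> 'v \<Rightarrow> nat \<Rightarrow> 'v set" where
  "hop E v 0 = {v}"
| "hop E v (Suc k) = hop E v k \<union> {u. \<exists>w\<in>hop E v k. {w, u} \<in> E}"

text \<open>The unique neighbor is the parent of \<open>w\<close>; in particular no edge joins two vertices at the same
  distance from \<open>v\<close>.\<close>

definition tree_at :: "'v set set \<Rightarrow> 'v \<Rightarrow> nat \<Rightarrow> bool" where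
  "tree_at E v R \<longleftrightarrow> (\<forall>k<R. \<forall>w\<in>hop E v (Suc k) - hop E v k.
     \<exists>!u. u \<in> hop E v (Suc k) \<and> {u, w} \<in> E)"

lemma hop_mono: "j \<le> k \<Longrightarrow> hop E v j \<subseteq> hop E v k"
  by (induction k) (auto simp: le_Suc_eq)

lemma center_in_hop: "v \<in> hop E v k"
  using hop_mono[of 0 k E v] by auto

lemma hop_mono_edges: "A \<subseteq> E \<Longrightarrow> hop A v k \<subseteq> hop E v k"
  by (induction k) auto

lemma tree_at_mono: "tree_at E v R \<Longrightarrow> r \<le> R \<Longrightarrow> tree_at E v r"
  by (auto simp: tree_at_def simp del: hop.simps)

section \<open>Simple paths inside a ball\<close>

definition path_between :: "'v set set \<Rightarrow> 'v set \<Rightarrow> 'v \<Rightarrow> 'v \<Rightarrow> 'v list \<Rightarrow> bool" where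
  "path_between E X a b xs \<longleftrightarrow> xs \<noteq> [] \<and> hd xs = a \<and> last xs = b \<and> distinct xs \<and> set xs \<subseteq> X \<and>
     successively (\<lambda>u v. {u, v} \<in> E) xs"

text \<open>A step back onto the path is handled by cutting the path at \<open>c\<close>, which
  keeps it simple.\<close>

lemma path_between_extend:
  assumes "path_between E X a b xs" "{b, c} \<in> E" "c \<in> X"
  shows "\<exists>ys. path_between E X a c ys"
proof (cases "c \<in> set xs")
  case True
  then obtain us vs where xs: "xs = us @ c # vs" by (auto simp: in_set_conv_decomp)
  have "path_between E X a c (us @ [c])"
    using assms unfolding path_between_def xs
    by (auto simp: successively_append_iff hd_append)
  then show ?thesis by blast
next
  case False
  have "path_between E X a c (xs @ [c])"
    using assms False unfolding path_between_def
    by (auto simp: successively_append_iff)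
  then show ?thesis by blast
qed

lemma path_between_rev:
  assumes "path_between E X a b xs"
  shows "path_between E X b a (rev xs)"
  using assms unfolding path_between_def
  by (auto simp: hd_rev last_rev successively_rev insert_commute)

lemma path_between_mono:
  "path_between E X a b xs \<Longrightarrow> X \<subseteq> Y \<Longrightarrow> path_between E Y a b xs"
  unfolding path_between_def by auto

lemma hop_path_from_center:
  "u \<in> hop E v k \<Longrightarrow> \<exists>xs. path_between E (hop E v k) v u xs"
proof (induction k arbitrary: u)
  case 0
  then have "path_between E (hop E v 0) v u [v]" by (auto simp: path_between_def)
  then show ?case by blast
next
  case (Suc k)
  show ?case
  proof (cases "u \<in> hop E v k")
    case True
    then show ?thesis using Suc.IH path_between_mono[of E "hop E v k" v u _ "hop E v (Suc k)"] by auto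
  next
    case False
    then obtain w where w: "w \<in> hop E v k" "{w, u} \<in> E" using Suc.prems by auto
    then obtain xs where "path_between E (hop E v k) v w xs" using Suc.IH by blast
    then have "path_between E (hop E v (Suc k)) v w xs" by (rule path_between_mono) auto
    then show ?thesis using path_between_extend w Suc.prems by metis
  qed
qed

text \<open>Concatenation may repeat vertices, so the second path is appended one vertex at a time,
  with a cut whenever the path meets itself.\<close>

lemma path_between_trans:
  assumes "path_between E X b c ys" "path_between E X a b xs"
  shows "\<exists>zs. path_between E X a c zs"
  using assms
proof (induction ys arbitrary: c rule: rev_induct)
  case Nil
  then show ?case by (simp add: path_between_def)
next
  case (snoc y ys)
  show ?case
  proof (cases "ys = []")
    case True
    then show ?thesis using snoc.prems by (auto simp: path_between_def)
  next
    case False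
    then have "path_between E X b (last ys) ys" "{last ys, c} \<in> E" "c \<in> X"
      using snoc.prems(1) unfolding path_between_def by (auto simp: successively_append_iff)
    then show ?thesis using snoc.IH[of "last ys"] snoc.prems(2) path_between_extend by metis
  qed
qed

lemma hop_path:
  assumes "a \<in> hop E v k" "b \<in> hop E v k"
  shows "\<exists>xs. path_between E (hop E v k) a b xs"
  using assms hop_path_from_center path_between_rev path_between_trans by metis

lemma hop_walk:
  assumes "v \<in> verts G" "\<And>e. e \<in> edges G \<Longrightarrow> e \<subseteq> verts G" "u \<in> hop (edges G) v k"
  shows "\<exists>xs. walk_in G xs \<and> hd xs = v \<and> last xs = u \<and> length xs \<le> k + 1"
  using assms(3)
proof (induction k arbitrary: u)
  case 0
  then show ?case using assms(1) by (intro exI[of _ "[v]"]) (auto simp: walk_in_def)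
next
  case (Suc k)
  show ?case
  proof (cases "u \<in> hop (edges G) v k")
    case True
    then show ?thesis using Suc.IH by fastforce
  next
    case False
    then obtain w where w: "w \<in> hop (edges G) v k" "{w, u} \<in> edges G" using Suc.prems by auto
    then obtain xs where xs: "walk_in G xs" "hd xs = v" "last xs = w" "length xs \<le> k + 1"
      using Suc.IH by blast
    have "walk_in G (xs @ [u])"
      using xs w assms(2)[OF w(2)] by (auto simp: walk_in_def successively_append_iff)
    then show ?thesis using xs by (intro exI[of _ "xs @ [u]"]) (auto simp: walk_in_def)
  qed
qed

text \<open>The vertex \<open>w\<close> lies outside \<open>X\<close>, so appending it keeps the
  vertices distinct; \<open>a \<noteq> b\<close> provides the third vertex of the cycle.\<close>

lemma cycle_if_path:
  assumes "path_between E X a b xs" "w \<notin> X" "{b, w} \<in> E" "{w, a} \<in> E" "a \<noteq> b"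
    and "insert w X \<subseteq> verts G" and "\<And>e. e \<in> E \<Longrightarrow> e \<subseteq> insert w X \<Longrightarrow> e \<in> edges G"
  shows "\<exists>ys. cycle_in G ys"
proof -
  have ne: "xs \<noteq> []" using assms(1) by (auto simp: path_between_def)
  have suc: "successively (\<lambda>u v. {u, v} \<in> edges G) xs"
    by (rule successively_mono[of "\<lambda>u v. {u, v} \<in> E"])
      (use assms(1,7) in \<open>auto simp: path_between_def\<close>)
  have ab: "a \<in> set xs" "b \<in> set xs" "a \<in> X" "b \<in> X"
    using assms(1) ne hd_in_set[OF ne] last_in_set[OF ne] by (auto simp: path_between_def)
  have len: "2 \<le> length xs"
  proof (rule ccontr)
    assume "\<not> 2 \<le> length xs"
    then obtain z where "xs = [z]" using ne by (cases xs) (auto simp: Suc_le_eq)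
    then show False using assms(1,5) by (auto simp: path_between_def)
  qed
  have "cycle_in G (xs @ [w])"
    unfolding cycle_in_def walk_in_def
    using assms ne suc ab len
    by (auto simp: path_between_def successively_append_iff)
  then show ?thesis by blast
qed

text \<open>If a new vertex \<open>w\<close> had two neighbours in its ball, a simple path between
  them that avoids \<open>w\<close> would close up to a cycle. The cycle stays in the neighbourhood
  because \<open>hop\<close> is contained in the walk ball and the neighbourhood is an induced
  subgraph.\<close>

lemma tree_at_if_tree_graph:
  assumes G: "v \<in> verts G" "\<And>e. e \<in> edges G \<Longrightarrow> e \<subseteq> verts G \<and> card e = 2"
    and tree: "tree_graph (neighbourhood G v R)"
  shows "tree_at (edges G) v R"
proof -
  let ?E = "edges G" and ?N = "neighbourhood G v R"
  have hopb: "hop ?E v k \<subseteq> verts ?N" if "k \<le> R" for k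
  proof
    fix u assume u: "u \<in> hop ?E v k"
    obtain xs where xs: "walk_in G xs" "hd xs = v" "last xs = u" "length xs \<le> k + 1"
      using hop_walk[OF G(1) _ u] G(2) by blast
    then have "u \<in> verts G" by (auto simp: walk_in_def)
    then show "u \<in> verts ?N" using xs that
      by (auto simp: neighbourhood_def induced_subgraph_def graph_ball_def intro!: exI[of _ xs])
  qed
  have nc: "\<not> cycle_in ?N ys" for ys using tree by (auto simp: tree_graph_def)
  have EN: "e \<in> edges ?N" if "e \<in> ?E" "e \<subseteq> verts ?N" for e
    using that by (auto simp: neighbourhood_def induced_subgraph_def)
  show ?thesis unfolding tree_at_def
  proof (intro allI impI ballI)
    fix k w assume k: "k < R" and w: "w \<in> hop ?E v (Suc k) - hop ?E v k"
    then obtain u where u: "u \<in> hop ?E v k" "{u, w} \<in> ?E" by auto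
    have "u' = u" if u': "u' \<in> hop ?E v (Suc k)" "{u', w} \<in> ?E" for u'
    proof (rule ccontr)
      assume ne: "u' \<noteq> u"
      have "u' \<noteq> w" using G(2)[OF u'(2)] by auto
      have "\<exists>xs. path_between ?E (hop ?E v (Suc k) - {w}) u u' xs"
      proof (cases "u' \<in> hop ?E v k")
        case True
        then obtain xs where "path_between ?E (hop ?E v k) u u' xs" using hop_path u by metis
        then show ?thesis using path_between_mono[of ?E _ u u' xs "hop ?E v (Suc k) - {w}"] w by auto
      next
        \<comment> \<open>Here \<open>u'\<close> lies on the same sphere as \<open>w\<close>; the
          path leads to a neighbour \<open>p\<close> of \<open>u'\<close> one sphere further in and
          is then extended by \<open>u'\<close>.\<close>
        case False
        then obtain p where p: "p \<in> hop ?E v k" "{p, u'} \<in> ?E" using u' by auto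
        then obtain xs where "path_between ?E (hop ?E v k) u p xs" using hop_path u by metis
        then have "path_between ?E (hop ?E v (Suc k) - {w}) u p xs"
          using path_between_mono[of ?E _ u p xs "hop ?E v (Suc k) - {w}"] w by auto
        then show ?thesis using path_between_extend p u' \<open>u' \<noteq> w\<close> by (metis DiffI singletonD)
      qed
      then obtain xs where xs: "path_between ?E (hop ?E v (Suc k) - {w}) u u' xs" by blast
      have "\<exists>ys. cycle_in ?N ys"
      proof (rule cycle_if_path[OF xs])
        show "{w, u} \<in> ?E" using u by (simp add: insert_commute)
        show sub: "insert w (hop ?E v (Suc k) - {w}) \<subseteq> verts ?N"
          using hopb[of "Suc k"] k w by auto
        show "e \<in> edges ?N" if "e \<in> ?E" "e \<subseteq> insert w (hop ?E v (Suc k) - {w})" for e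
          using EN that sub by blast
      qed (use u' ne in auto)
      then show False using nc by blast
    qed
    then show "\<exists>!u. u \<in> hop ?E v (Suc k) \<and> {u, w} \<in> ?E" using u by auto
  qed
qed

lemma hop_Suc_subset: "hop E v k \<subseteq> hop E v (Suc k)"
  by auto

lemma hop_adjacent: "w \<in> hop E v k \<Longrightarrow> {w, u} \<in> E \<Longrightarrow> u \<in> hop E v (Suc k)"
  by auto

lemma hop_new_vertex:
  assumes "w \<in> hop E v (Suc k) - hop E v k"
  obtains u where "u \<in> hop E v k" "{u, w} \<in> E"
  using assms by auto

declare hop.simps(2)[simp del]

section \<open>Spin configurations and the Griffiths inequality\<close>

abbreviation spins :: "'v set \<Rightarrow> ('v \<Rightarrow> real) set" where
  "spins V \<equiv> V \<rightarrow>\<^sub>E {-1, 1}"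

lemma finite_spins: "finite V \<Longrightarrow> finite (spins V)"
  by (intro finite_PiE) auto

lemma sum_spins_prod:
  fixes g :: "'v \<Rightarrow> real \<Rightarrow> real"
  assumes "finite V"
  shows "(\<Sum>\<sigma>\<in>spins V. \<Prod>v\<in>V. g v (\<sigma> v)) = (\<Prod>v\<in>V. g v 1 + g v (-1))"
  using assms by (subst prod_sum_PiE[symmetric]) (auto simp: add.commute)

lemma spin_cases: "\<sigma> \<in> spins V \<Longrightarrow> v \<in> V \<Longrightarrow> \<sigma> v = 1 \<or> \<sigma> v = -1"
  by (auto simp: PiE_def Pi_def)

lemma spin_square: "\<sigma> \<in> spins V \<Longrightarrow> v \<in> V \<Longrightarrow> \<sigma> v * \<sigma> v = 1"
  using spin_cases by fastforce

lemma spins_update: "\<sigma> \<in> spins V \<Longrightarrow> u \<in> V \<Longrightarrow> s \<in> {-1, 1} \<Longrightarrow> \<sigma>(u := s) \<in> spins V"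
  by (auto simp: PiE_def Pi_def extensional_def)

text \<open>Flipping the spin at \<open>u\<close> permutes the configurations, so a summand may be
  averaged with its flip. The domain of summation does not change.\<close>

lemma sum_spins_update:
  assumes "u \<in> V"
  shows "(\<Sum>\<sigma>\<in>spins V. F \<sigma> :: real) = (\<Sum>\<sigma>\<in>spins V. (F (\<sigma>(u := 1)) + F (\<sigma>(u := -1))) / 2)"
proof -
  let ?fl = "\<lambda>\<sigma>. \<sigma>(u := - \<sigma> u)"
  have "bij_betw ?fl (spins V) (spins V)"
  proof (rule bij_betwI[where g = ?fl])
    have "?fl \<sigma> \<in> spins V" if "\<sigma> \<in> spins V" for \<sigma>
      using spins_update[OF that assms, of "- \<sigma> u"] spin_cases[OF that assms] by auto
    then show "?fl \<in> spins V \<rightarrow> spins V" "?fl \<in> spins V \<rightarrow> spins V" by blast+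
  qed auto
  then have "(\<Sum>\<sigma>\<in>spins V. F \<sigma>) = (\<Sum>\<sigma>\<in>spins V. F (?fl \<sigma>))"
    by (rule sum.reindex_bij_betw[symmetric])
  then have "(\<Sum>\<sigma>\<in>spins V. F \<sigma>) = (\<Sum>\<sigma>\<in>spins V. (F \<sigma> + F (?fl \<sigma>)) / 2)"
    by (simp add: sum.distrib flip: sum_divide_distrib)
  also have "\<dots> = (\<Sum>\<sigma>\<in>spins V. (F (\<sigma>(u := 1)) + F (\<sigma>(u := -1))) / 2)"
  proof (rule sum.cong[OF refl])
    fix \<sigma> assume "\<sigma> \<in> spins V"
    then have "\<sigma> u = 1 \<and> \<sigma>(u := 1) = \<sigma> \<or> \<sigma> u = -1 \<and> \<sigma>(u := -1) = \<sigma>"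
      using spin_cases[of \<sigma> V u] assms by (metis fun_upd_triv)
    then show "(F \<sigma> + F (?fl \<sigma>)) / 2 = (F (\<sigma>(u := 1)) + F (\<sigma>(u := -1))) / 2" by auto
  qed
  finally show ?thesis .
qed

text \<open>\<open>L\<close> collects the spins that \<open>f\<close> ignores. Summed-out vertices
  remain in the configuration space, so independence has to be a property of the function instead of
  its domain.\<close>

definition indep_of :: "'v set \<Rightarrow> (('v \<Rightarrow> real) \<Rightarrow> 'b) \<Rightarrow> bool" where
  "indep_of L f \<longleftrightarrow> (\<forall>\<sigma> \<tau>. (\<forall>v. v \<notin> L \<longrightarrow> \<sigma> v = \<tau> v) \<longrightarrow> f \<sigma> = f \<tau>)"

lemma indep_of_upd: "indep_of L f \<Longrightarrow> u \<in> L \<Longrightarrow> f (\<sigma>(u := s)) = f \<sigma>"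
  unfolding indep_of_def by (metis fun_upd_other)

lemma indep_of_subset: "indep_of L f \<Longrightarrow> L' \<subseteq> L \<Longrightarrow> indep_of L' f"
  unfolding indep_of_def by (meson in_mono)

lemma indep_of_mult:
  fixes f g :: "('v \<Rightarrow> real) \<Rightarrow> real"
  shows "indep_of L f \<Longrightarrow> indep_of L g \<Longrightarrow> indep_of L (\<lambda>\<sigma>. f \<sigma> * g \<sigma>)"
  unfolding indep_of_def by metis

lemma indep_of_prod:
  fixes f :: "'i \<Rightarrow> ('v \<Rightarrow> real) \<Rightarrow> real"
  assumes "\<And>i. i \<in> I \<Longrightarrow> indep_of L (f i)"
  shows "indep_of L (\<lambda>\<sigma>. \<Prod>i\<in>I. f i \<sigma>)"
  unfolding indep_of_def
proof (intro allI impI)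
  fix \<sigma> \<tau> :: "'v \<Rightarrow> real" assume "\<forall>v. v \<notin> L \<longrightarrow> \<sigma> v = \<tau> v"
  then show "(\<Prod>i\<in>I. f i \<sigma>) = (\<Prod>i\<in>I. f i \<tau>)"
    using assms unfolding indep_of_def by (intro prod.cong) auto
qed

text \<open>Vertices summed out are kept as dummy spins, which explains the factors \<open>1 / 2\<close>.\<close>

lemma sum_spins_decimate:
  fixes w :: "'v \<Rightarrow> ('v \<Rightarrow> real) \<Rightarrow> real \<Rightarrow> real"
  assumes "finite L" "L \<subseteq> V" "indep_of L f" "\<And>u. u \<in> L \<Longrightarrow> indep_of L (w u)"
  shows "(\<Sum>\<sigma>\<in>spins V. f \<sigma> * (\<Prod>u\<in>L. w u \<sigma> (\<sigma> u)))
    = (\<Sum>\<sigma>\<in>spins V. f \<sigma> * (\<Prod>u\<in>L. (w u \<sigma> 1 + w u \<sigma> (-1)) / 2))"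
  using assms
proof (induction L arbitrary: f rule: finite_induct)
  case empty
  then show ?case by simp
next
  case (insert u L)
  let ?g = "\<lambda>\<sigma>. f \<sigma> * (\<Prod>i\<in>L. w i \<sigma> (\<sigma> i))"
  have upd: "f (\<sigma>(u := s)) = f \<sigma>" "w i (\<sigma>(u := s)) = w i \<sigma>" if "i \<in> insert u L" for i \<sigma> s
    using indep_of_upd insert.prems that by (metis insertI1)+
  have g: "?g (\<sigma>(u := s)) = ?g \<sigma>" for \<sigma> s
  proof -
    have "(\<Prod>i\<in>L. w i (\<sigma>(u := s)) ((\<sigma>(u := s)) i)) = (\<Prod>i\<in>L. w i \<sigma> (\<sigma> i))"
      using insert.hyps upd by (intro prod.cong) auto
    then show ?thesis using upd by auto
  qed
  have "(\<Sum>\<sigma>\<in>spins V. f \<sigma> * (\<Prod>i\<in>insert u L. w i \<sigma> (\<sigma> i))) = (\<Sum>\<sigma>\<in>spins V. ?g \<sigma> * w u \<sigma> (\<sigma> u))"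
    using insert.hyps by (simp add: mult_ac)
  also have "\<dots> = (\<Sum>\<sigma>\<in>spins V. (?g \<sigma> * w u \<sigma> 1 + ?g \<sigma> * w u \<sigma> (-1)) / 2)"
    using insert.prems by (subst sum_spins_update[of u]) (auto simp only: g upd(2)[OF insertI1] fun_upd_same)
  also have "\<dots> = (\<Sum>\<sigma>\<in>spins V. (f \<sigma> * ((w u \<sigma> 1 + w u \<sigma> (-1)) / 2)) * (\<Prod>i\<in>L. w i \<sigma> (\<sigma> i)))"
    by (intro sum.cong) (auto simp: algebra_simps)
  also have "\<dots> = (\<Sum>\<sigma>\<in>spins V. (f \<sigma> * ((w u \<sigma> 1 + w u \<sigma> (-1)) / 2)) *
      (\<Prod>i\<in>L. (w i \<sigma> 1 + w i \<sigma> (-1)) / 2))"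
  proof (rule insert.IH)
    have "indep_of (insert u L) (w u)" using insert.prems by auto
    then have "indep_of (insert u L) (\<lambda>\<sigma>. (w u \<sigma> 1 + w u \<sigma> (-1)) / 2)"
      unfolding indep_of_def by metis
    then have "indep_of (insert u L) (\<lambda>\<sigma>. f \<sigma> * ((w u \<sigma> 1 + w u \<sigma> (-1)) / 2))"
      using insert.prems(2) by (intro indep_of_mult) auto
    then show "indep_of L (\<lambda>\<sigma>. f \<sigma> * ((w u \<sigma> 1 + w u \<sigma> (-1)) / 2))"
      by (rule indep_of_subset) auto
    show "indep_of L (w i)" if "i \<in> L" for i
      using insert.prems(3)[of i] that by (auto intro: indep_of_subset)
  qed (use insert.prems in auto)
  also have "\<dots> = (\<Sum>\<sigma>\<in>spins V. f \<sigma> * (\<Prod>i\<in>insert u L. (w i \<sigma> 1 + w i \<sigma> (-1)) / 2))"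
    using insert.hyps by (simp add: mult_ac)
  finally show ?case .
qed

section \<open>Nonnegative Walsh coefficients and the cone of multipliers\<close>

text \<open>Up to the factor \<open>2 ^ card V\<close> the sums are the Walsh coefficients of
  \<open>g\<close> on the cube of spin configurations.\<close>

definition pos_def :: "'v set \<Rightarrow> (('v \<Rightarrow> real) \<Rightarrow> real) \<Rightarrow> bool" where
  "pos_def V g \<longleftrightarrow> (\<forall>A\<subseteq>V. 0 \<le> (\<Sum>\<sigma>\<in>spins V. g \<sigma> * (\<Prod>v\<in>A. \<sigma> v)))"

text \<open>Defining the cone by its multiplication action makes its closure under products trivial.\<close>

definition griffiths_cone :: "'v set \<Rightarrow> (('v \<Rightarrow> real) \<Rightarrow> real) set" where
  "griffiths_cone V = {f. \<forall>g. pos_def V g \<longrightarrow> pos_def V (\<lambda>\<sigma>. f \<sigma> * g \<sigma>)}"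

text \<open>The sum factorises over the vertices, and a vertex of \<open>A\<close> contributes
  \<open>1 + (-1) = 0\<close>.\<close>

lemma pos_def_one:
  assumes "finite V"
  shows "pos_def V (\<lambda>_. 1)"
  unfolding pos_def_def
proof (intro allI impI)
  fix A assume A: "A \<subseteq> V"
  have "(\<Sum>\<sigma>\<in>spins V. 1 * (\<Prod>v\<in>A. \<sigma> v)) = (\<Sum>\<sigma>\<in>spins V. \<Prod>v\<in>V. if v \<in> A then \<sigma> v else 1)"
    using A assms by (intro sum.cong) (auto simp: prod.inter_restrict[symmetric] Int_absorb1)
  also have "\<dots> = (\<Prod>v\<in>V. (if v \<in> A then 1 else 1) + (if v \<in> A then -1 else 1))"
    by (rule sum_spins_prod[OF assms])
  also have "\<dots> \<ge> 0" by (intro prod_nonneg) auto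
  finally show "0 \<le> (\<Sum>\<sigma>\<in>spins V. 1 * (\<Prod>v\<in>A. \<sigma> v))" .
qed

lemma griffiths_cone_const: "c \<ge> 0 \<Longrightarrow> (\<lambda>_. c) \<in> griffiths_cone V"
  unfolding griffiths_cone_def pos_def_def by (auto simp: mult.assoc simp flip: sum_distrib_left)

lemma griffiths_cone_add:
  "f \<in> griffiths_cone V \<Longrightarrow> g \<in> griffiths_cone V \<Longrightarrow> (\<lambda>\<sigma>. f \<sigma> + g \<sigma>) \<in> griffiths_cone V"
  unfolding griffiths_cone_def pos_def_def
  by (simp add: distrib_right sum.distrib)

lemma griffiths_cone_mult:
  "f \<in> griffiths_cone V \<Longrightarrow> g \<in> griffiths_cone V \<Longrightarrow> (\<lambda>\<sigma>. f \<sigma> * g \<sigma>) \<in> griffiths_cone V"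
  unfolding griffiths_cone_def by (simp add: mult.assoc)

lemma griffiths_cone_prod:
  assumes "\<And>i. i \<in> I \<Longrightarrow> f i \<in> griffiths_cone V"
  shows "(\<lambda>\<sigma>. \<Prod>i\<in>I. f i \<sigma>) \<in> griffiths_cone V"
  using assms by (induction I rule: infinite_finite_induct)
    (auto intro: griffiths_cone_const griffiths_cone_mult)

text \<open>Multiplication by \<open>\<sigma> u\<close> only permutes the Walsh coefficients: since
  \<open>\<sigma> u * \<sigma> u = 1\<close>, the set \<open>A\<close> is exchanged with its
  symmetric difference with \<open>{u}\<close>.\<close>

lemma griffiths_cone_spin:
  assumes "finite V" "u \<in> V"
  shows "(\<lambda>\<sigma>. \<sigma> u) \<in> griffiths_cone V"
  unfolding griffiths_cone_def pos_def_def
proof (intro CollectI allI impI)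
  fix g A assume g: "\<forall>A\<subseteq>V. 0 \<le> (\<Sum>\<sigma>\<in>spins V. g \<sigma> * (\<Prod>v\<in>A. \<sigma> v))" and A: "A \<subseteq> V"
  define A' where "A' = (if u \<in> A then A - {u} else insert u A)"
  have fin: "finite A" using A assms finite_subset by blast
  have "(\<Sum>\<sigma>\<in>spins V. \<sigma> u * g \<sigma> * (\<Prod>v\<in>A. \<sigma> v)) = (\<Sum>\<sigma>\<in>spins V. g \<sigma> * (\<Prod>v\<in>A'. \<sigma> v))"
  proof (rule sum.cong[OF refl])
    fix \<sigma> assume "\<sigma> \<in> spins V"
    then have "\<sigma> u * \<sigma> u = 1" using assms(2) by (rule spin_square)
    then have "\<sigma> u * (\<Prod>v\<in>A. \<sigma> v) = (\<Prod>v\<in>A'. \<sigma> v)"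
    proof (cases "u \<in> A")
      case True
      have "\<sigma> u * (\<Prod>v\<in>A. \<sigma> v) = (\<sigma> u * \<sigma> u) * (\<Prod>v\<in>A - {u}. \<sigma> v)"
        by (simp only: prod.remove[OF fin True] mult.assoc)
      then show ?thesis using True \<open>\<sigma> u * \<sigma> u = 1\<close> by (simp add: A'_def)
    qed (use fin in \<open>simp add: A'_def\<close>)
    then show "\<sigma> u * g \<sigma> * (\<Prod>v\<in>A. \<sigma> v) = g \<sigma> * (\<Prod>v\<in>A'. \<sigma> v)"
      by (simp only: mult.assoc mult.left_commute[of "\<sigma> u"])
  qed
  also have "\<dots> \<ge> 0"
  proof -
    have "A' \<subseteq> V" using A assms by (auto simp: A'_def)
    then show ?thesis using g by blast
  qed
  finally show "0 \<le> (\<Sum>\<sigma>\<in>spins V. \<sigma> u * g \<sigma> * (\<Prod>v\<in>A. \<sigma> v))" .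
qed

lemma griffiths_cone_sum_nonneg:
  assumes "finite V" "f \<in> griffiths_cone V"
  shows "0 \<le> (\<Sum>\<sigma>\<in>spins V. f \<sigma>)"
proof -
  have "pos_def V (\<lambda>\<sigma>. f \<sigma> * 1)" using assms pos_def_one unfolding griffiths_cone_def by blast
  then show ?thesis unfolding pos_def_def by (auto dest: spec[of _ "{}"])
qed

text \<open>Ginibre's argument: duplicate the spins as \<open>\<sigma>\<close> and \<open>\<sigma> * \<omega>\<close> and fix \<open>\<omega>\<close>.\<close>

lemma griffiths_inequality:
  fixes k :: "'v set \<Rightarrow> real"
  assumes V: "finite V" and I: "\<And>C. C \<in> I \<Longrightarrow> C \<subseteq> V \<and> 0 \<le> k C \<and> k C \<le> 1"
    and f: "f \<in> griffiths_cone V" and B: "B \<subseteq> V"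
  defines "W \<equiv> \<lambda>\<sigma>. \<Prod>C\<in>I. 1 + k C * (\<Prod>v\<in>C. \<sigma> v)"
  shows "(\<Sum>\<sigma>\<in>spins V. W \<sigma> * f \<sigma>) * (\<Sum>\<sigma>\<in>spins V. W \<sigma> * (\<Prod>v\<in>B. \<sigma> v))
    \<le> (\<Sum>\<sigma>\<in>spins V. W \<sigma>) * (\<Sum>\<sigma>\<in>spins V. W \<sigma> * f \<sigma> * (\<Prod>v\<in>B. \<sigma> v))"
proof -
  define X where "X = (\<lambda>A (\<sigma>::'v \<Rightarrow> real). \<Prod>v\<in>A. \<sigma> v)"
  \<comment> \<open>For fixed \<open>\<sigma>\<close> the pointwise product is an involution of the
    cube, so \<open>\<tau>\<close> can be written as \<open>mul \<sigma> \<omega>\<close>. Only the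
    copy \<open>\<sigma>\<close> carries \<open>f\<close>, so no second copy of \<open>f\<close> has
    to be controlled.\<close>
  define mul where "mul = (\<lambda>\<sigma> \<omega>. \<lambda>v\<in>V. \<sigma> v * \<omega> v :: real)"
  have Xcone: "X A \<in> griffiths_cone V" if "A \<subseteq> V" for A
    using griffiths_cone_prod[of A "\<lambda>v \<sigma>. \<sigma> v" V] griffiths_cone_spin[OF V] that
    unfolding X_def by (metis (no_types, lifting) in_mono)
  have Xmul: "X A (mul \<sigma> \<omega>) = X A \<sigma> * X A \<omega>" if "A \<subseteq> V" for A \<sigma> \<omega>
  proof -
    have "X A (mul \<sigma> \<omega>) = (\<Prod>v\<in>A. \<sigma> v * \<omega> v)"
      unfolding X_def mul_def using that by (intro prod.cong) auto
    then show ?thesis by (simp add: X_def prod.distrib)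
  qed
  have X1: "X A \<sigma> = 1 \<or> X A \<sigma> = -1" if "A \<subseteq> V" "\<sigma> \<in> spins V" for A \<sigma>
  proof -
    have "\<bar>X A \<sigma>\<bar> = (\<Prod>v\<in>A. \<bar>\<sigma> v\<bar>)" by (simp add: X_def abs_prod)
    also have "\<dots> = 1" using that spin_cases by (intro prod.neutral) fastforce
    finally show ?thesis by linarith
  qed
  have bij: "bij_betw (mul \<sigma>) (spins V) (spins V)" if s: "\<sigma> \<in> spins V" for \<sigma>
  proof (rule bij_betwI[where g = "mul \<sigma>"])
    have "mul \<sigma> \<omega> \<in> spins V" if "\<omega> \<in> spins V" for \<omega>
    proof -
      have "\<sigma> v * \<omega> v \<in> {-1, 1}" if "v \<in> V" for v
        using spin_cases[OF s that] spin_cases[OF \<open>\<omega> \<in> spins V\<close> that] by auto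
      then show ?thesis by (auto simp: mul_def)
    qed
    then show "mul \<sigma> \<in> spins V \<rightarrow> spins V" by auto
    then show "mul \<sigma> \<in> spins V \<rightarrow> spins V" .
    have "mul \<sigma> (mul \<sigma> \<omega>) = \<omega>" if "\<omega> \<in> spins V" for \<omega>
      using spin_square[OF s] that
      by (auto simp: mul_def fun_eq_iff PiE_def extensional_def simp flip: mult.assoc)
    then show "\<omega> \<in> spins V \<Longrightarrow> mul \<sigma> (mul \<sigma> \<omega>) = \<omega>" "\<omega> \<in> spins V \<Longrightarrow> mul \<sigma> (mul \<sigma> \<omega>) = \<omega>" for \<omega>
      by auto
  qed
  let ?S = "spins V"
  have "(\<Sum>\<sigma>\<in>?S. W \<sigma>) * (\<Sum>\<sigma>\<in>?S. W \<sigma> * f \<sigma> * X B \<sigma>)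
      - (\<Sum>\<sigma>\<in>?S. W \<sigma> * f \<sigma>) * (\<Sum>\<sigma>\<in>?S. W \<sigma> * X B \<sigma>)
    = (\<Sum>\<sigma>\<in>?S. \<Sum>\<tau>\<in>?S. W \<sigma> * W \<tau> * f \<sigma> * (X B \<sigma> - X B \<tau>))"
  proof -
    have "(\<Sum>\<sigma>\<in>?S. W \<sigma>) * (\<Sum>\<sigma>\<in>?S. W \<sigma> * f \<sigma> * X B \<sigma>)
        = (\<Sum>\<sigma>\<in>?S. \<Sum>\<tau>\<in>?S. W \<sigma> * f \<sigma> * X B \<sigma> * W \<tau>)"
      by (subst mult.commute) (rule sum_product)
    moreover have "(\<Sum>\<sigma>\<in>?S. W \<sigma> * f \<sigma>) * (\<Sum>\<sigma>\<in>?S. W \<sigma> * X B \<sigma>)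
        = (\<Sum>\<sigma>\<in>?S. \<Sum>\<tau>\<in>?S. W \<sigma> * f \<sigma> * (W \<tau> * X B \<tau>))"
      by (rule sum_product)
    ultimately show ?thesis
      by (simp add: sum_subtractf[symmetric] algebra_simps)
  qed
  also have "\<dots> = (\<Sum>\<sigma>\<in>?S. \<Sum>\<omega>\<in>?S. W \<sigma> * W (mul \<sigma> \<omega>) * f \<sigma> * (X B \<sigma> - X B (mul \<sigma> \<omega>)))"
    by (intro sum.cong refl sum.reindex_bij_betw[OF bij, symmetric])
  also have "\<dots> = (\<Sum>\<omega>\<in>?S. \<Sum>\<sigma>\<in>?S. W \<sigma> * W (mul \<sigma> \<omega>) * f \<sigma> * (X B \<sigma> - X B (mul \<sigma> \<omega>)))"
    by (rule sum.swap)
  also have "\<dots> \<ge> 0"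
  proof (rule sum_nonneg)
    fix \<omega> assume w: "\<omega> \<in> ?S"
    \<comment> \<open>Each pair of factors becomes a constant plus a multiple of
      \<open>X C \<sigma>\<close>, because \<open>X C \<sigma>\<close> squares to \<open>1\<close>.
      With \<open>\<omega>\<close> fixed both coefficients are nonnegative; for the constant one
      this uses \<open>k C \<le> 1\<close>.\<close>
    have eq: "W \<sigma> * W (mul \<sigma> \<omega>) * f \<sigma> * (X B \<sigma> - X B (mul \<sigma> \<omega>)) =
        (\<Prod>C\<in>I. (1 + (k C)\<^sup>2 * X C \<omega>) + (k C * (1 + X C \<omega>)) * X C \<sigma>) * f \<sigma> * ((1 - X B \<omega>) * X B \<sigma>)"
      if s: "\<sigma> \<in> ?S" for \<sigma>
    proof -
      have "W \<sigma> * W (mul \<sigma> \<omega>) = (\<Prod>C\<in>I. (1 + k C * X C \<sigma>) * (1 + k C * X C (mul \<sigma> \<omega>)))"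
        unfolding W_def X_def[symmetric] by (metis (no_types, lifting) prod.cong prod.distrib X_def)
      also have "\<dots> = (\<Prod>C\<in>I. (1 + (k C)\<^sup>2 * X C \<omega>) + (k C * (1 + X C \<omega>)) * X C \<sigma>)"
      proof (rule prod.cong[OF refl])
        fix C assume "C \<in> I"
        then have C: "C \<subseteq> V" using I by auto
        have sq: "X C \<sigma> * (X C \<sigma> * z) = z" for z using X1[OF C s] by auto
        show "(1 + k C * X C \<sigma>) * (1 + k C * X C (mul \<sigma> \<omega>)) =
            (1 + (k C)\<^sup>2 * X C \<omega>) + (k C * (1 + X C \<omega>)) * X C \<sigma>"
          unfolding Xmul[OF C] using X1[OF C s] by (auto simp: algebra_simps power2_eq_square)
      qed
      finally show ?thesis unfolding Xmul[OF B] by (simp add: algebra_simps)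
    qed
    have c1: "(\<lambda>\<sigma>. (1 + (k C)\<^sup>2 * X C \<omega>) + (k C * (1 + X C \<omega>)) * X C \<sigma>) \<in> griffiths_cone V"
      if "C \<in> I" for C
    proof -
      have C: "C \<subseteq> V" "0 \<le> k C" "k C \<le> 1" using I that by auto
      have "0 \<le> 1 + (k C)\<^sup>2 * X C \<omega>"
        using X1[OF C(1) w] C by (auto simp: power_le_one)
      moreover have "0 \<le> k C * (1 + X C \<omega>)" using X1[OF C(1) w] C by auto
      ultimately show ?thesis
        using Xcone[OF C(1)] by (intro griffiths_cone_add griffiths_cone_mult griffiths_cone_const)
    qed
    have c2: "0 \<le> 1 - X B \<omega>" using X1[OF B w] by auto
    show "0 \<le> (\<Sum>\<sigma>\<in>?S. W \<sigma> * W (mul \<sigma> \<omega>) * f \<sigma> * (X B \<sigma> - X B (mul \<sigma> \<omega>)))"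
      using c1 c2 f Xcone[OF B]
      by (subst sum.cong[OF refl eq])
        (auto intro!: griffiths_cone_sum_nonneg[OF V] griffiths_cone_mult griffiths_cone_prod
          griffiths_cone_const)
  qed
  finally show ?thesis by (simp add: X_def mult.assoc)
qed

section \<open>The Ising model and its Bethe lower bound on regular graphs\<close>

definition monochromatic :: "('v \<Rightarrow> 'c) \<Rightarrow> 'v set \<Rightarrow> bool" where
  "monochromatic \<sigma> e \<longleftrightarrow> (\<forall>u\<in>e. \<forall>v\<in>e. \<sigma> u = \<sigma> v)"

text \<open>Up to a constant per vertex this is \<open>exp (h * s)\<close> with
  \<open>l = exp (2 * h)\<close>; likewise the bond parameter \<open>x\<close> is
  \<open>exp (2 * J)\<close> for a coupling \<open>J\<close>.\<close>

definition field_weight :: "real \<Rightarrow> real \<Rightarrow> real" where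
  "field_weight l s = (if s = 1 then l else 1)"

definition bond_weight :: "real \<Rightarrow> ('v \<Rightarrow> real) \<Rightarrow> 'v set \<Rightarrow> real" where
  "bond_weight x \<sigma> e = (if monochromatic \<sigma> e then x else 1)"

lemma bond_weight_pair: "bond_weight x \<sigma> {u, v} = (if \<sigma> u = \<sigma> v then x else 1)"
  by (auto simp: bond_weight_def monochromatic_def)

definition ising_weight :: "'v set \<Rightarrow> 'v set set \<Rightarrow> real \<Rightarrow> real \<Rightarrow> ('v \<Rightarrow> real) \<Rightarrow> real" where
  "ising_weight V E x l \<sigma> = (\<Prod>v\<in>V. field_weight l (\<sigma> v)) * (\<Prod>e\<in>E. bond_weight x \<sigma> e)"

definition Z_Ising :: "'v set \<Rightarrow> 'v set set \<Rightarrow> real \<Rightarrow> real \<Rightarrow> real" where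
  "Z_Ising V E x l = (\<Sum>\<sigma>\<in>spins V. ising_weight V E x l \<sigma>)"

text \<open>The quadratic form of the bond matrix, with diagonal entries \<open>x\<close> and
  off-diagonal entries \<open>1\<close>.\<close>

definition ising_form :: "real \<Rightarrow> real \<Rightarrow> real \<Rightarrow> real" where
  "ising_form x s t = x * s\<^sup>2 + 2 * s * t + x * t\<^sup>2"

locale regular =
  fixes V :: "'v set" and E :: "'v set set" and d :: nat
  assumes finite_V: "finite V"
    and edge: "e \<in> E \<Longrightarrow> e \<subseteq> V" "e \<in> E \<Longrightarrow> card e = 2"
    and degree: "v \<in> V \<Longrightarrow> card {e \<in> E. v \<in> e} = d"
begin

lemma finite_E: "finite E"
  using edge finite_V by (meson Pow_iff finite_Pow_iff finite_subset subsetI)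

lemma edge_cases:
  assumes "e \<in> E"
  obtains u v where "e = {u, v}" "u \<noteq> v" "u \<in> V" "v \<in> V"
  using edge[OF assms] by (metis card_2_iff insert_subset)

lemma prod_edges:
  fixes g :: "'v \<Rightarrow> real"
  assumes "A \<subseteq> E"
  shows "(\<Prod>e\<in>A. \<Prod>v\<in>e. g v) = (\<Prod>v\<in>V. g v ^ card {e \<in> A. v \<in> e})"
proof -
  have fA: "finite A" using assms finite_E finite_subset by blast
  have "(\<Prod>e\<in>A. \<Prod>v\<in>e. g v) = (\<Prod>e\<in>A. \<Prod>v\<in>V. if v \<in> e then g v else 1)"
  proof (rule prod.cong[OF refl])
    fix e assume "e \<in> A"
    then have "e \<subseteq> V" using assms edge by auto
    then show "(\<Prod>v\<in>e. g v) = (\<Prod>v\<in>V. if v \<in> e then g v else 1)"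
      using finite_V by (simp add: Int_absorb1 flip: prod.inter_restrict)
  qed
  also have "\<dots> = (\<Prod>v\<in>V. \<Prod>e\<in>A. if v \<in> e then g v else 1)" by (rule prod.swap)
  also have "\<dots> = (\<Prod>v\<in>V. g v ^ card {e \<in> A. v \<in> e})"
    using fA by (intro prod.cong refl) (simp flip: prod.inter_filter)
  finally show ?thesis .
qed

lemma sum_edges:
  fixes g :: "'v \<Rightarrow> 'v set \<Rightarrow> real"
  shows "(\<Sum>e\<in>E. \<Sum>v\<in>e. g v e) = (\<Sum>v\<in>V. \<Sum>e\<in>{e \<in> E. v \<in> e}. g v e)"
proof -
  have "(\<Sum>e\<in>E. \<Sum>v\<in>e. g v e) = (\<Sum>e\<in>E. \<Sum>v\<in>V. if v \<in> e then g v e else 0)"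
  proof (rule sum.cong[OF refl])
    fix e assume "e \<in> E"
    then have "e \<subseteq> V" using edge by auto
    then show "(\<Sum>v\<in>e. g v e) = (\<Sum>v\<in>V. if v \<in> e then g v e else 0)"
      using finite_V by (simp add: Int_absorb1 flip: sum.inter_restrict)
  qed
  also have "\<dots> = (\<Sum>v\<in>V. \<Sum>e\<in>E. if v \<in> e then g v e else 0)" by (rule sum.swap)
  also have "\<dots> = (\<Sum>v\<in>V. \<Sum>e\<in>{e \<in> E. v \<in> e}. g v e)"
    by (intro sum.cong refl sum.inter_filter[symmetric] finite_E)
  finally show ?thesis .
qed

lemma card_E: "2 * real (card E) = real d * real (card V)"
proof -
  have "(\<Sum>e\<in>E. \<Sum>v\<in>e. 1::real) = (\<Sum>v\<in>V. \<Sum>e\<in>{e \<in> E. v \<in> e}. 1)" by (rule sum_edges)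
  then show ?thesis using edge(2) degree by (simp add: mult.commute)
qed

section \<open>Expansion over edge subsets when every bond is a sum of two products\<close>

text \<open>\<open>A\<close> is the set of edges from which the term \<open>b\<close> is chosen. A
  vertex meeting \<open>k\<close> of them meets \<open>d - k\<close> of the others, so summing out
  its spin gives \<open>f k\<close>.\<close>

lemma factor_graph_expansion:
  fixes a b \<psi> :: "real \<Rightarrow> real"
  defines "f \<equiv> \<lambda>k. \<psi> 1 * a 1 ^ (d - k) * b 1 ^ k + \<psi> (-1) * a (-1) ^ (d - k) * b (-1) ^ k"
  shows "(\<Sum>\<sigma>\<in>spins V. (\<Prod>v\<in>V. \<psi> (\<sigma> v)) * (\<Prod>e\<in>E. (\<Prod>v\<in>e. b (\<sigma> v)) + (\<Prod>v\<in>e. a (\<sigma> v))))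
    = (\<Sum>A\<in>Pow E. \<Prod>v\<in>V. f (card {e \<in> A. v \<in> e}))"
proof -
  let ?D = "\<lambda>A v. card {e \<in> A. v \<in> e}"
  have "(\<Prod>v\<in>V. \<psi> (\<sigma> v)) * (\<Prod>e\<in>E. (\<Prod>v\<in>e. b (\<sigma> v)) + (\<Prod>v\<in>e. a (\<sigma> v)))
      = (\<Sum>A\<in>Pow E. \<Prod>v\<in>V. \<psi> (\<sigma> v) * a (\<sigma> v) ^ (d - ?D A v) * b (\<sigma> v) ^ ?D A v)" for \<sigma>
  proof -
    have "(\<Prod>e\<in>E. (\<Prod>v\<in>e. b (\<sigma> v)) + (\<Prod>v\<in>e. a (\<sigma> v))) =
        (\<Sum>A\<in>Pow E. (\<Prod>e\<in>A. \<Prod>v\<in>e. b (\<sigma> v)) * (\<Prod>e\<in>E - A. \<Prod>v\<in>e. a (\<sigma> v)))"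
      by (rule prod_add[OF finite_E])
    also have "\<dots> = (\<Sum>A\<in>Pow E. \<Prod>v\<in>V. a (\<sigma> v) ^ (d - ?D A v) * b (\<sigma> v) ^ ?D A v)"
    proof (rule sum.cong[OF refl])
      fix A assume "A \<in> Pow E"
      then have A: "A \<subseteq> E" "E - A \<subseteq> E" by auto
      have "?D (E - A) v = d - ?D A v" if "v \<in> V" for v
      proof -
        have "{e \<in> E - A. v \<in> e} = {e \<in> E. v \<in> e} - {e \<in> A. v \<in> e}" by auto
        moreover have "finite {e \<in> A. v \<in> e}" using A finite_E finite_subset by fastforce
        moreover have "{e \<in> A. v \<in> e} \<subseteq> {e \<in> E. v \<in> e}" using A by auto
        ultimately show ?thesis using degree[OF that] by (simp add: card_Diff_subset)
      qed
      then show "(\<Prod>e\<in>A. \<Prod>v\<in>e. b (\<sigma> v)) * (\<Prod>e\<in>E - A. \<Prod>v\<in>e. a (\<sigma> v)) =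
          (\<Prod>v\<in>V. a (\<sigma> v) ^ (d - ?D A v) * b (\<sigma> v) ^ ?D A v)"
        unfolding prod_edges[OF A(1)] prod_edges[OF A(2)]
        by (simp add: prod.distrib mult.commute)
    qed
    finally show ?thesis by (simp add: sum_distrib_left prod.distrib mult.assoc)
  qed
  then have "(\<Sum>\<sigma>\<in>spins V. (\<Prod>v\<in>V. \<psi> (\<sigma> v)) * (\<Prod>e\<in>E. (\<Prod>v\<in>e. b (\<sigma> v)) + (\<Prod>v\<in>e. a (\<sigma> v))))
    = (\<Sum>A\<in>Pow E. \<Sum>\<sigma>\<in>spins V. \<Prod>v\<in>V. \<psi> (\<sigma> v) * a (\<sigma> v) ^ (d - ?D A v) * b (\<sigma> v) ^ ?D A v)"
    by (simp only: sum.swap[of _ "Pow E"])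
  also have "\<dots> = (\<Sum>A\<in>Pow E. \<Prod>v\<in>V. f (?D A v))"
    unfolding f_def
    by (intro sum.cong refl sum_spins_prod[OF finite_V, where g = "\<lambda>v s. \<psi> s * a s ^ (d - ?D _ v) * b s ^ ?D _ v"])
  finally show ?thesis .
qed

text \<open>The condition \<open>f 1 = 0\<close> makes the two prefactors opposite, so
  \<open>f (Suc k) = K * (\<rho> ^ k - (- \<rho>') ^ k)\<close> as long as
  \<open>Suc k \<le> d\<close>. Hence either all \<open>f k\<close> or all
  \<open>(-1) ^ k * f k\<close> are nonnegative. In the second case the signs cancel, because the
  degrees in an edge subset have an even sum. So no summand is negative, and the one of the empty
  subset can be kept alone.\<close>

lemma factor_graph_lower_bound:
  fixes a b \<psi> :: "real \<Rightarrow> real"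
  defines "f \<equiv> \<lambda>k. \<psi> 1 * a 1 ^ (d - k) * b 1 ^ k + \<psi> (-1) * a (-1) ^ (d - k) * b (-1) ^ k"
  assumes pos: "a 1 > 0" "a (-1) > 0" "\<psi> 1 > 0" "\<psi> (-1) > 0" "b 1 \<ge> 0" "b (-1) \<le> 0" and crit: "f 1 = 0"
  shows "f 0 ^ card V \<le> (\<Sum>\<sigma>\<in>spins V. (\<Prod>v\<in>V. \<psi> (\<sigma> v)) * (\<Prod>e\<in>E. (\<Prod>v\<in>e. b (\<sigma> v)) + (\<Prod>v\<in>e. a (\<sigma> v))))"
proof (cases "d = 0")
  case True
  \<comment> \<open>For \<open>d = 0\<close> the exponent \<open>d - 1\<close> is truncated; without
    edges only the empty subset remains in the expansion.\<close>
  have "E = {}"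
  proof (rule equals0I)
    fix e assume e: "e \<in> E"
    then obtain v where v: "v \<in> e" "v \<in> V" using edge_cases by blast
    then have "card {e \<in> E. v \<in> e} \<noteq> 0" using e finite_E by auto
    then show False using degree v True by auto
  qed
  then show ?thesis
    using factor_graph_expansion[of \<psi> b a] by (simp add: f_def)
next
  case False
  let ?D = "\<lambda>A v. card {e \<in> A. v \<in> e}"
  define \<rho> where "\<rho> = b 1 / a 1"
  define \<rho>' where "\<rho>' = - b (-1) / a (-1)"
  define K where "K = \<psi> 1 * a 1 ^ (d - 1) * b 1"
  have K': "\<psi> (-1) * a (-1) ^ (d - 1) * b (-1) = - K"
    using crit by (simp add: f_def K_def)
  have K0: "K \<ge> 0" using pos by (simp add: K_def)
  have nn: "\<rho> \<ge> 0" "\<rho>' \<ge> 0" using pos divide_nonpos_pos[of "b (-1)" "a (-1)"] by (simp_all add: \<rho>_def \<rho>'_def)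
  have fk: "f (Suc k) = K * (\<rho> ^ k - (- \<rho>') ^ k)" if "Suc k \<le> d" for k
  proof -
    have pw: "a s ^ (d - Suc k) * b s ^ Suc k = a s ^ (d - 1) * b s * (b s / a s) ^ k" if "a s > 0" for s
    proof -
      have "a s ^ (d - 1) = a s ^ (d - Suc k) * a s ^ k"
        using \<open>Suc k \<le> d\<close> by (simp flip: power_add)
      then show ?thesis using that by (simp add: power_divide field_simps)
    qed
    have "f (Suc k) = \<psi> 1 * (a 1 ^ (d - 1) * b 1 * (b 1 / a 1) ^ k)
        + \<psi> (-1) * (a (-1) ^ (d - 1) * b (-1) * (b (-1) / a (-1)) ^ k)"
      unfolding f_def using pw[OF pos(1)] pw[OF pos(2)] by (simp only: mult.assoc)
    also have "\<dots> = K * \<rho> ^ k + (- K) * (b (-1) / a (-1)) ^ k"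
      unfolding K'[symmetric] unfolding K_def \<rho>_def by (simp only: mult.assoc)
    finally show ?thesis by (simp add: \<rho>'_def algebra_simps)
  qed
  \<comment> \<open>Odd powers of \<open>- \<rho>'\<close> are harmless in the first pattern and
    helpful in the second; for even exponents the comparison of \<open>\<rho>\<close> with
    \<open>\<rho>'\<close> decides which pattern holds.\<close>
  have sgn: "\<exists>c\<in>{1,-1::real}. \<forall>k\<le>d. 0 \<le> c ^ k * f k"
  proof (cases "\<rho>' \<le> \<rho>")
    case True
    have "0 \<le> f k" if "k \<le> d" for k
    proof (cases k)
      case 0
      then show ?thesis using pos by (simp add: f_def)
    next
      case (Suc j)
      have "(- \<rho>') ^ j \<le> \<rho> ^ j"
      proof (cases "even j")
        case True
        then show ?thesis using power_mono[OF \<open>\<rho>' \<le> \<rho>\<close> nn(2)] by simp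
      next
        case False
        then have "(- \<rho>') ^ j \<le> 0" using nn by simp
        also have "0 \<le> \<rho> ^ j" using nn by simp
        finally show ?thesis .
      qed
      then show ?thesis using fk[of j] that Suc K0 by simp
    qed
    then show ?thesis by (intro bexI[of _ 1]) auto
  next
    case False
    have "0 \<le> (-1) ^ k * f k" if "k \<le> d" for k
    proof (cases k)
      case 0
      then show ?thesis using pos by (simp add: f_def)
    next
      case (Suc j)
      have "0 \<le> (-1) ^ Suc j * (\<rho> ^ j - (- \<rho>') ^ j)"
      proof (cases "even j")
        case True
        then show ?thesis using power_mono[of \<rho> \<rho>' j] nn False by simp
      next
        case False
        then show ?thesis using nn by simp
      qed
      then have "0 \<le> K * ((-1) ^ Suc j * (\<rho> ^ j - (- \<rho>') ^ j))" using K0 by (rule mult_nonneg_nonneg[rotated])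
      then show ?thesis using fk[of j] that Suc by (simp only: mult.left_commute)
    qed
    then show ?thesis by (intro bexI[of _ "-1"]) auto
  qed
  then obtain c where c: "c \<in> {1,-1::real}" "\<And>k. k \<le> d \<Longrightarrow> 0 \<le> c ^ k * f k" by blast
  have nonneg: "0 \<le> (\<Prod>v\<in>V. f (?D A v))" if "A \<subseteq> E" for A
  proof -
    have "(\<Prod>v\<in>V. c ^ ?D A v) = (\<Prod>e\<in>A. \<Prod>v\<in>e. c)" using prod_edges[OF that, of "\<lambda>_. c"] by simp
    also have "\<dots> = 1" using edge(2) that c(1) by (intro prod.neutral) (auto simp: power2_eq_square)
    finally have "(\<Prod>v\<in>V. f (?D A v)) = (\<Prod>v\<in>V. c ^ ?D A v * f (?D A v))" by (simp add: prod.distrib)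
    also have "\<dots> \<ge> 0"
    proof (rule prod_nonneg)
      fix v assume "v \<in> V"
      then have "?D A v \<le> d"
        using degree[of v] that finite_E card_mono[of "{e \<in> E. v \<in> e}" "{e \<in> A. v \<in> e}"] by auto
      then show "0 \<le> c ^ ?D A v * f (?D A v)" by (rule c)
    qed
    finally show ?thesis .
  qed
  have "f 0 ^ card V = (\<Sum>A\<in>{{}}. \<Prod>v\<in>V. f (?D A v))" by simp
  also have "\<dots> \<le> (\<Sum>A\<in>Pow E. \<Prod>v\<in>V. f (?D A v))"
    using finite_E nonneg by (intro sum_mono2) auto
  finally show ?thesis unfolding factor_graph_expansion f_def .
qed

lemma Z_Ising_lower_bound:
  assumes "1 \<le> x" "0 < l" "0 < s" "0 < t" "0 < d"
    and BP: "l * (x * s + t) ^ (d - 1) = z * s" "(s + x * t) ^ (d - 1) = z * t"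
  shows "((l * (x * s + t) ^ d + (s + x * t) ^ d) / sqrt (ising_form x s t) ^ d) ^ card V \<le> Z_Ising V E x l"
proof -
  define Q where "Q = ising_form x s t"
  have Q: "Q > 0" using assms by (auto simp: Q_def ising_form_def intro!: add_pos_pos)
  define a where "a = (\<lambda>r::real. (if r = 1 then x * s + t else s + x * t) / sqrt Q)"
  \<comment> \<open>What is left of the bond matrix after removing the square of \<open>a\<close>
    kills \<open>(s, t)\<close>, so it is a multiple of the square of \<open>(t, -s)\<close>; the
    multiple is the determinant \<open>x\<^sup>2 - 1\<close> divided by \<open>Q\<close>.\<close>
  define b where "b = (\<lambda>r::real. sqrt ((x\<^sup>2 - 1) / Q) * (if r = 1 then t else - s))"
  have x2: "0 \<le> (x\<^sup>2 - 1) / Q" using assms Q by (simp add: power2_eq_square mult_ge1_I)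
  have sq: "sqrt Q * sqrt Q = Q" using Q by simp
  have sq2: "sqrt ((x\<^sup>2 - 1) / Q) * sqrt ((x\<^sup>2 - 1) / Q) = (x\<^sup>2 - 1) / Q"
    by (subst real_sqrt_mult_self) (rule abs_of_nonneg[OF x2])
  have ab: "b r * b r' + a r * a r' = (if r = r' then x else 1)" if "r \<in> {-1,1}" "r' \<in> {-1,1}" for r r'
  proof -
    have aa: "p / sqrt Q * (p' / sqrt Q) = p * p' / Q" for p p'
      using sq by (simp add: times_divide_times_eq)
    have bb: "sqrt ((x\<^sup>2 - 1) / Q) * p * (sqrt ((x\<^sup>2 - 1) / Q) * p') = (x\<^sup>2 - 1) * (p * p') / Q" for p p'
    proof -
      have "sqrt ((x\<^sup>2 - 1) / Q) * p * (sqrt ((x\<^sup>2 - 1) / Q) * p')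
        = (sqrt ((x\<^sup>2 - 1) / Q) * sqrt ((x\<^sup>2 - 1) / Q)) * (p * p')" by (simp only: mult_ac)
      then show ?thesis unfolding sq2 by simp
    qed
    have "(x\<^sup>2 - 1) * ((if r = 1 then t else - s) * (if r' = 1 then t else - s))
        + (if r = 1 then x * s + t else s + x * t) * (if r' = 1 then x * s + t else s + x * t)
        = (if r = r' then x else 1) * Q"
      using that by (auto simp: Q_def ising_form_def power2_eq_square algebra_simps)
    then show ?thesis using Q unfolding a_def b_def aa bb
      by (simp add: add_divide_distrib[symmetric])
  qed
  have edgew: "bond_weight x \<sigma> e = (\<Prod>v\<in>e. b (\<sigma> v)) + (\<Prod>v\<in>e. a (\<sigma> v))"
    if eE: "e \<in> E" and \<sigma>: "\<sigma> \<in> spins V" for e \<sigma>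
  proof -
    obtain u v where e: "e = {u, v}" "u \<noteq> v" "u \<in> V" "v \<in> V" using edge_cases[OF eE] .
    have "b (\<sigma> u) * b (\<sigma> v) + a (\<sigma> u) * a (\<sigma> v) = (if \<sigma> u = \<sigma> v then x else 1)"
      using spin_cases[OF \<sigma> e(3)] spin_cases[OF \<sigma> e(4)] by (intro ab) auto
    then show ?thesis using e(2) unfolding e(1) by (simp add: bond_weight_pair)
  qed
  have "(field_weight l 1 * a 1 ^ (d - 0) * b 1 ^ 0 + field_weight l (-1) * a (-1) ^ (d - 0) * b (-1) ^ 0) ^ card V
     \<le> (\<Sum>\<sigma>\<in>spins V. (\<Prod>v\<in>V. field_weight l (\<sigma> v)) * (\<Prod>e\<in>E. (\<Prod>v\<in>e. b (\<sigma> v)) + (\<Prod>v\<in>e. a (\<sigma> v))))"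
  proof (rule factor_graph_lower_bound)
    \<comment> \<open>Eliminating \<open>z\<close> from the two fixed-point equations gives the
      vanishing weight at degree one.\<close>
    have "l * ((x * s + t) ^ (d - 1) * t) = (s + x * t) ^ (d - 1) * s"
      using BP by (metis mult.assoc mult.commute)
    then show "field_weight l 1 * a 1 ^ (d - 1) * b 1 ^ 1 + field_weight l (-1) * a (-1) ^ (d - 1) * b (-1) ^ 1 = 0"
      by (simp add: a_def b_def field_weight_def power_divide field_simps)
  qed (use assms Q x2 in \<open>auto simp: a_def b_def field_weight_def add_pos_pos mult_nonneg_nonpos\<close>)
  also have "\<dots> = Z_Ising V E x l"
    unfolding Z_Ising_def ising_weight_def
    by (intro sum.cong arg_cong2[of _ _ _ _ "(*)"] prod.cong refl) (simp add: edgew)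
  finally have "(field_weight l 1 * a 1 ^ (d - 0) * b 1 ^ 0 + field_weight l (-1) * a (-1) ^ (d - 0) * b (-1) ^ 0) ^ card V
     \<le> Z_Ising V E x l" .
  moreover have "field_weight l 1 * a 1 ^ (d - 0) * b 1 ^ 0 + field_weight l (-1) * a (-1) ^ (d - 0) * b (-1) ^ 0
     = (l * (x * s + t) ^ d + (s + x * t) ^ d) / sqrt (ising_form x s t) ^ d"
    unfolding a_def field_weight_def power_divide by (simp add: Q_def add_divide_distrib)
  ultimately show ?thesis by (simp only:)
qed

end

section \<open>Bond correlations on trees\<close>

text \<open>The \<open>1 / 2\<close> belongs to the summed-out spin, which stays in the
  configuration as a dummy.\<close>

definition transfer :: "real \<Rightarrow> (real \<Rightarrow> real) \<Rightarrow> real \<Rightarrow> real" where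
  "transfer x m s = (x * m s + m (- s)) / 2"

context regular
begin

lemma card_neighbours:
  assumes "p \<in> V"
  shows "card {u. {u, p} \<in> E} = d"
proof -
  have "bij_betw (\<lambda>u. {u, p}) {u. {u, p} \<in> E} {e \<in> E. p \<in> e}"
    unfolding bij_betw_def
  proof
    show "inj_on (\<lambda>u. {u, p}) {u. {u, p} \<in> E}" by (auto simp: inj_on_def doubleton_eq_iff)
    show "(\<lambda>u. {u, p}) ` {u. {u, p} \<in> E} = {e \<in> E. p \<in> e}"
    proof (intro equalityI subsetI)
      fix e assume e: "e \<in> {e \<in> E. p \<in> e}"
      then have "e \<in> E" by simp
      then obtain a b where "e = {a, b}" by (rule edge_cases)
      then have "e = {a, p} \<or> e = {b, p}" using e by auto
      then show "e \<in> (\<lambda>u. {u, p}) ` {u. {u, p} \<in> E}" using e by auto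
    qed auto
  qed
  from bij_betw_same_card[OF this] show ?thesis using degree[OF assms] by simp
qed

lemma hop_subset:
  assumes "v \<in> V"
  shows "hop E v k \<subseteq> V"
proof (induction k)
  case (Suc k)
  show ?case
  proof
    fix u assume "u \<in> hop E v (Suc k)"
    then have "u \<in> hop E v k \<or> (\<exists>w. {w, u} \<in> E)" by (auto simp: hop.simps)
    then show "u \<in> V" using Suc edge(1) by blast
  qed
qed (use assms in simp)

lemma finite_hop: "v \<in> V \<Longrightarrow> finite (hop E v k)"
  using hop_subset finite_V finite_subset by metis

definition parent :: "'v \<Rightarrow> nat \<Rightarrow> 'v \<Rightarrow> 'v" where
  "parent v k w = (THE u. u \<in> hop E v (Suc k) \<and> {u, w} \<in> E)"

lemma parent_eq:
  assumes "tree_at E v R" "k < R" "w \<in> hop E v (Suc k) - hop E v k"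
    and "u \<in> hop E v (Suc k)" "{u, w} \<in> E"
  shows "parent v k w = u"
  unfolding parent_def using assms unfolding tree_at_def by (intro the1_equality) blast+

lemma parent_in:
  assumes "tree_at E v R" "k < R" "w \<in> hop E v (Suc k) - hop E v k"
  shows "parent v k w \<in> hop E v k" "{parent v k w, w} \<in> E"
proof -
  obtain u where u: "u \<in> hop E v k" "{u, w} \<in> E" using assms(3) by (rule hop_new_vertex)
  have "parent v k w = u" using u hop_Suc_subset[of E v k] by (intro parent_eq[OF assms]) auto
  then show "parent v k w \<in> hop E v k" "{parent v k w, w} \<in> E" using u by simp_all
qed

text \<open>An edge not contained in the smaller ball has an endpoint \<open>w\<close> on the new
  sphere and its other end in the larger ball; by uniqueness that end is the parent of
  \<open>w\<close>.\<close>

lemma hop_edges_Suc: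
  assumes "tree_at E v R" "k < R"
  shows "{e \<in> E. e \<subseteq> hop E v (Suc k)} =
    {e \<in> E. e \<subseteq> hop E v k} \<union> (\<lambda>w. {parent v k w, w}) ` (hop E v (Suc k) - hop E v k)"
    (is "?A = ?B \<union> ?C")
proof (intro equalityI subsetI)
  fix e assume e: "e \<in> ?A"
  show "e \<in> ?B \<union> ?C"
  proof (cases "e \<subseteq> hop E v k")
    case False
    then obtain w where w: "w \<in> e" "w \<notin> hop E v k" by auto
    have "e \<in> E" using e by simp
    then obtain a b where ab: "e = {a, b}" by (rule edge_cases)
    then obtain u where u: "e = {u, w}" using w by auto
    then have "parent v k w = u" using e w by (intro parent_eq[OF assms]) auto
    then show ?thesis using u w e by auto
  qed (use e in auto)
next
  fix e assume "e \<in> ?B \<union> ?C"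
  then consider "e \<in> ?B" | w where "w \<in> hop E v (Suc k) - hop E v k" "e = {parent v k w, w}" by blast
  then show "e \<in> ?A"
  proof cases
    case 1
    then show ?thesis using hop_Suc_subset[of E v k] by blast
  next
    case 2
    then show ?thesis using parent_in[OF assms 2(1)] hop_Suc_subset[of E v k] by auto
  qed
qed

lemma inj_on_parent_edge:
  assumes "tree_at E v R" "k < R"
  shows "inj_on (\<lambda>w. {parent v k w, w}) (hop E v (Suc k) - hop E v k)"
proof (rule inj_onI)
  fix w w' assume w: "w \<in> hop E v (Suc k) - hop E v k" "w' \<in> hop E v (Suc k) - hop E v k"
    and eq: "{parent v k w, w} = {parent v k w', w'}"
  have "parent v k w \<in> hop E v k" using parent_in[OF assms w(1)] by auto
  then show "w = w'" using eq w by (auto simp: doubleton_eq_iff)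
qed

lemma prod_hop_edges_Suc:
  fixes h :: "'v set \<Rightarrow> real"
  assumes v: "v \<in> V" and "tree_at E v R" "k < R"
  shows "(\<Prod>e\<in>{e \<in> E. e \<subseteq> hop E v (Suc k)}. h e) =
    (\<Prod>e\<in>{e \<in> E. e \<subseteq> hop E v k}. h e) * (\<Prod>w\<in>hop E v (Suc k) - hop E v k. h {parent v k w, w})"
proof -
  have "(\<Prod>e\<in>{e \<in> E. e \<subseteq> hop E v (Suc k)}. h e) =
    (\<Prod>e\<in>{e \<in> E. e \<subseteq> hop E v k}. h e) *
    (\<Prod>e\<in>(\<lambda>w. {parent v k w, w}) ` (hop E v (Suc k) - hop E v k). h e)"
    unfolding hop_edges_Suc[OF assms(2,3)]
    by (rule prod.union_disjoint) (use finite_E finite_hop[OF v] in auto)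
  then show ?thesis by (simp add: prod.reindex[OF inj_on_parent_edge[OF assms(2,3)]])
qed

text \<open>By uniqueness of the parent, all other neighbours of \<open>p\<close> lie outside the
  ball of radius \<open>Suc k\<close>, hence on the next sphere; \<open>Suc k < R\<close> then makes
  \<open>p\<close> the parent of each of them.\<close>

lemma card_children:
  assumes v: "v \<in> V" and tree: "tree_at E v R" and k: "Suc k < R"
    and p: "p \<in> hop E v (Suc k) - hop E v k"
  shows "card {w \<in> hop E v (Suc (Suc k)) - hop E v (Suc k). parent v (Suc k) w = p} = d - 1"
proof -
  have "p \<in> V" using hop_subset[OF v] p by blast
  have "{w \<in> hop E v (Suc (Suc k)) - hop E v (Suc k). parent v (Suc k) w = p}
      = {u. {u, p} \<in> E} - {parent v k p}" (is "?L = ?R")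
  proof (intro equalityI subsetI)
    fix w assume w: "w \<in> ?L"
    then have "{p, w} \<in> E" using parent_in(2)[OF tree k, of w] by auto
    moreover have "w \<noteq> parent v k p"
      using parent_in(1)[OF tree _ p] k w hop_Suc_subset[of E v k] by auto
    ultimately show "w \<in> ?R" by (simp add: insert_commute)
  next
    fix w assume w: "w \<in> ?R"
    then have pw: "{p, w} \<in> E" by (simp add: insert_commute)
    have "w \<notin> hop E v (Suc k)"
      using parent_eq[OF tree _ p, of w] w k by auto
    moreover have "w \<in> hop E v (Suc (Suc k))" by (rule hop_adjacent[OF _ pw]) (use p in simp)
    ultimately show "w \<in> ?L" using parent_eq[OF tree k, of w p] pw p hop_Suc_subset[of E v "Suc k"] by auto
  qed
  moreover have "parent v k p \<in> {u. {u, p} \<in> E}" using parent_in(2)[OF tree _ p] k by simp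
  ultimately show ?thesis using card_neighbours[OF \<open>p \<in> V\<close>] by simp
qed

section \<open>Eliminating a tree ball sphere by sphere\<close>

text \<open>On the outermost sphere \<open>m\<close> stands for everything a vertex carries, instead
  of its field weight. This is the shape that is reproduced when a sphere is removed.\<close>

definition ball_weight :: "real \<Rightarrow> real \<Rightarrow> 'v \<Rightarrow> nat \<Rightarrow> (real \<Rightarrow> real) \<Rightarrow> ('v \<Rightarrow> real) \<Rightarrow> real" where
  "ball_weight x l v k m \<sigma> = (\<Prod>e\<in>{e \<in> E. e \<subseteq> hop E v (Suc k)}. bond_weight x \<sigma> e) *
     (\<Prod>u\<in>hop E v k. field_weight l (\<sigma> u)) * (\<Prod>u\<in>hop E v (Suc k) - hop E v k. m (\<sigma> u))"

lemma indep_of_bond_weight: "e \<inter> L = {} \<Longrightarrow> indep_of L (\<lambda>\<sigma>. bond_weight x \<sigma> e)"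
  unfolding indep_of_def bond_weight_def monochromatic_def by (metis disjoint_iff)

lemma indep_of_site: "u \<notin> L \<Longrightarrow> indep_of L (\<lambda>\<sigma>. m (\<sigma> u))"
  unfolding indep_of_def by simp

text \<open>One step of belief propagation: a leaf turns into a \<open>transfer\<close> factor at
  its parent, and the \<open>d - 1\<close> leaves of a parent are collected into a power.
  \<open>g\<close> stands for all remaining factors, which must not see the removed sphere.\<close>

lemma ball_weight_step:
  assumes v: "v \<in> V" and tree: "tree_at E v R" and k: "Suc k < R"
    and g: "indep_of (hop E v (Suc (Suc k)) - hop E v (Suc k)) g"
  shows "(\<Sum>\<sigma>\<in>spins V. g \<sigma> * ball_weight x l v (Suc k) m \<sigma>) =
    (\<Sum>\<sigma>\<in>spins V. g \<sigma> * ball_weight x l v k (\<lambda>s. field_weight l s * transfer x m s ^ (d - 1)) \<sigma>)"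
proof -
  let ?H = "hop E v"
  define L where "L = ?H (Suc (Suc k)) - ?H (Suc k)"
  define L' where "L' = ?H (Suc k) - ?H k"
  define par where "par = parent v (Suc k)"
  have LV: "L \<subseteq> V" using hop_subset[OF v] unfolding L_def by blast
  have fin: "finite L" "finite L'" using LV finite_V finite_hop[OF v] by (auto simp: L'_def intro: finite_subset)
  have parL: "par w \<in> L'" if "w \<in> L" for w
  proof -
    have 1: "par w \<in> ?H (Suc k)" "{par w, w} \<in> E"
      using parent_in[OF tree k] that unfolding par_def L_def by auto
    moreover have "par w \<notin> ?H k"
    proof
      assume "par w \<in> ?H k"
      then have "w \<in> ?H (Suc k)" using 1(2) by (rule hop_adjacent)
      then show False using that unfolding L_def by simp
    qed
    ultimately show ?thesis by (simp add: L'_def)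
  qed
  let ?W = "\<lambda>\<sigma>. (\<Prod>e\<in>{e \<in> E. e \<subseteq> ?H (Suc k)}. bond_weight x \<sigma> e) * (\<Prod>u\<in>?H (Suc k). field_weight l (\<sigma> u))"
  let ?w = "\<lambda>u \<sigma> s. (if \<sigma> (par u) = s then x else 1) * m s"
  have "(\<Sum>\<sigma>\<in>spins V. g \<sigma> * ball_weight x l v (Suc k) m \<sigma>) =
    (\<Sum>\<sigma>\<in>spins V. (g \<sigma> * ?W \<sigma>) * (\<Prod>u\<in>L. ?w u \<sigma> (\<sigma> u)))"
    unfolding ball_weight_def prod_hop_edges_Suc[OF v tree k] bond_weight_pair
    by (simp add: prod.distrib L_def par_def mult_ac)
  also have "\<dots> = (\<Sum>\<sigma>\<in>spins V. (g \<sigma> * ?W \<sigma>) * (\<Prod>u\<in>L. (?w u \<sigma> 1 + ?w u \<sigma> (-1)) / 2))"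
  proof (rule sum_spins_decimate[OF fin(1) LV])
    have "indep_of L ?W"
    proof (intro indep_of_mult indep_of_prod)
      show "indep_of L (\<lambda>\<sigma>. bond_weight x \<sigma> e)" if "e \<in> {e \<in> E. e \<subseteq> ?H (Suc k)}" for e
        using that by (intro indep_of_bond_weight) (auto simp: L_def)
      show "indep_of L (\<lambda>\<sigma>. field_weight l (\<sigma> u))" if "u \<in> ?H (Suc k)" for u
        using that by (intro indep_of_site) (auto simp: L_def)
    qed
    with g[folded L_def] show "indep_of L (\<lambda>\<sigma>. g \<sigma> * ?W \<sigma>)" by (rule indep_of_mult)
    show "indep_of L (?w u)" if "u \<in> L" for u
    proof -
      have "par u \<notin> L" using parL[OF that] by (auto simp: L'_def L_def)
      then show ?thesis unfolding indep_of_def by simp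
    qed
  qed
  also have "\<dots> = (\<Sum>\<sigma>\<in>spins V. g \<sigma> * ball_weight x l v k (\<lambda>s. field_weight l s * transfer x m s ^ (d - 1)) \<sigma>)"
  proof (rule sum.cong[OF refl])
    fix \<sigma> assume \<sigma>: "\<sigma> \<in> spins V"
    have "(\<Prod>u\<in>L. (?w u \<sigma> 1 + ?w u \<sigma> (-1)) / 2) = (\<Prod>u\<in>L. transfer x m (\<sigma> (par u)))"
    proof (rule prod.cong[OF refl])
      fix u assume "u \<in> L"
      then have "par u \<in> V" using parL hop_subset[OF v] unfolding L'_def by blast
      then show "(?w u \<sigma> 1 + ?w u \<sigma> (-1)) / 2 = transfer x m (\<sigma> (par u))"
        using spin_cases[OF \<sigma>] by (fastforce simp: transfer_def)
    qed
    also have "\<dots> = (\<Prod>p\<in>L'. \<Prod>u\<in>{u \<in> L. par u = p}. transfer x m (\<sigma> (par u)))"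
      using parL by (intro prod.group[symmetric] fin) auto
    also have "\<dots> = (\<Prod>p\<in>L'. transfer x m (\<sigma> p) ^ (d - 1))"
    proof (rule prod.cong[OF refl])
      fix p assume "p \<in> L'"
      then have "card {u \<in> L. par u = p} = d - 1"
        using card_children[OF v tree k] unfolding L_def L'_def par_def by blast
      then show "(\<Prod>u\<in>{u \<in> L. par u = p}. transfer x m (\<sigma> (par u))) = transfer x m (\<sigma> p) ^ (d - 1)"
        by simp
    qed
    finally have 1: "(\<Prod>u\<in>L. (?w u \<sigma> 1 + ?w u \<sigma> (-1)) / 2) = (\<Prod>p\<in>L'. transfer x m (\<sigma> p) ^ (d - 1))" .
    \<comment> \<open>The next sphere becomes the boundary, so its field weights pass from the ball
      to the messages.\<close>
    have 2: "(\<Prod>u\<in>?H (Suc k). field_weight l (\<sigma> u)) = (\<Prod>u\<in>?H k. field_weight l (\<sigma> u)) * (\<Prod>u\<in>L'. field_weight l (\<sigma> u))"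
      using prod.subset_diff[of "?H k" "?H (Suc k)" "\<lambda>u. field_weight l (\<sigma> u)"] finite_hop[OF v] hop_mono[of k "Suc k" E v]
      unfolding L'_def by (simp only: mult.commute)
    show "g \<sigma> * ?W \<sigma> * (\<Prod>u\<in>L. (?w u \<sigma> 1 + ?w u \<sigma> (-1)) / 2) =
      g \<sigma> * ball_weight x l v k (\<lambda>s. field_weight l s * transfer x m s ^ (d - 1)) \<sigma>"
      unfolding 1 2 ball_weight_def L'_def[symmetric] by (simp only: prod.distrib mult_ac)
  qed
  finally show ?thesis .
qed

text \<open>The root has \<open>d\<close> children, one more than the other inner vertices. The
  extra child \<open>u0\<close> is singled out so that the result displays the edge to it. The flag
  \<open>b\<close> yields the total weight and the weight of the event
  \<open>\<sigma> v = \<sigma> u0\<close> in one proof.\<close>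

lemma ball_weight_base:
  fixes b :: bool
  assumes v: "v \<in> V" and tree: "tree_at E v R" and R: "0 < R" and u0: "{v, u0} \<in> E"
    and g: "indep_of (hop E v 1) g"
  shows "(\<Sum>\<sigma>\<in>spins V. g \<sigma> * of_bool (b \<longrightarrow> \<sigma> v = \<sigma> u0) * ball_weight x l v 0 m \<sigma>) =
    (\<Sum>\<sigma>\<in>spins V. g \<sigma>) * ((\<Sum>s\<in>{1,-1}. field_weight l s * transfer x m s ^ (d - 1) *
       (if b then x * m s / 2 else transfer x m s)) / 2)"
proof -
  let ?H = "hop E v"
  define L where "L = ?H 1 - ?H 0"
  have u0v: "u0 \<noteq> v" using edge(2)[OF u0] by auto
  have L: "u0 \<in> L" "v \<notin> L" "L \<subseteq> V" using u0 u0v hop_subset[OF v, of 1] by (auto simp: L_def hop.simps)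
  have fin: "finite L" using L finite_V finite_subset by blast
  have par: "parent v 0 u = v" if "u \<in> L" for u
    using parent_in(1)[OF tree R, of u] that by (auto simp: L_def)
  have Lnb: "L = {u. {u, v} \<in> E}"
  proof -
    have "{v, v} \<notin> E" using edge(2)[of "{v, v}"] by auto
    then show ?thesis by (auto simp: L_def hop.simps insert_commute)
  qed
  have cardL: "card L = d" unfolding Lnb by (rule card_neighbours[OF v])
  have no: "{e \<in> E. e \<subseteq> ?H 0} = {}"
  proof -
    have "\<not> e \<subseteq> {v}" if "e \<in> E" for e
      using edge(2)[OF that] card_mono[of "{v}" e] by auto
    then show ?thesis by auto
  qed
  let ?w = "\<lambda>u \<sigma> s. (if \<sigma> v = s then x else 1) * m s * of_bool (b \<and> u = u0 \<longrightarrow> \<sigma> v = s)"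
  \<comment> \<open>To fit the product form of the decimation, the indicator is spread over all
    children; only the factor of \<open>u0\<close> is nontrivial.\<close>
  have 1: "of_bool (b \<longrightarrow> \<sigma> v = \<sigma> u0) = (\<Prod>u\<in>L. of_bool (b \<and> u = u0 \<longrightarrow> \<sigma> v = \<sigma> u) :: real)" for \<sigma> :: "'v \<Rightarrow> real"
    using fin L(1) by (subst prod.remove[of L u0]) (auto intro!: prod.neutral)
  have "(\<Sum>\<sigma>\<in>spins V. g \<sigma> * of_bool (b \<longrightarrow> \<sigma> v = \<sigma> u0) * ball_weight x l v 0 m \<sigma>) =
    (\<Sum>\<sigma>\<in>spins V. (g \<sigma> * field_weight l (\<sigma> v)) * (\<Prod>u\<in>L. ?w u \<sigma> (\<sigma> u)))"
  proof (rule sum.cong[OF refl])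
    fix \<sigma>
    have "(\<Prod>w\<in>?H (Suc 0) - ?H 0. bond_weight x \<sigma> {parent v 0 w, w}) = (\<Prod>w\<in>L. if \<sigma> v = \<sigma> w then x else 1)"
      using par by (intro prod.cong) (auto simp: L_def bond_weight_pair)
    then show "g \<sigma> * of_bool (b \<longrightarrow> \<sigma> v = \<sigma> u0) * ball_weight x l v 0 m \<sigma> =
        (g \<sigma> * field_weight l (\<sigma> v)) * (\<Prod>u\<in>L. ?w u \<sigma> (\<sigma> u))"
      unfolding ball_weight_def prod_hop_edges_Suc[OF v tree R] no 1
      by (simp add: prod.distrib L_def mult_ac)
  qed
  also have "\<dots> = (\<Sum>\<sigma>\<in>spins V. (g \<sigma> * field_weight l (\<sigma> v)) * (\<Prod>u\<in>L. (?w u \<sigma> 1 + ?w u \<sigma> (-1)) / 2))"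
  proof (rule sum_spins_decimate[OF fin L(3)])
    show "indep_of L (\<lambda>\<sigma>. g \<sigma> * field_weight l (\<sigma> v))"
    proof (rule indep_of_mult)
      show "indep_of L g" using g by (rule indep_of_subset) (auto simp: L_def)
    qed (rule indep_of_site[OF L(2)])
    show "indep_of L (?w u)" if "u \<in> L" for u
      using L(2) unfolding indep_of_def by simp
  qed
  also have "\<dots> = (\<Sum>\<sigma>\<in>spins V. g \<sigma> * (\<Prod>u\<in>{v}. field_weight l (\<sigma> u) * (transfer x m (\<sigma> u) ^ (d - 1) *
       (if b then x * m (\<sigma> u) / 2 else transfer x m (\<sigma> u)))))"
  proof (rule sum.cong[OF refl])
    fix \<sigma> assume \<sigma>: "\<sigma> \<in> spins V"
    have "(?w u0 \<sigma> 1 + ?w u0 \<sigma> (-1)) / 2 = (if b then x * m (\<sigma> v) / 2 else transfer x m (\<sigma> v))"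
      using spin_cases[OF \<sigma> v] by (auto simp: transfer_def)
    moreover have "(\<Prod>u\<in>L - {u0}. (?w u \<sigma> 1 + ?w u \<sigma> (-1)) / 2) = (\<Prod>u\<in>L - {u0}. transfer x m (\<sigma> v))"
      using spin_cases[OF \<sigma> v] by (intro prod.cong) (auto simp: transfer_def)
    moreover have "(\<Prod>u\<in>L - {u0}. transfer x m (\<sigma> v)) = transfer x m (\<sigma> v) ^ (d - 1)"
      using cardL L(1) fin by simp
    ultimately have "(\<Prod>u\<in>L. (?w u \<sigma> 1 + ?w u \<sigma> (-1)) / 2) =
       transfer x m (\<sigma> v) ^ (d - 1) * (if b then x * m (\<sigma> v) / 2 else transfer x m (\<sigma> v))"
      by (subst prod.remove[OF fin L(1)]) (simp only: mult.commute)
    then show "g \<sigma> * field_weight l (\<sigma> v) * (\<Prod>u\<in>L. (?w u \<sigma> 1 + ?w u \<sigma> (-1)) / 2) =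
      g \<sigma> * (\<Prod>u\<in>{v}. field_weight l (\<sigma> u) * (transfer x m (\<sigma> u) ^ (d - 1) *
       (if b then x * m (\<sigma> u) / 2 else transfer x m (\<sigma> u))))"
      by simp
  qed
  also have "\<dots> = (\<Sum>\<sigma>\<in>spins V. g \<sigma> * (\<Prod>u\<in>{v}.
      (field_weight l 1 * (transfer x m 1 ^ (d - 1) * (if b then x * m 1 / 2 else transfer x m 1)) +
       field_weight l (-1) * (transfer x m (-1) ^ (d - 1) * (if b then x * m (-1) / 2 else transfer x m (-1)))) / 2))"
  proof (rule sum_spins_decimate[where w = "\<lambda>u \<sigma> s. field_weight l s * (transfer x m s ^ (d - 1) *
       (if b then x * m s / 2 else transfer x m s))"])
    show "indep_of {v} g" using g by (rule indep_of_subset) (simp add: center_in_hop)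
  qed (use v in \<open>auto simp: indep_of_def\<close>)
  also have "(field_weight l 1 * (transfer x m 1 ^ (d - 1) * (if b then x * m 1 / 2 else transfer x m 1)) +
       field_weight l (-1) * (transfer x m (-1) ^ (d - 1) * (if b then x * m (-1) / 2 else transfer x m (-1)))) / 2
    = (\<Sum>s\<in>{1,-1}. field_weight l s * transfer x m s ^ (d - 1) *
       (if b then x * m s / 2 else transfer x m s)) / 2" (is "?C = ?C'")
    by (simp add: mult.assoc)
  finally show ?thesis by (simp only: prod.insert prod.empty finite.emptyI empty_iff if_False not_False_eq_True
      mult_1_right flip: sum_distrib_right)
qed

lemma ball_weight_collapse:
  assumes v: "v \<in> V" and tree: "tree_at E v (Suc r)" and g: "indep_of (hop E v (Suc r)) g"
    and u0: "{v, u0} \<in> E"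
  shows "(\<Sum>\<sigma>\<in>spins V. g \<sigma> * of_bool (b \<longrightarrow> \<sigma> v = \<sigma> u0) * ball_weight x l v r m \<sigma>) =
    (\<Sum>\<sigma>\<in>spins V. g \<sigma> * of_bool (b \<longrightarrow> \<sigma> v = \<sigma> u0) *
       ball_weight x l v 0 (((\<lambda>m s. field_weight l s * transfer x m s ^ (d - 1)) ^^ r) m) \<sigma>)"
  using tree g
proof (induction r arbitrary: m)
  case (Suc r)
  let ?step = "\<lambda>m s. field_weight l s * transfer x m s ^ (d - 1)"
  let ?h = "\<lambda>\<sigma>. g \<sigma> * of_bool (b \<longrightarrow> \<sigma> v = \<sigma> u0)"
  have "u0 \<in> hop E v (Suc r)"
    using hop_adjacent[OF center_in_hop u0, of 0] hop_mono[of 1 "Suc r" E v] by auto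
  moreover have "v \<in> hop E v (Suc r)" by (rule center_in_hop)
  ultimately have "indep_of (hop E v (Suc (Suc r)) - hop E v (Suc r)) (\<lambda>\<sigma>. of_bool (b \<longrightarrow> \<sigma> v = \<sigma> u0) :: real)"
    unfolding indep_of_def by simp
  moreover have "indep_of (hop E v (Suc (Suc r)) - hop E v (Suc r)) g"
    using Suc.prems(2) by (rule indep_of_subset) auto
  ultimately have "indep_of (hop E v (Suc (Suc r)) - hop E v (Suc r)) ?h"
    by (intro indep_of_mult)
  then have "(\<Sum>\<sigma>\<in>spins V. ?h \<sigma> * ball_weight x l v (Suc r) m \<sigma>) =
      (\<Sum>\<sigma>\<in>spins V. ?h \<sigma> * ball_weight x l v r (?step m) \<sigma>)"
    by (intro ball_weight_step[OF v Suc.prems(1)]) auto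
  also have "\<dots> = (\<Sum>\<sigma>\<in>spins V. ?h \<sigma> * ball_weight x l v 0 ((?step ^^ r) (?step m)) \<sigma>)"
  proof (rule Suc.IH)
    show "tree_at E v (Suc r)" using Suc.prems(1) by (rule tree_at_mono) simp
    show "indep_of (hop E v (Suc r)) g"
      using Suc.prems(2) hop_Suc_subset by (rule indep_of_subset)
  qed
  finally show ?case by (simp only: funpow_Suc_right o_apply)
qed simp

end

section \<open>Messages under plus boundary conditions\<close>

text \<open>The ratio of the message at \<open>-1\<close> to the one at \<open>1\<close>; the start
  \<open>0\<close> is the plus boundary condition.\<close>

primrec tree_ratio :: "real \<Rightarrow> real \<Rightarrow> nat \<Rightarrow> nat \<Rightarrow> real" where
  "tree_ratio x l d 0 = 0"
| "tree_ratio x l d (Suc k) = ((1 + x * tree_ratio x l d k) / (x + tree_ratio x l d k)) ^ (d - 1) / l"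

text \<open>The probability that the ends of an edge agree when the rest of the graph gives them
  minus-to-plus ratios \<open>t\<close> and \<open>t'\<close>: the four configurations weigh
  \<open>x\<close>, \<open>x * t * t'\<close>, \<open>t\<close> and \<open>t'\<close>.\<close>

definition bond_corr :: "real \<Rightarrow> real \<Rightarrow> real \<Rightarrow> real" where
  "bond_corr x t t' = x * (1 + t * t') / (x * (1 + t * t') + t + t')"

lemma tree_ratio_nonneg: "x > 0 \<Longrightarrow> l > 0 \<Longrightarrow> 0 \<le> tree_ratio x l d k"
  by (induction k) auto

context regular
begin

lemma message_ratio:
  fixes x l :: real
  assumes "x > 0" "l > 0"
  defines "ms \<equiv> \<lambda>k. ((\<lambda>m s. field_weight l s * transfer x m s ^ (d - 1)) ^^ k) (\<lambda>s. of_bool (s = 1))"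
  shows "ms k 1 > 0 \<and> ms k (-1) = tree_ratio x l d k * ms k 1"
proof (induction k)
  case 0
  then show ?case by (simp add: ms_def)
next
  case (Suc k)
  let ?t = "tree_ratio x l d k"
  have t: "?t \<ge> 0" using assms tree_ratio_nonneg by blast
  have step: "ms (Suc k) s = field_weight l s * transfer x (ms k) s ^ (d - 1)" for s
    by (simp add: ms_def)
  have T1: "transfer x (ms k) 1 = ms k 1 / 2 * (x + ?t)" "transfer x (ms k) (-1) = ms k 1 / 2 * (1 + x * ?t)"
    using Suc by (simp_all add: transfer_def algebra_simps)
  have pos: "x + ?t > 0" using t assms by simp
  then show ?case unfolding step T1 using Suc assms
    by (simp add: field_weight_def power_mult_distrib power_divide)
qed

text \<open>On the event of plus spins on the sphere the weight is an exterior factor times a ball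
  factor, and the exterior cancels. Apart from their common edge, \<open>u0\<close> has collected
  \<open>r\<close> message steps and \<open>v\<close>, with its other children, one more; hence the
  two consecutive indices.\<close>

lemma bond_probability_le:
  assumes v: "v \<in> V" and tree: "tree_at E v (Suc r)" and u0: "{v, u0} \<in> E"
    and x: "1 \<le> x" and l: "1 \<le> l"
  shows "(\<Sum>\<sigma>\<in>spins V. ising_weight V E x l \<sigma> * of_bool (\<sigma> v = \<sigma> u0))
    \<le> bond_corr x (tree_ratio x l d r) (tree_ratio x l d (Suc r)) * Z_Ising V E x l"
proof -
  let ?S = "spins V" and ?H = "hop E v" and ?W = "ising_weight V E x l"
  define L where "L = ?H (Suc r) - ?H r"
  \<comment> \<open>The indicator of plus spins on the sphere, written as a product that visibly
    lies in the cone.\<close>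
  define f where "f = (\<lambda>\<sigma> :: 'v \<Rightarrow> real. \<Prod>u\<in>L. 1/2 + 1/2 * \<sigma> u :: real)"
  define m0 where "m0 = (\<lambda>s::real. of_bool (s = 1) :: real)"
  define eq where "eq = (\<lambda>\<sigma> :: 'v \<Rightarrow> real. of_bool (\<sigma> v = \<sigma> u0) :: real)"
  define I where "I = E \<union> (\<lambda>u. {u}) ` V"
  \<comment> \<open>A bond is \<open>(x + 1) / 2\<close> times
    \<open>1 + k * \<sigma> a * \<sigma> b\<close>, a field \<open>(l + 1) / 2\<close> times
    \<open>1 + k * \<sigma> u\<close>. A singleton is never an edge, so one family \<open>I\<close>
    holds both kinds. Here \<open>1 \<le> x\<close> and \<open>1 \<le> l\<close> make the
    coefficients nonnegative.\<close>
  define kk where "kk = (\<lambda>C. if C \<in> E then (x - 1) / (x + 1) else (l - 1) / (l + 1))"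
  define Wg where "Wg = (\<lambda>\<sigma> :: 'v \<Rightarrow> real. \<Prod>C\<in>I. 1 + kk C * (\<Prod>u\<in>C. \<sigma> u))"
  define \<kappa> where "\<kappa> = ((l + 1) / 2) ^ card V * ((x + 1) / 2) ^ card E"
  have u0V: "u0 \<in> V" "u0 \<noteq> v" using edge[OF u0] by auto
  have LV: "L \<subseteq> V" using hop_subset[OF v] unfolding L_def by blast
  have finL: "finite L" using LV finite_V finite_subset by blast
  have W: "?W \<sigma> = \<kappa> * Wg \<sigma>" if \<sigma>: "\<sigma> \<in> ?S" for \<sigma>
  proof -
    have "E \<inter> (\<lambda>u. {u}) ` V = {}" using edge(2) by fastforce
    moreover have "inj_on (\<lambda>u. {u}) V" by auto
    ultimately have "Wg \<sigma> = (\<Prod>C\<in>E. 1 + kk C * (\<Prod>u\<in>C. \<sigma> u)) * (\<Prod>u\<in>V. 1 + kk {u} * \<sigma> u)"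
      unfolding Wg_def I_def using finite_E finite_V
      by (simp add: prod.union_disjoint prod.reindex)
    moreover have "(\<Prod>C\<in>E. bond_weight x \<sigma> C) = (\<Prod>C\<in>E. (x + 1) / 2 * (1 + kk C * (\<Prod>u\<in>C. \<sigma> u)))"
    proof (rule prod.cong[OF refl])
      fix C assume C: "C \<in> E"
      then obtain a b where ab: "C = {a, b}" "a \<noteq> b" "a \<in> V" "b \<in> V" by (rule edge_cases)
      have "bond_weight x \<sigma> {a, b} = (x + 1) / 2 * (1 + (x - 1) / (x + 1) * (\<sigma> a * \<sigma> b))"
        using spin_cases[OF \<sigma> ab(3)] spin_cases[OF \<sigma> ab(4)] x by (auto simp: bond_weight_pair field_simps)
      then show "bond_weight x \<sigma> C = (x + 1) / 2 * (1 + kk C * (\<Prod>u\<in>C. \<sigma> u))"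
        using C ab by (simp add: kk_def)
    qed
    moreover have "(\<Prod>u\<in>V. field_weight l (\<sigma> u)) = (\<Prod>u\<in>V. (l + 1) / 2 * (1 + kk {u} * \<sigma> u))"
    proof (rule prod.cong[OF refl])
      fix u assume u: "u \<in> V"
      have "{u} \<notin> E" using edge(2)[of "{u}"] by auto
      then show "field_weight l (\<sigma> u) = (l + 1) / 2 * (1 + kk {u} * \<sigma> u)"
        using spin_cases[OF \<sigma> u] l by (auto simp: kk_def field_weight_def field_simps)
    qed
    ultimately show ?thesis
      unfolding ising_weight_def \<kappa>_def by (simp only: prod.distrib prod_constant mult_ac)
  qed
  have \<kappa>: "\<kappa> > 0" using x l by (simp add: \<kappa>_def)
  have eqB: "eq \<sigma> = 1/2 + 1/2 * (\<Prod>u\<in>{v, u0}. \<sigma> u)" if "\<sigma> \<in> ?S" for \<sigma>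
    using spin_cases[OF that v] spin_cases[OF that u0V(1)] u0V(2) by (auto simp: eq_def)
  have fcone: "f \<in> griffiths_cone V"
    unfolding f_def
    by (intro griffiths_cone_prod griffiths_cone_add griffiths_cone_mult griffiths_cone_const griffiths_cone_spin)
      (use finite_V LV in auto)
  have "(\<Sum>\<sigma>\<in>?S. Wg \<sigma> * f \<sigma>) * (\<Sum>\<sigma>\<in>?S. Wg \<sigma> * (\<Prod>u\<in>{v, u0}. \<sigma> u))
      \<le> (\<Sum>\<sigma>\<in>?S. Wg \<sigma>) * (\<Sum>\<sigma>\<in>?S. Wg \<sigma> * f \<sigma> * (\<Prod>u\<in>{v, u0}. \<sigma> u))"
    unfolding Wg_def
  proof (rule griffiths_inequality[OF finite_V _ fcone])
    show "C \<subseteq> V \<and> 0 \<le> kk C \<and> kk C \<le> 1" if "C \<in> I" for C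
      using that edge(1) x l by (auto simp: I_def kk_def)
  qed (use v u0V in auto)
  \<comment> \<open>The inequality passes from the product of the two spins to the indicator of
    their equality, since the constant \<open>1/2\<close> contributes the same to both
    sides.\<close>
  then have "(\<Sum>\<sigma>\<in>?S. Wg \<sigma> * f \<sigma>) * (\<Sum>\<sigma>\<in>?S. Wg \<sigma> * (1/2 + 1/2 * (\<Prod>u\<in>{v, u0}. \<sigma> u)))
      \<le> (\<Sum>\<sigma>\<in>?S. Wg \<sigma>) * (\<Sum>\<sigma>\<in>?S. Wg \<sigma> * f \<sigma> * (1/2 + 1/2 * (\<Prod>u\<in>{v, u0}. \<sigma> u)))"
    by (simp add: distrib_left sum.distrib mult.commute flip: sum_divide_distrib)
  then have "\<kappa> * \<kappa> * ((\<Sum>\<sigma>\<in>?S. Wg \<sigma> * f \<sigma>) * (\<Sum>\<sigma>\<in>?S. Wg \<sigma> * eq \<sigma>))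
      \<le> \<kappa> * \<kappa> * ((\<Sum>\<sigma>\<in>?S. Wg \<sigma>) * (\<Sum>\<sigma>\<in>?S. Wg \<sigma> * f \<sigma> * eq \<sigma>))"
    using \<kappa> by (simp add: eqB)
  moreover have "(\<Sum>\<sigma>\<in>?S. ?W \<sigma> * h \<sigma>) = \<kappa> * (\<Sum>\<sigma>\<in>?S. Wg \<sigma> * h \<sigma>)" for h
    by (simp add: W sum_distrib_left mult.assoc)
  ultimately have gks: "(\<Sum>\<sigma>\<in>?S. ?W \<sigma> * f \<sigma>) * (\<Sum>\<sigma>\<in>?S. ?W \<sigma> * eq \<sigma>)
      \<le> Z_Ising V E x l * (\<Sum>\<sigma>\<in>?S. ?W \<sigma> * (f \<sigma> * eq \<sigma>))"
    by (simp add: Z_Ising_def W sum_distrib_left mult_ac)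
  \<comment> \<open>Overwriting the ball by plus spins makes \<open>out\<close> independent of the
    ball for every configuration. Where \<open>f\<close> does not vanish this changes nothing, since
    an edge not contained in the ball of radius \<open>Suc r\<close> avoids the ball of radius
    \<open>r\<close>.\<close>
  define ov where "ov = (\<lambda>\<sigma> u. if u \<in> ?H (Suc r) then 1 else \<sigma> u :: real)"
  define out where "out = (\<lambda>\<sigma>. (\<Prod>u\<in>V - ?H r. field_weight l (ov \<sigma> u)) *
      (\<Prod>e\<in>E - {e \<in> E. e \<subseteq> ?H (Suc r)}. bond_weight x (ov \<sigma>) e))"
  have out_indep: "indep_of (?H (Suc r)) out"
    unfolding indep_of_def
  proof (intro allI impI)
    fix \<sigma> \<tau> :: "'v \<Rightarrow> real" assume "\<forall>u. u \<notin> ?H (Suc r) \<longrightarrow> \<sigma> u = \<tau> u"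
    then have "ov \<sigma> = ov \<tau>" by (auto simp: ov_def)
    then show "out \<sigma> = out \<tau>" by (simp only: out_def)
  qed
  have out_pos: "out \<sigma> > 0" for \<sigma>
    unfolding out_def using x l
    by (intro mult_pos_pos prod_pos) (auto simp: field_weight_def bond_weight_def)
  have fm: "f \<sigma> = (\<Prod>u\<in>L. m0 (\<sigma> u))" if "\<sigma> \<in> ?S" for \<sigma>
    unfolding f_def m0_def
  proof (rule prod.cong[OF refl])
    fix u assume "u \<in> L"
    then show "1/2 + 1/2 * \<sigma> u = of_bool (\<sigma> u = 1)" using spin_cases[OF that] LV by fastforce
  qed
  have Wf: "?W \<sigma> * f \<sigma> = out \<sigma> * ball_weight x l v r m0 \<sigma>" if \<sigma>: "\<sigma> \<in> ?S" for \<sigma>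
  proof (cases "\<forall>u\<in>L. \<sigma> u = 1")
    case True
    have ov: "ov \<sigma> u = \<sigma> u" if "u \<notin> ?H r" for u using True that by (simp add: ov_def L_def)
    have "(\<Prod>u\<in>V - ?H r. field_weight l (ov \<sigma> u)) = (\<Prod>u\<in>V - ?H r. field_weight l (\<sigma> u))"
      by (intro prod.cong refl) (simp add: ov)
    moreover have "(\<Prod>e\<in>E - {e \<in> E. e \<subseteq> ?H (Suc r)}. bond_weight x (ov \<sigma>) e) =
        (\<Prod>e\<in>E - {e \<in> E. e \<subseteq> ?H (Suc r)}. bond_weight x \<sigma> e)"
    proof (rule prod.cong[OF refl])
      fix e assume e: "e \<in> E - {e \<in> E. e \<subseteq> ?H (Suc r)}"
      then have "e \<in> E" by simp
      then obtain a b where ab: "e = {a, b}" by (rule edge_cases)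
      have "a \<notin> ?H r" "b \<notin> ?H r"
        using hop_adjacent[of a E v r b] hop_adjacent[of b E v r a] hop_Suc_subset[of E v r] e
        unfolding ab by (auto simp: insert_commute)
      then show "bond_weight x (ov \<sigma>) e = bond_weight x \<sigma> e" by (simp add: ab bond_weight_pair ov)
    qed
    moreover have "(\<Prod>u\<in>V. field_weight l (\<sigma> u)) = (\<Prod>u\<in>V - ?H r. field_weight l (\<sigma> u)) * (\<Prod>u\<in>?H r. field_weight l (\<sigma> u))"
      by (rule prod.subset_diff[OF hop_subset[OF v] finite_V])
    moreover have "(\<Prod>e\<in>E. bond_weight x \<sigma> e) = (\<Prod>e\<in>E - {e \<in> E. e \<subseteq> ?H (Suc r)}. bond_weight x \<sigma> e) *
        (\<Prod>e\<in>{e \<in> E. e \<subseteq> ?H (Suc r)}. bond_weight x \<sigma> e)"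
      by (rule prod.subset_diff[OF _ finite_E]) auto
    ultimately show ?thesis
      unfolding fm[OF \<sigma>] ising_weight_def ball_weight_def out_def L_def by (simp only: mult_ac)
  next
    case False
    then have "(\<Prod>u\<in>L. m0 (\<sigma> u)) = 0" using finL by (auto simp: m0_def)
    then show ?thesis by (simp add: fm[OF \<sigma>] ball_weight_def L_def)
  qed
  define ms where "ms = (\<lambda>k. ((\<lambda>m s. field_weight l s * transfer x m s ^ (d - 1)) ^^ k) m0)"
  define C where "C = (\<lambda>b. (\<Sum>s\<in>{1,-1}. field_weight l s * transfer x (ms r) s ^ (d - 1) *
       (if b then x * ms r s / 2 else transfer x (ms r) s)) / 2)"
  have collapse: "(\<Sum>\<sigma>\<in>?S. out \<sigma> * of_bool (b \<longrightarrow> \<sigma> v = \<sigma> u0) * ball_weight x l v r m0 \<sigma>)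
      = (\<Sum>\<sigma>\<in>?S. out \<sigma>) * C b" for b
  proof -
    have "indep_of (?H 1) out" using out_indep hop_mono[of 1 "Suc r" E v] by (auto intro: indep_of_subset)
    then show ?thesis
      unfolding ball_weight_collapse[OF v tree out_indep u0] C_def ms_def
      by (intro ball_weight_base[OF v tree _ u0]) auto
  qed
  have Zf: "(\<Sum>\<sigma>\<in>?S. ?W \<sigma> * f \<sigma>) = (\<Sum>\<sigma>\<in>?S. out \<sigma>) * C False"
    unfolding collapse[symmetric] by (intro sum.cong refl) (simp add: Wf)
  have Zfe: "(\<Sum>\<sigma>\<in>?S. ?W \<sigma> * (f \<sigma> * eq \<sigma>)) = (\<Sum>\<sigma>\<in>?S. out \<sigma>) * C True"
    unfolding collapse[symmetric]
  proof (intro sum.cong refl)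
    fix \<sigma> assume "\<sigma> \<in> ?S"
    then have "?W \<sigma> * f \<sigma> * eq \<sigma> = out \<sigma> * ball_weight x l v r m0 \<sigma> * eq \<sigma>" by (simp only: Wf)
    then show "?W \<sigma> * (f \<sigma> * eq \<sigma>) = out \<sigma> * of_bool (True \<longrightarrow> \<sigma> v = \<sigma> u0) * ball_weight x l v r m0 \<sigma>"
      by (simp add: eq_def mult_ac)
  qed
  have Opos: "(\<Sum>\<sigma>\<in>?S. out \<sigma>) > 0"
    using finite_spins[OF finite_V] out_pos by (intro sum_pos) (auto simp: PiE_eq_empty_iff)
  let ?t = "tree_ratio x l d r" and ?t' = "tree_ratio x l d (Suc r)"
  have t: "?t \<ge> 0" "?t' \<ge> 0" using x l by (auto intro!: tree_ratio_nonneg simp del: tree_ratio.simps)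
  have mr: "ms k 1 > 0" "ms k (-1) = tree_ratio x l d k * ms k 1" for k
    using message_ratio[of x l k] x l unfolding ms_def m0_def by auto
  have step: "field_weight l s * transfer x (ms r) s ^ (d - 1) = ms (Suc r) s" for s
    by (simp add: ms_def)
  have C1: "C True = ms (Suc r) 1 * ms r 1 / 4 * (x * (1 + ?t * ?t'))"
    unfolding C_def step using mr(2)[of r] mr(2)[of "Suc r"]
    by (simp add: algebra_simps del: tree_ratio.simps)
  have C0: "C False = ms (Suc r) 1 * ms r 1 / 4 * (x * (1 + ?t * ?t') + ?t + ?t')"
    unfolding C_def step unfolding transfer_def using mr(2)[of r] mr(2)[of "Suc r"]
    by (simp add: algebra_simps add_divide_distrib del: tree_ratio.simps)
  have den: "x * (1 + ?t * ?t') + ?t + ?t' > 0"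
  proof -
    have "x * (1 + ?t * ?t') > 0" using x t by (intro mult_pos_pos add_pos_nonneg mult_nonneg_nonneg) auto
    then show ?thesis using t by linarith
  qed
  then have C0pos: "C False > 0" unfolding C0 using mr(1) by simp
  have ratio: "C True = bond_corr x ?t ?t' * C False"
    unfolding C0 C1 bond_corr_def using den by (simp add: field_simps del: tree_ratio.simps)
  have "((\<Sum>\<sigma>\<in>?S. out \<sigma>) * C False) * (\<Sum>\<sigma>\<in>?S. ?W \<sigma> * eq \<sigma>)
      \<le> ((\<Sum>\<sigma>\<in>?S. out \<sigma>) * C False) * (bond_corr x ?t ?t' * Z_Ising V E x l)"
    using gks unfolding Zf Zfe ratio by (simp only: mult_ac)
  then show ?thesis using Opos C0pos unfolding eq_def by (subst (asm) mult_le_cancel_left_pos) auto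
qed

end

section \<open>The Bethe functional of the Ising model\<close>

definition ising_num :: "real \<Rightarrow> real \<Rightarrow> nat \<Rightarrow> real \<Rightarrow> real \<Rightarrow> real" where
  "ising_num x l d s t = l * (x * s + t) ^ d + (s + x * t) ^ d"

text \<open>Invariant under positive scaling, because the numerator has degree \<open>d\<close> and
  the form degree \<open>2\<close>; vectors need not be normalised.\<close>

definition ising_bethe :: "real \<Rightarrow> real \<Rightarrow> nat \<Rightarrow> real \<Rightarrow> real \<Rightarrow> real" where
  "ising_bethe x l d s t = ln (ising_num x l d s t) - real d / 2 * ln (ising_form x s t)"

definition ising_fixed :: "real \<Rightarrow> real \<Rightarrow> nat \<Rightarrow> real \<Rightarrow> real \<Rightarrow> real \<Rightarrow> bool" where
  "ising_fixed x l d s t z \<longleftrightarrow> l * (x * s + t) ^ (d - 1) = z * s \<and> (s + x * t) ^ (d - 1) = z * t"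

lemma ising_num_pos:
  assumes "1 \<le> x" "0 < l" "0 \<le> s" "0 \<le> t" "0 < s + t"
  shows "0 < ising_num x l d s t"
proof -
  have "s \<le> x * s" "t \<le> x * t" using assms mult_right_mono[of 1 x s] mult_right_mono[of 1 x t] by auto
  then have "0 < x * s + t" "0 < s + x * t" using assms by linarith+
  then show ?thesis using assms by (simp add: ising_num_def add_pos_pos)
qed

lemma ising_form_pos:
  assumes "1 \<le> x" "0 \<le> s" "0 \<le> t" "0 < s + t"
  shows "0 < ising_form x s t"
proof -
  have "(s + t)\<^sup>2 \<le> ising_form x s t"
    using assms mult_right_mono[of 1 x "s\<^sup>2"] mult_right_mono[of 1 x "t\<^sup>2"]
    by (simp add: ising_form_def power2_sum)
  moreover have "0 < (s + t)\<^sup>2" using assms by simp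
  ultimately show ?thesis by linarith
qed

lemma ising_bethe_scale:
  assumes "1 \<le> x" "0 < l" "0 \<le> s" "0 \<le> t" "0 < s + t" "0 < c"
  shows "ising_bethe x l d (c * s) (c * t) = ising_bethe x l d s t"
proof -
  have e: "x * (c * s) + c * t = c * (x * s + t)" "c * s + x * (c * t) = c * (s + x * t)"
    by (simp_all add: algebra_simps)
  have "ising_num x l d (c * s) (c * t) = c ^ d * ising_num x l d s t"
    unfolding ising_num_def e power_mult_distrib by (simp add: distrib_left)
  moreover have "ising_form x (c * s) (c * t) = c\<^sup>2 * ising_form x s t"
    by (simp add: ising_form_def power2_eq_square algebra_simps)
  ultimately show ?thesis
    using assms ising_num_pos[OF assms(1-5), of d] ising_form_pos[OF assms(1,3-5)]
    by (simp add: ising_bethe_def ln_mult ln_realpow algebra_simps)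
qed

lemma ising_bethe_swap:
  assumes "1 \<le> x" "0 < l" "0 \<le> s" "0 \<le> t" "0 < s + t"
  shows "ising_bethe x l d s t = ln l + ising_bethe x (1 / l) d t s"
proof -
  have "ising_num x l d s t = l * ising_num x (1 / l) d t s"
    using assms by (simp add: ising_num_def algebra_simps)
  moreover have "ising_form x s t = ising_form x t s" by (simp add: ising_form_def algebra_simps)
  moreover have "0 < ising_num x (1 / l) d t s" using assms by (intro ising_num_pos) auto
  ultimately show ?thesis using assms by (simp add: ising_bethe_def ln_mult)
qed

text \<open>Multiplying the case \<open>d\<close> by \<open>b\<close> gives the case
  \<open>Suc d\<close> with the nonnegative remainder
  \<open>real d * a ^ (d - 1) * (b - a)\<^sup>2\<close>.\<close>

lemma power_tangent:
  fixes a b :: real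
  assumes "0 \<le> a" "0 \<le> b"
  shows "a ^ d + real d * a ^ (d - 1) * (b - a) \<le> b ^ d"
proof (induction d)
  case (Suc d)
  have "b * (a ^ d + real d * a ^ (d - 1) * (b - a)) \<le> b * b ^ d"
    using Suc assms by (intro mult_left_mono)
  moreover have "b * (a ^ d + real d * a ^ (d - 1) * (b - a)) =
      a ^ Suc d + real (Suc d) * a ^ d * (b - a) + real d * a ^ (d - 1) * (b - a)\<^sup>2"
    by (cases d) (simp_all add: algebra_simps power2_eq_square)
  moreover have "0 \<le> real d * a ^ (d - 1) * (b - a)\<^sup>2" using assms by simp
  ultimately show ?case by simp
qed simp

text \<open>One step of belief propagation increases the Bethe functional, strictly unless it is
  stationary: the tangent inequality controls the numerator, Cauchy--Schwarz the denominator.\<close>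

lemma ising_bethe_maximizer_fixed:
  assumes x: "1 < x" and l: "0 < l" and d: "0 < d" and st: "0 \<le> s" "0 \<le> t" "0 < s + t"
    and max: "\<And>s' t'. 0 < s' \<Longrightarrow> 0 < t' \<Longrightarrow> ising_bethe x l d s' t' \<le> ising_bethe x l d s t"
  shows "0 < s \<and> 0 < t \<and> (\<exists>z>0. ising_fixed x l d s t z)"
proof -
  define a b where "a = x * s + t" and "b = s + x * t"
  have ab: "0 < a" "0 < b"
  proof -
    have "s \<le> x * s" "t \<le> x * t" using assms mult_right_mono[of 1 x s] mult_right_mono[of 1 x t] by auto
    then show "0 < a" "0 < b" using st by (auto simp: a_def b_def)
  qed
  define S T where "S = l * a ^ (d - 1)" and "T = b ^ (d - 1)"
  have ST: "0 < S" "0 < T" using ab l by (auto simp: S_def T_def)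
  define P Q Q' where "P = ising_num x l d s t" and "Q = ising_form x s t" and "Q' = ising_form x S T"
  have pos: "0 < P" "0 < Q" "0 < Q'"
    unfolding P_def Q_def Q'_def using x l st ST by (auto intro!: ising_num_pos ising_form_pos)
  have Pd: "P = l * a ^ d + b ^ d" by (simp add: P_def ising_num_def a_def b_def)
  have P1: "P = S * a + T * b"
    using d by (simp add: P_def ising_num_def S_def T_def a_def[symmetric] b_def[symmetric] power_eq_if)
  \<comment> \<open>\<open>(S, T)\<close> is the unnormalised image under belief propagation. The
    scale \<open>c\<close> achieves \<open>S * a' + T * b' = S * a + T * b\<close>, so that the
    linear term of the tangent inequality vanishes.\<close>
  define c where "c = P / Q'"
  have c: "0 < c" using pos by (simp add: c_def)
  define a' b' where "a' = x * (c * S) + c * T" and "b' = c * S + x * (c * T)"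
  have ab': "0 \<le> a'" "0 \<le> b'" using c ST x by (auto simp: a'_def b'_def)
  have cQ: "S * a' + T * b' = P"
  proof -
    have "S * a' + T * b' = c * Q'" by (simp add: a'_def b'_def Q'_def ising_form_def power2_eq_square algebra_simps)
    then show ?thesis using pos by (simp add: c_def)
  qed
  have "l * (a ^ d + real d * a ^ (d - 1) * (a' - a)) + (b ^ d + real d * b ^ (d - 1) * (b' - b))
      \<le> l * a' ^ d + b' ^ d"
    using l ab ab' by (intro add_mono mult_left_mono power_tangent) auto
  moreover have "l * (a ^ d + real d * a ^ (d - 1) * (a' - a)) + (b ^ d + real d * b ^ (d - 1) * (b' - b)) =
      P + real d * ((S * a' + T * b') - (S * a + T * b))"
    unfolding Pd by (simp add: S_def T_def algebra_simps)
  ultimately have num: "P \<le> ising_num x l d (c * S) (c * T)"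
    unfolding cQ P1[symmetric] by (simp add: ising_num_def a'_def b'_def)
  have form: "ising_form x (c * S) (c * T) = P\<^sup>2 / Q'"
  proof -
    have "ising_form x (c * S) (c * T) = c\<^sup>2 * Q'"
      by (simp add: Q'_def ising_form_def power2_eq_square algebra_simps)
    then show ?thesis using pos by (simp add: c_def power2_eq_square)
  qed
  have "ising_bethe x l d (c * S) (c * T) \<le> ising_bethe x l d s t"
    using c ST by (intro max) auto
  moreover have "ln P \<le> ln (ising_num x l d (c * S) (c * T))" using num pos by simp
  ultimately have "real d / 2 * ln Q \<le> real d / 2 * ln (P\<^sup>2 / Q')"
    unfolding ising_bethe_def form P_def[symmetric] Q_def[symmetric] by linarith
  then have "ln Q \<le> ln (P\<^sup>2 / Q')" using d by simp
  then have "Q \<le> P\<^sup>2 / Q'" using pos by simp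
  then have "Q * Q' \<le> P\<^sup>2" using pos by (simp add: field_simps)
  \<comment> \<open>Lagrange's identity for the bond form, whose determinant is
    \<open>x\<^sup>2 - 1\<close>. Maximality gives the reverse of Cauchy-Schwarz, so
    \<open>(s, t)\<close> and \<open>(S, T)\<close> are parallel; this also excludes a maximum on
    the boundary.\<close>
  moreover have "Q * Q' - P\<^sup>2 = (x\<^sup>2 - 1) * (s * T - t * S)\<^sup>2"
    unfolding P1 a_def b_def Q_def Q'_def ising_form_def by (simp add: power2_eq_square algebra_simps)
  ultimately have "(x\<^sup>2 - 1) * (s * T - t * S)\<^sup>2 \<le> 0" by simp
  moreover have "0 < x\<^sup>2 - 1" using x by simp
  ultimately have "(s * T - t * S)\<^sup>2 \<le> 0" by (simp add: mult_le_0_iff)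
  then have eq: "s * T = t * S" by simp
  have s0: "0 < s"
  proof (rule ccontr)
    assume "\<not> 0 < s"
    then have "s = 0" using st by simp
    then show False using eq st ST by auto
  qed
  have t0: "0 < t"
  proof (rule ccontr)
    assume "\<not> 0 < t"
    then have "t = 0" using st by simp
    then show False using eq s0 ST by auto
  qed
  have "ising_fixed x l d s t (S / s)"
    using s0 eq unfolding ising_fixed_def S_def[symmetric] T_def[symmetric] a_def[symmetric] b_def[symmetric]
    by (simp add: field_simps)
  then show ?thesis using s0 t0 ST by (intro conjI exI[of _ "S / s"]) auto
qed

lemma ising_bethe_maximizer:
  assumes x: "1 \<le> x" and l: "0 < l" and d: "0 < d"
  obtains s t z where "0 < s" "0 < t" "0 < z" "s + t = 1" "ising_fixed x l d s t z"
    "\<And>s' t'. 0 \<le> s' \<Longrightarrow> 0 \<le> t' \<Longrightarrow> 0 < s' + t' \<Longrightarrow> ising_bethe x l d s' t' \<le> ising_bethe x l d s t"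
proof (cases "x = 1")
  case True
  \<comment> \<open>Without coupling the functional is constant and maximality yields no equation,
    so the fixed vector is written down explicitly.\<close>
  have const: "ising_bethe x l d s t = ln (l + 1)" if st: "0 \<le> s" "0 \<le> t" "0 < s + t" for s t
  proof -
    have "ising_num x l d s t = (l + 1) * (s + t) ^ d" by (simp add: True ising_num_def algebra_simps)
    moreover have "ising_form x s t = (s + t)\<^sup>2"
      by (simp add: True ising_form_def power2_eq_square algebra_simps)
    ultimately show ?thesis using l st by (simp add: ising_bethe_def ln_mult ln_realpow)
  qed
  have sum: "l / (l + 1) + 1 / (l + 1) = 1" using l by (simp flip: add_divide_distrib)
  show ?thesis
  proof (rule that[of "l / (l + 1)" "1 / (l + 1)" "l + 1"])
    show "ising_fixed x l d (l / (l + 1)) (1 / (l + 1)) (l + 1)"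
      using l sum by (simp add: True ising_fixed_def)
    show "ising_bethe x l d s' t' \<le> ising_bethe x l d (l / (l + 1)) (1 / (l + 1))"
      if "0 \<le> s'" "0 \<le> t'" "0 < s' + t'" for s' t'
      using that l sum by (simp add: const)
  qed (use l sum in auto)
next
  case False
  then have x1: "1 < x" using x by simp
  have "continuous_on {0..1} (\<lambda>t. ising_bethe x l d (1 - t) t)"
    unfolding ising_bethe_def
  proof (intro continuous_intros)
    show "\<forall>t\<in>{0..1}. ising_num x l d (1 - t) t \<noteq> 0"
      using ising_num_pos[OF x l, of "1 - _" _ d] by (metis add.commute atLeastAtMost_iff diff_add_cancel diff_ge_0_iff_ge less_numeral_extra(3) zero_less_one)
    show "\<forall>t\<in>{0..1}. ising_form x (1 - t) t \<noteq> 0"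
      using ising_form_pos[OF x, of "1 - _" _] by (metis add.commute atLeastAtMost_iff diff_add_cancel diff_ge_0_iff_ge less_numeral_extra(3) zero_less_one)
  qed (auto simp: ising_num_def ising_form_def intro!: continuous_intros)
  then obtain t where t: "t \<in> {0..1}"
    and tmax: "\<And>t'. t' \<in> {0..1} \<Longrightarrow> ising_bethe x l d (1 - t') t' \<le> ising_bethe x l d (1 - t) t"
    using continuous_attains_sup[of "{0..1::real}" "\<lambda>t. ising_bethe x l d (1 - t) t"] by auto
  have max: "ising_bethe x l d s' t' \<le> ising_bethe x l d (1 - t) t"
    if "0 \<le> s'" "0 \<le> t'" "0 < s' + t'" for s' t'
  proof -
    have "ising_bethe x l d s' t' = ising_bethe x l d (1 / (s' + t') * s') (1 / (s' + t') * t')"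
      using that x l by (intro ising_bethe_scale[symmetric]) auto
    also have "1 / (s' + t') * s' = 1 - t' / (s' + t')" using that by (simp add: field_simps)
    also have "ising_bethe x l d (1 - t' / (s' + t')) (1 / (s' + t') * t') \<le> ising_bethe x l d (1 - t) t"
      using that by (simp, intro tmax) (auto simp: field_simps)
    finally show ?thesis .
  qed
  have "0 < 1 - t \<and> 0 < t \<and> (\<exists>z>0. ising_fixed x l d (1 - t) t z)"
    using t by (intro ising_bethe_maximizer_fixed[OF x1 l d] max) auto
  then show ?thesis using that[of "1 - t" t] max by auto
qed

lemma ising_num_fixed:
  assumes "ising_fixed x l d s t z" "0 < d"
  shows "ising_num x l d s t = z * ising_form x s t"
proof -
  have "ising_num x l d s t = (l * (x * s + t) ^ (d - 1)) * (x * s + t) + (s + x * t) ^ (d - 1) * (s + x * t)"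
    using assms(2) by (simp add: ising_num_def power_eq_if)
  also have "\<dots> = z * s * (x * s + t) + z * t * (s + x * t)" using assms(1) by (simp add: ising_fixed_def)
  finally show ?thesis by (simp add: ising_form_def power2_eq_square algebra_simps)
qed

text \<open>With \<open>(s, t)\<close> held fixed the derivative in \<open>ln x\<close> is
  \<open>d * c\<close> from the numerator minus \<open>d / 2 * c\<close> from the form, where
  \<open>c\<close> is the bond correlation; the fixed-point equation is what brings the same
  \<open>c\<close> into the numerator. The quadratic error comes from
  \<open>y - y\<^sup>2 \<le> ln (1 + y)\<close>, used for
  \<open>y \<le> real d * e \<le> 1\<close>.\<close>

lemma ising_bethe_increment:
  assumes x: "1 \<le> x" and l: "0 < l" and d: "0 < d" and st: "0 < s" "0 < t" "0 < z"
    and fixed: "ising_fixed x l d s t z" and e: "0 \<le> e" "real d * e \<le> 1"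
  shows "real d / 2 * e * bond_corr x (t / s) (t / s) - (real d * e)\<^sup>2
    \<le> ising_bethe (x * (1 + e)) l d s t - ising_bethe x l d s t"
proof -
  define P Q where "P = ising_num x l d s t" and "Q = ising_form x s t"
  define c where "c = x * (s\<^sup>2 + t\<^sup>2) / Q"
  have PQ: "0 < P" "0 < Q" unfolding P_def Q_def using assms by (auto intro!: ising_num_pos ising_form_pos)
  have P: "P = z * Q" unfolding P_def Q_def by (rule ising_num_fixed[OF fixed d])
  have cQ: "c * Q = x * (s\<^sup>2 + t\<^sup>2)" using PQ by (simp add: c_def)
  have c: "0 \<le> c" "c \<le> 1"
    using PQ x st by (auto simp: c_def divide_le_eq_1 Q_def ising_form_def algebra_simps)
  have corr: "bond_corr x (t / s) (t / s) = c"
  proof -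
    have "s\<^sup>2 * (x * (1 + t / s * (t / s))) = x * (s\<^sup>2 + t\<^sup>2)"
      and "s\<^sup>2 * (x * (1 + t / s * (t / s)) + t / s + t / s) = Q"
      using st by (simp_all add: Q_def ising_form_def field_simps power2_eq_square)
    moreover have "bond_corr x (t / s) (t / s) =
        (s\<^sup>2 * (x * (1 + t / s * (t / s)))) / (s\<^sup>2 * (x * (1 + t / s * (t / s)) + t / s + t / s))"
      using st by (simp add: bond_corr_def)
    ultimately show ?thesis by (simp only: c_def)
  qed
  have form: "ising_form (x * (1 + e)) s t = Q * (1 + e * c)"
  proof -
    have "Q * (1 + e * c) = Q + e * (c * Q)" by (simp add: algebra_simps)
    then show ?thesis unfolding cQ by (simp add: Q_def ising_form_def algebra_simps)
  qed
  have "P + real d * e * (c * P) \<le> ising_num (x * (1 + e)) l d s t"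
  proof -
    have xs: "0 \<le> x * s + t" "0 \<le> s + x * t" "0 \<le> x * (1 + e) * s + t" "0 \<le> s + x * (1 + e) * t"
      using x st e by auto
    have "l * ((x * s + t) ^ d + real d * (x * s + t) ^ (d - 1) * ((x * (1 + e) * s + t) - (x * s + t))) +
        ((s + x * t) ^ d + real d * (s + x * t) ^ (d - 1) * ((s + x * (1 + e) * t) - (s + x * t)))
      \<le> l * (x * (1 + e) * s + t) ^ d + (s + x * (1 + e) * t) ^ d"
      using l xs by (intro add_mono mult_left_mono power_tangent) auto
    moreover have "l * ((x * s + t) ^ d + real d * (x * s + t) ^ (d - 1) * ((x * (1 + e) * s + t) - (x * s + t))) +
        ((s + x * t) ^ d + real d * (s + x * t) ^ (d - 1) * ((s + x * (1 + e) * t) - (s + x * t)))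
      = P + real d * e * (x * ((l * (x * s + t) ^ (d - 1)) * s + (s + x * t) ^ (d - 1) * t))"
      by (simp add: P_def ising_num_def algebra_simps)
    moreover have "x * ((l * (x * s + t) ^ (d - 1)) * s + (s + x * t) ^ (d - 1) * t) = c * P"
    proof -
      have "x * ((l * (x * s + t) ^ (d - 1)) * s + (s + x * t) ^ (d - 1) * t) = z * (x * (s\<^sup>2 + t\<^sup>2))"
        using fixed by (simp add: ising_fixed_def power2_eq_square algebra_simps)
      then show ?thesis unfolding P cQ[symmetric] by simp
    qed
    ultimately show ?thesis by (simp add: ising_num_def)
  qed
  then have num: "P * (1 + real d * e * c) \<le> ising_num (x * (1 + e)) l d s t" by (simp add: algebra_simps)
  have dec: "0 \<le> real d * e * c" "real d * e * c \<le> 1"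
    using c e mult_mono[of "real d * e" 1 c 1] by auto
  have "ln (P * (1 + real d * e * c)) \<le> ln (ising_num (x * (1 + e)) l d s t)"
  proof -
    have "0 < P * (1 + real d * e * c)" using PQ dec by (intro mult_pos_pos add_pos_nonneg) auto
    then show ?thesis using num by simp
  qed
  then have 1: "ln P + ln (1 + real d * e * c) \<le> ln (ising_num (x * (1 + e)) l d s t)"
    using PQ dec by (simp add: ln_mult)
  have 2: "real d * e * c - (real d * e * c)\<^sup>2 \<le> ln (1 + real d * e * c)"
    by (rule ln_one_plus_pos_lower_bound[OF dec])
  have 3: "ln (Q * (1 + e * c)) \<le> ln Q + e * c"
  proof -
    have "0 \<le> e * c" using e c by simp
    then show ?thesis using PQ ln_add_one_self_le_self[of "e * c"] by (simp add: ln_mult)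
  qed
  have 4: "(real d * e * c)\<^sup>2 \<le> (real d * e)\<^sup>2"
    using c e by (intro power_mono) (auto intro: mult_left_le)
  have 5: "real d / 2 * ln (Q * (1 + e * c)) \<le> real d / 2 * (ln Q + e * c)"
    using 3 by (intro mult_left_mono) auto
  show ?thesis
    unfolding ising_bethe_def form corr P_def[symmetric] Q_def[symmetric]
    using 1 2 4 5 by (simp add: algebra_simps)
qed

text \<open>In the variable \<open>w = - ln t\<close> the recursion reads \<open>w = ln l + (d - 1) * G w\<close> with \<open>G\<close>
  concave and \<open>G 0 = 0\<close>, so for \<open>l > 1\<close> it has one positive solution.\<close>

lemma ratio_fixed_point_unique:
  fixes x l t t' :: real
  assumes x: "1 \<le> x" and l: "1 < l" and t: "0 < t" "t < t'" "t' \<le> 1"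
    and fp: "t = ((1 + x * t) / (x + t)) ^ n / l" and fp': "t' = ((1 + x * t') / (x + t')) ^ n / l"
  shows False
proof -
  define h where "h = (\<lambda>w. w - real n * (ln (x * exp w + 1) - ln (exp w + x)))"
  define h' where "h' = (\<lambda>w. 1 - real n * (x * exp w / (x * exp w + 1) - exp w / (exp w + x)))"
  have "convex_on {0..} h"
  proof (rule convex_on_realI)
    fix w :: real assume "w \<in> {0..}"
    have "0 < x * exp w + 1" "0 < exp w + x" using x by (auto intro: add_pos_pos)
    then show "(h has_real_derivative h' w) (at w)"
      unfolding h_def h'_def by (auto intro!: derivative_eq_intros simp: divide_inverse algebra_simps)
  next
    fix w1 w2 :: real assume w: "w1 \<in> {0..}" "w2 \<in> {0..}" "w1 \<le> w2"
    define a b where "a = exp w1" and "b = exp w2"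
    have ab: "1 \<le> a" "a \<le> b" using w by (auto simp: a_def b_def)
    have form: "x * c / (x * c + 1) - c / (c + x) = (x\<^sup>2 - 1) * (c / ((x * c + 1) * (c + x)))" if "1 \<le> c" for c
    proof -
      have "x * c + 1 \<noteq> 0" "c + x \<noteq> 0" using that x by (auto simp: add_nonneg_eq_0_iff)
      then show ?thesis by (simp add: divide_simps) (simp add: power2_eq_square algebra_simps)
    qed
    \<comment> \<open>Monotonicity of the derivative comes down to the sign of
      \<open>x * (b - a) * (a * b - 1)\<close>; restricting to \<open>w \<ge> 0\<close> gives
      \<open>a * b \<ge> 1\<close>.\<close>
    have "b * ((x * a + 1) * (a + x)) \<le> a * ((x * b + 1) * (b + x))"
    proof -
      have "a * ((x * b + 1) * (b + x)) - b * ((x * a + 1) * (a + x)) = x * ((b - a) * (a * b - 1))"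
        by (simp add: algebra_simps)
      moreover have "1 \<le> a * b" using ab mult_mono[of 1 a 1 b] by auto
      moreover have "0 \<le> x * ((b - a) * (a * b - 1))"
        using ab x \<open>1 \<le> a * b\<close> by (intro mult_nonneg_nonneg) auto
      ultimately show ?thesis by linarith
    qed
    moreover have "0 < (x * a + 1) * (a + x)" "0 < (x * b + 1) * (b + x)"
      using x ab by (auto intro!: mult_pos_pos add_pos_pos)
    ultimately have "b / ((x * b + 1) * (b + x)) \<le> a / ((x * a + 1) * (a + x))"
      by (simp only: pos_divide_le_eq pos_le_divide_eq times_divide_eq_left)
    then have "(x\<^sup>2 - 1) * (b / ((x * b + 1) * (b + x))) \<le> (x\<^sup>2 - 1) * (a / ((x * a + 1) * (a + x)))"
      using x by (intro mult_left_mono) auto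
    then have "x * b / (x * b + 1) - b / (b + x) \<le> x * a / (x * a + 1) - a / (a + x)"
      using form ab by auto
    then have "real n * (x * b / (x * b + 1) - b / (b + x)) \<le> real n * (x * a / (x * a + 1) - a / (a + x))"
      by (intro mult_left_mono) auto
    then show "h' w1 \<le> h' w2" by (simp add: h'_def a_def b_def)
  qed auto
  have hfp: "h (- ln t) = ln l" if "0 < t" and fp: "t = ((1 + x * t) / (x + t)) ^ n / l" for t
  proof -
    have pos: "0 < 1 + x * t" "0 < x + t" using that x by (auto intro: add_pos_pos)
    have e1: "ln t = real n * (ln (1 + x * t) - ln (x + t)) - ln l"
      using pos l by (subst fp) (simp add: ln_div ln_realpow)
    have e2: "ln (x * exp (- ln t) + 1) = ln (x + t) - ln t"
    proof -
      have "x * exp (- ln t) + 1 = (x + t) / t" using that by (simp add: exp_minus field_simps)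
      then show ?thesis using that pos by (simp add: ln_div)
    qed
    have e3: "ln (exp (- ln t) + x) = ln (1 + x * t) - ln t"
    proof -
      have "exp (- ln t) + x = (1 + x * t) / t" using that by (simp add: exp_minus field_simps)
      then show ?thesis using that pos by (simp add: ln_div)
    qed
    show ?thesis unfolding h_def e2 e3 using e1 by (simp add: algebra_simps)
  qed
  define w w' where "w = - ln t" and "w' = - ln t'"
  have hw: "h w = ln l" "h w' = ln l" using hfp fp fp' t by (auto simp: w_def w'_def)
  have h0: "h 0 = 0" by (simp add: h_def add.commute)
  have ww: "0 \<le> w'" "w' < w" using t by (auto simp: w_def w'_def)
  \<comment> \<open>The chord from \<open>0\<close> to \<open>w\<close>: as \<open>h 0 = 0\<close>
    and \<open>h w = ln l > 0\<close>, the value at the intermediate point \<open>w'\<close> would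
    lie strictly below \<open>ln l\<close>.\<close>
  have "h ((1 - w' / w) *\<^sub>R 0 + (w' / w) *\<^sub>R w) \<le> (1 - w' / w) * h 0 + (w' / w) * h w"
    by (rule convex_onD[OF \<open>convex_on {0..} h\<close>]) (use ww in auto)
  then have "ln l \<le> w' / w * ln l" using ww hw h0 by simp
  moreover have "w' / w * ln l < 1 * ln l" using ww l by (intro mult_strict_right_mono) auto
  ultimately show False by simp
qed

text \<open>The recursion is monotone and starts below the fixed point \<open>t\<close>, so it
  increases to a fixed point that is at most \<open>t\<close>. This limit is positive because the
  first ratio is, and uniqueness identifies it with \<open>t\<close>.\<close>

lemma tree_ratio_tendsto:
  assumes x: "1 \<le> x" and l: "1 < l"
    and t: "0 < t" "t \<le> 1" and fp: "t = ((1 + x * t) / (x + t)) ^ (d - 1) / l"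
  shows "tree_ratio x l d \<longlonglongrightarrow> t"
proof -
  let ?T = "\<lambda>t. ((1 + x * t) / (x + t)) ^ (d - 1) / l"
  have mono: "?T a \<le> ?T b" if "0 \<le> a" "a \<le> b" for a b
  proof -
    have "(1 + x * a) / (x + a) \<le> (1 + x * b) / (x + b)"
    proof -
      have "(1 + x * b) * (x + a) - (1 + x * a) * (x + b) = (x\<^sup>2 - 1) * (b - a)"
        by (simp add: power2_eq_square algebra_simps)
      moreover have "0 \<le> (x\<^sup>2 - 1) * (b - a)" using that x by (intro mult_nonneg_nonneg) auto
      ultimately have "(1 + x * a) * (x + b) \<le> (1 + x * b) * (x + a)" by linarith
      moreover have "0 < x + a" "0 < x + b" using that x by auto
      ultimately show ?thesis by (simp add: divide_simps)
    qed
    moreover have "0 \<le> (1 + x * a) / (x + a)" using that x by simp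
    ultimately show ?thesis using l by (intro divide_right_mono power_mono) auto
  qed
  have nn: "0 \<le> tree_ratio x l d k" for k using x l by (intro tree_ratio_nonneg) auto
  have inc: "tree_ratio x l d k \<le> tree_ratio x l d (Suc k)" for k
  proof (induction k)
    case (Suc k)
    show ?case using mono[OF nn Suc] by (simp only: tree_ratio.simps)
  qed (use nn[of "Suc 0"] in simp)
  have le: "tree_ratio x l d k \<le> t" for k
  proof (induction k)
    case (Suc k)
    show ?case using mono[OF nn Suc] fp by (simp only: tree_ratio.simps)
  qed (use t in simp)
  obtain L where L: "tree_ratio x l d \<longlonglongrightarrow> L"
    using incseq_convergent[of "tree_ratio x l d" t] inc le by (metis incseq_SucI)
  have L1: "tree_ratio x l d 1 \<le> L"
    by (rule incseq_le[OF _ L]) (use inc in \<open>auto simp: incseq_Suc_iff\<close>)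
  have "0 < tree_ratio x l d 1" using x l by simp
  then have L0: "0 < L" using L1 by linarith
  have Lt: "L \<le> t" using L le by (intro LIMSEQ_le_const2) auto
  have "(\<lambda>k. ?T (tree_ratio x l d k)) \<longlonglongrightarrow> ?T L"
    using L0 x l by (intro tendsto_intros L) auto
  moreover have "(\<lambda>k. tree_ratio x l d (Suc k)) \<longlonglongrightarrow> L" using L by (rule LIMSEQ_Suc)
  ultimately have "L = ?T L" using LIMSEQ_unique by auto
  then have "\<not> L < t" using ratio_fixed_point_unique[OF x l L0 _ t(2) _ fp] by blast
  then show ?thesis using L Lt by simp
qed

text \<open>Selects the fixed point reached from the plus boundary. If \<open>s < t\<close>,
  swapping the coordinates puts the larger power next to the factor \<open>l > 1\<close> and leaves
  the form unchanged. Without coupling the swap is neutral, and the fixed-point equation gives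
  \<open>s = l * t\<close> instead.\<close>

lemma ising_maximizer_le:
  assumes x: "1 \<le> x" and l: "1 < l" and d: "0 < d" and st: "0 < s" "0 < t"
    and fixed: "ising_fixed x l d s t z"
    and max: "ising_bethe x l d t s \<le> ising_bethe x l d s t"
  shows "t \<le> s"
proof (rule ccontr)
  assume "\<not> t \<le> s"
  then have st': "s < t" by simp
  have "x \<noteq> 1"
  proof
    assume x1: "x = 1"
    then have "l * (s + t) ^ (d - 1) = z * s" "(s + t) ^ (d - 1) = z * t" using fixed by (auto simp: ising_fixed_def)
    then have "z * s = l * (z * t)" by metis
    moreover have "0 < z * t" using \<open>(s + t) ^ (d - 1) = z * t\<close> st by (metis add_pos_pos zero_less_power)
    ultimately have "s = l * t" using st by (auto simp: zero_less_mult_iff)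
    moreover have "1 * t < l * t" using l st by (intro mult_strict_right_mono) auto
    ultimately show False using st' by simp
  qed
  then have x1: "1 < x" using x by simp
  have "ising_form x t s = ising_form x s t" by (simp add: ising_form_def algebra_simps)
  then have "ln (ising_num x l d t s) \<le> ln (ising_num x l d s t)" using max by (simp add: ising_bethe_def)
  then have le: "ising_num x l d t s \<le> ising_num x l d s t"
    using ising_num_pos[of x l t s d] ising_num_pos[of x l s t d] x l st by simp
  have "x * s + t < s + x * t" 
  proof -
    have "0 < (x - 1) * (t - s)" using x1 st' by simp
    then show ?thesis by (simp add: algebra_simps)
  qed
  then have "(x * s + t) ^ d < (s + x * t) ^ d" using st x d by (intro power_strict_mono) auto
  then have "0 < (l - 1) * ((s + x * t) ^ d - (x * s + t) ^ d)" using l by simp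
  moreover have "ising_num x l d t s - ising_num x l d s t = (l - 1) * ((s + x * t) ^ d - (x * s + t) ^ d)"
    by (simp add: ising_num_def algebra_simps)
  ultimately show False using le by simp
qed

lemma bond_corr_tendsto:
  assumes x: "1 \<le> x" and l: "1 < l" and d: "0 < d" and st: "0 < s" "0 < t"
    and fixed: "ising_fixed x l d s t z"
    and max: "ising_bethe x l d t s \<le> ising_bethe x l d s t"
  shows "(\<lambda>r. bond_corr x (tree_ratio x l d r) (tree_ratio x l d (Suc r))) \<longlonglongrightarrow> bond_corr x (t / s) (t / s)"
proof -
  have z: "l * (x * s + t) ^ (d - 1) = z * s" "(s + x * t) ^ (d - 1) = z * t"
    using fixed by (auto simp: ising_fixed_def)
  have xs: "0 < x * s + t" "0 < s + x * t" using st x by (auto intro: add_pos_pos)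
  have "0 < z * t" using z(2) xs by (metis zero_less_power)
  then have z0: "0 < z" using st by (simp add: zero_less_mult_iff)
  have "(1 + x * (t / s)) / (x + t / s) = (s + x * t) / (x * s + t)"
    using st xs by (simp add: divide_simps)
  then have "((1 + x * (t / s)) / (x + t / s)) ^ (d - 1) / l = (s + x * t) ^ (d - 1) / (l * (x * s + t) ^ (d - 1))"
    by (simp add: power_divide mult.commute)
  also have "\<dots> = t / s" unfolding z using z0 st by simp
  finally have fp: "t / s = ((1 + x * (t / s)) / (x + t / s)) ^ (d - 1) / l" ..
  have lim: "tree_ratio x l d \<longlonglongrightarrow> t / s"
    using ising_maximizer_le[OF assms] st by (intro tree_ratio_tendsto[OF x l _ _ fp]) auto
  have "0 < x * (1 + t / s * (t / s)) + t / s + t / s"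
    using st x by (intro add_pos_pos mult_pos_pos add_pos_nonneg) auto
  then show ?thesis unfolding bond_corr_def
    by (intro tendsto_intros lim LIMSEQ_Suc[OF lim]) auto
qed

section \<open>The Ising pressure on locally tree-like regular graphs\<close>

definition ising_pressure :: "real \<Rightarrow> real \<Rightarrow> nat \<Rightarrow> real" where
  "ising_pressure x l d = (SUP t\<in>{0..1}. ising_bethe x l d (1 - t) t)"

lemma ising_pressure_attained:
  assumes "1 \<le> x" "0 < l" "0 < d"
  shows "\<exists>s t z. 0 < s \<and> 0 < t \<and> 0 < z \<and> ising_fixed x l d s t z \<and>
      ising_bethe x l d s t = ising_pressure x l d"
    and ising_bethe_le_pressure: "0 \<le> s' \<Longrightarrow> 0 \<le> t' \<Longrightarrow> 0 < s' + t' \<Longrightarrow>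
      ising_bethe x l d s' t' \<le> ising_pressure x l d"
proof -
  obtain s t z where st: "0 < s" "0 < t" "0 < z" "s + t = 1" "ising_fixed x l d s t z"
    and max: "\<And>s' t'. 0 \<le> s' \<Longrightarrow> 0 \<le> t' \<Longrightarrow> 0 < s' + t' \<Longrightarrow> ising_bethe x l d s' t' \<le> ising_bethe x l d s t"
    using ising_bethe_maximizer[OF assms] by metis
  have s: "s = 1 - t" using st by simp
  have "ising_pressure x l d = ising_bethe x l d s t"
    unfolding ising_pressure_def s
  proof (rule cSup_eq_maximum)
    show "ising_bethe x l d (1 - t) t \<in> (\<lambda>t. ising_bethe x l d (1 - t) t) ` {0..1}"
      using st by (intro imageI) auto
  qed (use max s in auto)
  then show "\<exists>s t z. 0 < s \<and> 0 < t \<and> 0 < z \<and> ising_fixed x l d s t z \<and>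
      ising_bethe x l d s t = ising_pressure x l d"
    and "0 \<le> s' \<Longrightarrow> 0 \<le> t' \<Longrightarrow> 0 < s' + t' \<Longrightarrow> ising_bethe x l d s' t' \<le> ising_pressure x l d"
    using st max by auto
qed

lemma ising_pressure_swap:
  assumes "1 \<le> x" "0 < l" "0 < d"
  shows "ising_pressure x l d = ln l + ising_pressure x (1 / l) d"
proof (rule antisym)
  obtain s t where st: "0 < s" "0 < t" "ising_bethe x l d s t = ising_pressure x l d"
    using ising_pressure_attained[OF assms] by auto
  have l': "0 < 1 / l" using assms by simp
  obtain s' t' where st': "0 < s'" "0 < t'" "ising_bethe x (1 / l) d s' t' = ising_pressure x (1 / l) d"
    using ising_pressure_attained[OF assms(1) l' assms(3)] by auto
  show "ising_pressure x l d \<le> ln l + ising_pressure x (1 / l) d"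
    using ising_bethe_swap[of x l s t d] ising_bethe_le_pressure[OF assms(1) l' assms(3), of t s] st assms by simp
  show "ln l + ising_pressure x (1 / l) d \<le> ising_pressure x l d"
    using ising_bethe_swap[of x l t' s' d] ising_bethe_le_pressure[OF assms, of t' s'] st' assms by simp
qed

lemma ising_pressure_no_coupling:
  assumes "0 < l" "0 < d"
  shows "ising_pressure 1 l d = ln (l + 1)"
proof -
  obtain s t where st: "0 < s" "0 < t" "ising_bethe 1 l d s t = ising_pressure 1 l d"
    using ising_pressure_attained[of 1 l d] assms by auto
  have "ising_num 1 l d s t = (l + 1) * (s + t) ^ d" by (simp add: ising_num_def algebra_simps)
  moreover have "ising_form 1 s t = (s + t)\<^sup>2"
    by (simp add: ising_form_def power2_eq_square algebra_simps)
  ultimately show ?thesis using st assms by (simp add: ising_bethe_def ln_mult ln_realpow)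
qed

text \<open>Raising the field from \<open>1\<close> to \<open>l\<close> multiplies the numerator by
  at most \<open>l\<close>; this controls the approach to \<open>l = 1\<close> from above.\<close>

lemma ising_pressure_field_le:
  assumes "1 \<le> x" "1 \<le> l" "0 < d"
  shows "ising_pressure x l d \<le> ising_pressure x 1 d + ln l"
proof -
  obtain s t where st: "0 < s" "0 < t" "ising_bethe x l d s t = ising_pressure x l d"
    using ising_pressure_attained[of x l d] assms by auto
  have max: "ising_bethe x 1 d s t \<le> ising_pressure x 1 d"
    using ising_bethe_le_pressure[of x 1 d s t] st assms by simp
  have "ising_num x l d s t \<le> l * ising_num x 1 d s t"
    using assms st mult_right_mono[of 1 l "(s + x * t) ^ d"] by (simp add: ising_num_def algebra_simps)
  moreover have "0 < ising_num x l d s t" "0 < ising_num x 1 d s t"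
    using assms st by (auto intro!: ising_num_pos)
  ultimately have "ln (ising_num x l d s t) \<le> ln (l * ising_num x 1 d s t)" using assms by simp
  also have "\<dots> = ln l + ln (ising_num x 1 d s t)"
    using assms \<open>0 < ising_num x 1 d s t\<close> by (simp add: ln_mult)
  finally show ?thesis using st max by (simp add: ising_bethe_def)
qed

context regular
begin

lemma ising_weight_pos: "0 < x \<Longrightarrow> 0 < l \<Longrightarrow> 0 < ising_weight V E x l \<sigma>"
  unfolding ising_weight_def field_weight_def bond_weight_def by (intro mult_pos_pos prod_pos) auto

lemma Z_Ising_pos: "0 < x \<Longrightarrow> 0 < l \<Longrightarrow> 0 < Z_Ising V E x l"
  unfolding Z_Ising_def using finite_spins[OF finite_V]
  by (intro sum_pos ising_weight_pos) (auto simp: PiE_eq_empty_iff)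

lemma Z_Ising_ge_pressure:
  assumes "1 \<le> x" "0 < l" "0 < d"
  shows "real (card V) * ising_pressure x l d \<le> ln (Z_Ising V E x l)"
proof -
  obtain s t z where st: "0 < s" "0 < t" "ising_fixed x l d s t z" "ising_bethe x l d s t = ising_pressure x l d"
    using ising_pressure_attained[OF assms] by metis
  let ?A = "ising_num x l d s t / sqrt (ising_form x s t) ^ d"
  have pos: "0 < ising_num x l d s t" "0 < ising_form x s t"
    using assms st by (auto intro!: ising_num_pos ising_form_pos)
  have "?A ^ card V \<le> Z_Ising V E x l"
    unfolding ising_num_def using Z_Ising_lower_bound[OF assms(1,2) st(1,2) assms(3)] st(3)
    unfolding ising_fixed_def by blast
  moreover have "0 < ?A ^ card V" using pos by simp
  ultimately have "ln (?A ^ card V) \<le> ln (Z_Ising V E x l)" by (simp only: ln_mono)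
  moreover have "ln (?A ^ card V) = real (card V) * ising_bethe x l d s t"
    using pos by (simp add: ln_realpow ln_div ising_bethe_def ln_sqrt)
  ultimately show ?thesis using st by simp
qed

lemma Z_Ising_no_coupling: "Z_Ising V E 1 l = (l + 1) ^ card V"
proof -
  have "Z_Ising V E 1 l = (\<Sum>\<sigma>\<in>spins V. \<Prod>v\<in>V. field_weight l (\<sigma> v))"
    by (simp add: Z_Ising_def ising_weight_def bond_weight_def)
  also have "\<dots> = (\<Prod>v\<in>V. field_weight l 1 + field_weight l (-1))"
    by (rule sum_spins_prod[OF finite_V])
  finally show ?thesis by (simp add: field_weight_def)
qed

lemma Z_Ising_flip:
  assumes "0 < l"
  shows "Z_Ising V E x l = l ^ card V * Z_Ising V E x (1 / l)"
proof -
  let ?f = "\<lambda>\<sigma>. \<lambda>v\<in>V. - \<sigma> v :: real"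
  have bij: "bij_betw ?f (spins V) (spins V)"
  proof (rule bij_betwI[where g = ?f])
    have "?f \<sigma> \<in> spins V" if "\<sigma> \<in> spins V" for \<sigma>
    proof -
      have "- \<sigma> v \<in> {-1, 1}" if "v \<in> V" for v using spin_cases[OF \<open>\<sigma> \<in> spins V\<close> that] by auto
      then show ?thesis by auto
    qed
    then show "?f \<in> spins V \<rightarrow> spins V" "?f \<in> spins V \<rightarrow> spins V" by blast+
    have "?f (?f \<sigma>) = \<sigma>" if "\<sigma> \<in> spins V" for \<sigma>
      using that by (auto simp: fun_eq_iff PiE_def extensional_def)
    then show "\<sigma> \<in> spins V \<Longrightarrow> ?f (?f \<sigma>) = \<sigma>" "\<sigma> \<in> spins V \<Longrightarrow> ?f (?f \<sigma>) = \<sigma>" for \<sigma> by blast+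
  qed
  have "ising_weight V E x l (?f \<sigma>) = l ^ card V * ising_weight V E x (1 / l) \<sigma>" if \<sigma>: "\<sigma> \<in> spins V" for \<sigma>
  proof -
    have "(\<Prod>v\<in>V. field_weight l (?f \<sigma> v)) = (\<Prod>v\<in>V. l * field_weight (1 / l) (\<sigma> v))"
    proof (rule prod.cong[OF refl])
      fix v assume "v \<in> V"
      then show "field_weight l (?f \<sigma> v) = l * field_weight (1 / l) (\<sigma> v)"
        using spin_cases[OF \<sigma>, of v] assms by (auto simp: field_weight_def)
    qed
    moreover have "(\<Prod>e\<in>E. bond_weight x (?f \<sigma>) e) = (\<Prod>e\<in>E. bond_weight x \<sigma> e)"
    proof (rule prod.cong[OF refl])
      fix e assume "e \<in> E"
      then obtain a b where "e = {a, b}" "a \<noteq> b" "a \<in> V" "b \<in> V" by (rule edge_cases)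
      then show "bond_weight x (?f \<sigma>) e = bond_weight x \<sigma> e" by (simp add: bond_weight_pair)
    qed
    ultimately show ?thesis by (simp add: ising_weight_def prod.distrib)
  qed
  moreover have "Z_Ising V E x l = (\<Sum>\<sigma>\<in>spins V. ising_weight V E x l (?f \<sigma>))"
    unfolding Z_Ising_def by (rule sum.reindex_bij_betw[OF bij, symmetric])
  ultimately show ?thesis by (simp add: Z_Ising_def sum_distrib_left)
qed

lemma Z_Ising_field_mono:
  assumes "0 < x" "0 < l" "l \<le> l'"
  shows "Z_Ising V E x l \<le> Z_Ising V E x l'"
  unfolding Z_Ising_def ising_weight_def
  by (intro sum_mono mult_right_mono prod_mono prod_nonneg)
    (use assms in \<open>auto simp: field_weight_def bond_weight_def\<close>)

section \<open>Raising the coupling in small steps\<close>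

text \<open>\<open>ln Z\<close> is convex in \<open>ln x\<close>, so its increment is at most the
  slope at the right end times \<open>ln (1 + e) \<le> e\<close>. The slope is the mean number of
  monochromatic edges at \<open>x'\<close>.\<close>

lemma Z_Ising_increment:
  assumes x: "1 \<le> x" and l: "0 < l" and e: "0 \<le> e"
  defines "x' \<equiv> x * (1 + e)"
  shows "ln (Z_Ising V E x' l) - ln (Z_Ising V E x l) \<le>
    e * ((\<Sum>f\<in>E. \<Sum>\<sigma>\<in>spins V. ising_weight V E x' l \<sigma> * of_bool (monochromatic \<sigma> f)) / Z_Ising V E x' l)"
proof -
  define k where "k = ln (1 + e)"
  define N where "N = (\<lambda>\<sigma>::'v \<Rightarrow> real. \<Sum>f\<in>E. of_bool (monochromatic \<sigma> f) :: real)"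
  let ?w = "ising_weight V E x' l" and ?Z = "Z_Ising V E x' l"
  define m where "m = (\<Sum>\<sigma>\<in>spins V. ?w \<sigma> * N \<sigma>) / ?Z"
  have x': "0 < x'" "1 \<le> x'" using x e mult_mono[of 1 x 1 "1 + e"] by (auto simp: x'_def)
  have Z: "0 < ?Z" "0 < Z_Ising V E x l" using x' x l by (auto intro: Z_Ising_pos)
  have mZ: "m * ?Z = (\<Sum>\<sigma>\<in>spins V. ?w \<sigma> * N \<sigma>)" using Z by (simp add: m_def)
  have w: "ising_weight V E x l \<sigma> = ?w \<sigma> * exp (- k * N \<sigma>)" for \<sigma>
  proof -
    have "bond_weight x \<sigma> f = bond_weight x' \<sigma> f * exp (- k * of_bool (monochromatic \<sigma> f))" for f
      using e by (simp add: bond_weight_def x'_def k_def exp_minus)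
    then have "(\<Prod>f\<in>E. bond_weight x \<sigma> f) = (\<Prod>f\<in>E. bond_weight x' \<sigma> f) * (\<Prod>f\<in>E. exp (- k * of_bool (monochromatic \<sigma> f)))"
      by (simp add: prod.distrib)
    also have "(\<Prod>f\<in>E. exp (- k * of_bool (monochromatic \<sigma> f))) = exp (- k * N \<sigma>)"
      unfolding N_def sum_distrib_left by (rule exp_sum[OF finite_E, symmetric])
    finally show ?thesis by (simp add: ising_weight_def)
  qed
  \<comment> \<open>Jensen's inequality by hand: the tangent of \<open>exp\<close> at the mean
    \<open>m\<close>, whose linear part sums to \<open>0\<close>.\<close>
  have "exp (- k * m) * ?Z = (\<Sum>\<sigma>\<in>spins V. ?w \<sigma> * (exp (- k * m) * (1 - k * (N \<sigma> - m))))"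
  proof -
    have "(\<Sum>\<sigma>\<in>spins V. ?w \<sigma> * (exp (- k * m) * (1 - k * (N \<sigma> - m)))) =
        exp (- k * m) * ((1 + k * m) * ?Z - k * (\<Sum>\<sigma>\<in>spins V. ?w \<sigma> * N \<sigma>))"
      by (simp add: Z_Ising_def sum_distrib_left sum_subtractf[symmetric] sum.distrib[symmetric] algebra_simps)
    also have "\<dots> = exp (- k * m) * ?Z" unfolding mZ[symmetric] by (simp add: algebra_simps)
    finally show ?thesis by simp
  qed
  also have "\<dots> \<le> (\<Sum>\<sigma>\<in>spins V. ?w \<sigma> * exp (- k * N \<sigma>))"
  proof (intro sum_mono mult_left_mono)
    fix \<sigma> show "exp (- k * m) * (1 - k * (N \<sigma> - m)) \<le> exp (- k * N \<sigma>)"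
    proof -
      have "1 - k * (N \<sigma> - m) \<le> exp (- k * (N \<sigma> - m))" using exp_ge_add_one_self[of "- k * (N \<sigma> - m)"] by simp
      then have "exp (- k * m) * (1 - k * (N \<sigma> - m)) \<le> exp (- k * m) * exp (- k * (N \<sigma> - m))"
        by (intro mult_left_mono) auto
      also have "\<dots> = exp (- k * N \<sigma>)" by (simp add: algebra_simps flip: exp_add)
      finally show ?thesis .
    qed
  qed (use ising_weight_pos[OF x'(1) l] less_imp_le in blast)
  also have "\<dots> = Z_Ising V E x l" by (simp add: Z_Ising_def w)
  finally have "ln (exp (- k * m) * ?Z) \<le> ln (Z_Ising V E x l)" using Z by simp
  then have "ln ?Z - ln (Z_Ising V E x l) \<le> k * m" using Z by (simp add: ln_mult)
  also have "\<dots> \<le> e * m"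
  proof (rule mult_right_mono)
    show "k \<le> e" unfolding k_def using e by (rule ln_add_one_self_le_self)
    have "0 \<le> (\<Sum>\<sigma>\<in>spins V. ?w \<sigma> * N \<sigma>)"
      using ising_weight_pos[OF x'(1) l] by (intro sum_nonneg mult_nonneg_nonneg) (auto simp: N_def less_imp_le intro!: sum_nonneg)
    then show "0 \<le> m" using Z by (simp add: m_def)
  qed
  also have "(\<Sum>\<sigma>\<in>spins V. ?w \<sigma> * N \<sigma>) = (\<Sum>f\<in>E. \<Sum>\<sigma>\<in>spins V. ?w \<sigma> * of_bool (monochromatic \<sigma> f))"
    unfolding N_def sum_distrib_left by (rule sum.swap)
  then have "m = (\<Sum>f\<in>E. \<Sum>\<sigma>\<in>spins V. ?w \<sigma> * of_bool (monochromatic \<sigma> f)) / ?Z" by (simp add: m_def)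
  finally show ?thesis .
qed

text \<open>Every edge is counted from both ends, which explains the \<open>1 / 2\<close>. From an
  end with a tree ball the tree bound applies, from a bad one the trivial bound by \<open>Z\<close>;
  the bad vertices are at most a proportion \<open>\<delta>\<close>.\<close>

lemma monochromatic_sum_le:
  assumes x: "1 \<le> x" and l: "1 \<le> l"
    and bad: "real (card {v \<in> V. \<not> tree_at E v (Suc r)}) \<le> \<delta> * real (card V)"
  shows "(\<Sum>f\<in>E. \<Sum>\<sigma>\<in>spins V. ising_weight V E x l \<sigma> * of_bool (monochromatic \<sigma> f)) / Z_Ising V E x l
    \<le> real d / 2 * (bond_corr x (tree_ratio x l d r) (tree_ratio x l d (Suc r)) + \<delta>) * real (card V)"
proof -
  let ?Z = "Z_Ising V E x l" and ?w = "ising_weight V E x l"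
  define c where "c = bond_corr x (tree_ratio x l d r) (tree_ratio x l d (Suc r))"
  define M where "M = (\<lambda>f. \<Sum>\<sigma>\<in>spins V. ?w \<sigma> * of_bool (monochromatic \<sigma> f))"
  define B where "B = {v \<in> V. \<not> tree_at E v (Suc r)}"
  have Z: "0 < ?Z" using x l by (intro Z_Ising_pos) auto
  have c0: "0 \<le> c" unfolding c_def bond_corr_def
    using x l tree_ratio_nonneg[of x l d r] tree_ratio_nonneg[of x l d "Suc r"]
    by (intro divide_nonneg_nonneg mult_nonneg_nonneg add_nonneg_nonneg) auto
  have MZ: "M f \<le> ?Z" for f
    unfolding M_def Z_Ising_def using ising_weight_pos[of x l] x l
    by (intro sum_mono) (auto simp: less_imp_le)
  have good: "M f \<le> c * ?Z" if v: "v \<in> V" "v \<notin> B" and f: "f \<in> E" "v \<in> f" for v f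
  proof -
    obtain a b where "f = {a, b}" using f(1) by (rule edge_cases)
    then obtain u where u: "f = {v, u}" using f(2) by auto
    have "monochromatic \<sigma> f \<longleftrightarrow> \<sigma> v = \<sigma> u" for \<sigma> :: "'v \<Rightarrow> real" by (auto simp: u monochromatic_def)
    then show ?thesis
      using bond_probability_le[of v r u x l] v f u x l unfolding M_def c_def by (simp add: B_def)
  qed
  have "2 * (\<Sum>f\<in>E. M f) = (\<Sum>f\<in>E. \<Sum>v\<in>f. M f)"
    using edge(2) by (simp add: sum_distrib_left)
  also have "\<dots> = (\<Sum>v\<in>V. \<Sum>f\<in>{f \<in> E. v \<in> f}. M f)" by (rule sum_edges)
  also have "\<dots> \<le> (\<Sum>v\<in>V. real d * ((c + of_bool (v \<in> B)) * ?Z))"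
  proof (rule sum_mono)
    fix v assume v: "v \<in> V"
    have "M f \<le> (c + of_bool (v \<in> B)) * ?Z" if "f \<in> {f \<in> E. v \<in> f}" for f
    proof (cases "v \<in> B")
      case True
      have "0 \<le> c * ?Z" using c0 Z by simp
      then show ?thesis using True MZ[of f] by (simp add: algebra_simps)
    qed (use good[OF v] that in auto)
    then have "(\<Sum>f\<in>{f \<in> E. v \<in> f}. M f) \<le> real (card {f \<in> E. v \<in> f}) * ((c + of_bool (v \<in> B)) * ?Z)"
      by (rule sum_bounded_above)
    then show "(\<Sum>f\<in>{f \<in> E. v \<in> f}. M f) \<le> real d * ((c + of_bool (v \<in> B)) * ?Z)"
      by (simp add: degree[OF v])
  qed
  also have "\<dots> = real d * ?Z * (c * real (card V) + real (card B))"
  proof -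
    have "(\<Sum>v\<in>V. of_bool (v \<in> B) :: real) = real (card B)"
      using finite_V by (simp add: B_def of_bool_def flip: sum.inter_filter)
    then show ?thesis by (simp add: sum_distrib_left[symmetric] sum_distrib_right[symmetric] sum.distrib algebra_simps)
  qed
  also have "\<dots> \<le> real d * ?Z * (c * real (card V) + \<delta> * real (card V))"
    using bad Z by (intro mult_left_mono) (auto simp: B_def)
  finally have "(\<Sum>f\<in>E. M f) \<le> real d / 2 * (c + \<delta>) * real (card V) * ?Z" by (simp add: algebra_simps)
  then show ?thesis using Z unfolding M_def c_def by (simp add: pos_divide_le_eq)
qed

end

lemma bond_corr_bounds:
  assumes "1 \<le> x" "0 \<le> t"
  shows "0 \<le> bond_corr x t t" "bond_corr x t t \<le> 1"
proof -
  have pos: "0 < x * (1 + t * t)" using assms by (intro mult_pos_pos add_pos_nonneg) auto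
  then show "0 \<le> bond_corr x t t" "bond_corr x t t \<le> 1"
    using assms unfolding bond_corr_def by (auto simp: divide_le_eq_1)
qed

text \<open>The coupling runs through \<open>X k = (1 + e) ^ k\<close> from \<open>1\<close> to
  \<open>x\<close>. In one step \<open>ln Z\<close> grows per vertex by at most
  \<open>D / 2 * e * (c (Suc k) + 2 * \<delta>)\<close>, the pressure by at least
  \<open>D / 2 * e * c k - (D * e)\<^sup>2\<close>. The differences of the \<open>c k\<close>
  telescope to at most \<open>D / 2 * e\<close>, because \<open>c\<close> lies between
  \<open>0\<close> and \<open>1\<close>.\<close>

lemma Z_Ising_le_pressure_strict:
  assumes x: "1 \<le> x" and l: "1 < l" and d: "0 < d" and \<eta>: "0 < \<eta>"
  shows "\<exists>r \<delta>. 0 < \<delta> \<and> (\<forall>(V::'v set) E. regular V E d \<longrightarrow>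
    real (card {v \<in> V. \<not> tree_at E v (Suc r)}) \<le> \<delta> * real (card V) \<longrightarrow>
    ln (Z_Ising V E x l) \<le> real (card V) * (ising_pressure x l d + \<eta>))"
proof -
  define D where "D = real d"
  have D: "0 < D" using d by (simp add: D_def)
  define K where "K = 2 * ln x"
  have K: "0 \<le> K" using x by (simp add: K_def)
  \<comment> \<open>\<open>G\<close> collects the two errors that are linear in \<open>e\<close>:
    the telescoped one, and \<open>N\<close> quadratic ones with \<open>N * e \<le> K\<close>. A
    bound by \<open>\<tau>\<close> gives both \<open>D * e \<le> 1\<close> and
    \<open>e * G \<le> \<eta> / 2\<close>.\<close>
  define G where "G = D / 2 + K * D\<^sup>2"
  have G: "0 < G" unfolding G_def using D K by (intro add_pos_nonneg) auto
  define \<tau> where "\<tau> = min (1 / D) (\<eta> / (2 * G))"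
  have \<tau>: "0 < \<tau>" using D \<eta> G by (simp add: \<tau>_def)
  obtain N :: nat where N: "max 1 (max (ln x) (K / \<tau>)) \<le> real N" using real_arch_simple by blast
  then have N': "1 \<le> real N" "ln x \<le> real N" "K / \<tau> \<le> real N" by auto
  define y where "y = ln x / real N"
  have y: "0 \<le> y" "y \<le> 1" using N' x by (auto simp: y_def divide_le_eq_1)
  \<comment> \<open>Chosen such that \<open>(1 + e) ^ N\<close> is exactly \<open>x\<close>.\<close>
  define e where "e = exp y - 1"
  have e0: "0 \<le> e" using y by (simp add: e_def)
  have "e \<le> 2 * y"
  proof -
    have "y\<^sup>2 \<le> y" using y by (simp add: power2_eq_square mult_left_le)
    then show ?thesis using exp_bound[OF y] by (simp add: e_def)
  qed
  then have Ne: "real N * e \<le> K"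
    using N' mult_left_mono[of e "2 * y" "real N"] by (simp add: y_def K_def)
  have e\<tau>: "e \<le> \<tau>"
  proof -
    have "K \<le> real N * \<tau>" using N' \<tau> by (simp add: pos_divide_le_eq)
    with Ne have "real N * e \<le> real N * \<tau>" by (rule order_trans)
    moreover have "0 < real N" using N' by simp
    ultimately show ?thesis by (simp only: mult_le_cancel_left_pos)
  qed
  have De: "D * e \<le> 1"
  proof -
    have "e \<le> 1 / D" using e\<tau> by (simp add: \<tau>_def)
    then show ?thesis using D by (simp add: field_simps)
  qed
  have e\<eta>: "e * G \<le> \<eta> / 2"
  proof -
    have "e * G \<le> \<eta> / (2 * G) * G" using e\<tau> G by (intro mult_right_mono) (auto simp: \<tau>_def)
    then show ?thesis using G by simp
  qed
  \<comment> \<open>The errors from finite radius and from bad vertices add up to at most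
    \<open>K * D * \<delta>\<close> over all steps. The \<open>+ 1\<close> keeps the denominator
    positive when \<open>x = 1\<close> and so \<open>K = 0\<close>.\<close>
  define \<delta> where "\<delta> = \<eta> / (2 * (K * D + 1))"
  have KD: "0 < K * D + 1" using K D by (intro add_nonneg_pos) auto
  then have \<delta>: "0 < \<delta>" using \<eta> by (simp add: \<delta>_def)
  have \<delta>\<eta>: "K * D * \<delta> \<le> \<eta> / 2"
  proof -
    have "K * D * \<delta> \<le> (K * D + 1) * \<delta>" using \<delta> by (intro mult_right_mono) auto
    also have "\<dots> = \<eta> / 2"
    proof -
      have "y * (\<eta> / (2 * y)) = \<eta> / 2" if "0 < y" for y using that by simp
      then show ?thesis using KD unfolding \<delta>_def by blast
    qed
    finally show ?thesis .
  qed
  define X where "X = (\<lambda>k::nat. (1 + e) ^ k)"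
  have X1: "1 \<le> X k" for k using e0 by (simp add: X_def)
  have XN: "X N = x"
  proof -
    have "X N = exp (real N * y)" by (simp add: X_def e_def exp_of_nat_mult)
    then show ?thesis using N' x by (simp add: y_def)
  qed
  have l0: "0 < l" using l by simp
  have "\<forall>k. \<exists>s t z. 0 < s \<and> 0 < t \<and> 0 < z \<and> ising_fixed (X k) l d s t z \<and>
      ising_bethe (X k) l d s t = ising_pressure (X k) l d"
    using ising_pressure_attained[OF X1 l0 d] by blast
  then obtain s t z where st: "\<And>k. 0 < s k" "\<And>k. 0 < t k" "\<And>k. 0 < z k"
    "\<And>k. ising_fixed (X k) l d (s k) (t k) (z k)"
    "\<And>k. ising_bethe (X k) l d (s k) (t k) = ising_pressure (X k) l d"
    by metis
  define c where "c = (\<lambda>k. bond_corr (X k) (t k / s k) (t k / s k))"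
  have c: "0 \<le> c k" "c k \<le> 1" for k
    unfolding c_def using st(1,2)[of k] X1[of k] by (auto intro!: bond_corr_bounds)
  define cr where "cr = (\<lambda>r k. bond_corr (X k) (tree_ratio (X k) l d r) (tree_ratio (X k) l d (Suc r)))"
  have "\<forall>\<^sub>F r in sequentially. \<forall>k\<in>{..N}. cr r k < c k + \<delta>"
  \<comment> \<open>The path has finitely many points, so one radius serves them all.\<close>
  proof (rule eventually_ball_finite)
    show "\<forall>k\<in>{..N}. \<forall>\<^sub>F r in sequentially. cr r k < c k + \<delta>"
    proof
      fix k
      have "ising_bethe (X k) l d (t k) (s k) \<le> ising_bethe (X k) l d (s k) (t k)"
        unfolding st(5) using st(1,2)[of k] by (intro ising_bethe_le_pressure X1 l0 d) auto
      then have "(\<lambda>r. cr r k) \<longlonglongrightarrow> c k"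
        unfolding cr_def c_def using st X1 by (intro bond_corr_tendsto[OF X1 l d]) auto
      then show "\<forall>\<^sub>F r in sequentially. cr r k < c k + \<delta>"
        by (rule order_tendstoD) (use \<delta> in simp)
    qed
  qed simp
  then obtain r where r: "\<And>k. k \<le> N \<Longrightarrow> cr r k < c k + \<delta>"
    by (auto simp: eventually_sequentially)
  define R where "R = D * e * \<delta> + (D * e)\<^sup>2"
  have "ln (Z_Ising V E x l) \<le> real (card V) * (ising_pressure x l d + \<eta>)"
    if reg: "regular V E d" and bad: "real (card {v \<in> V. \<not> tree_at E v (Suc r)}) \<le> \<delta> * real (card V)"
    for V :: "'v set" and E
  proof -
    interpret regular V E d by (rule reg)
    define n where "n = real (card V)"
    have claim: "ln (Z_Ising V E (X k) l) \<le>
        n * (ising_pressure (X k) l d + D / 2 * e * (c k - c 0) + real k * R)" if "k \<le> N" for k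
      using that
    proof (induction k)
      case 0
      show ?case using l d by (simp add: X_def Z_Ising_no_coupling ising_pressure_no_coupling ln_realpow n_def)
    next
      case (Suc k)
      have XS: "X (Suc k) = X k * (1 + e)" by (simp add: X_def)
      have inc: "ln (Z_Ising V E (X (Suc k)) l) - ln (Z_Ising V E (X k) l) \<le> e * (D / 2 * (cr r (Suc k) + \<delta>) * n)"
      proof -
        have "(\<Sum>f\<in>E. \<Sum>\<sigma>\<in>spins V. ising_weight V E (X (Suc k)) l \<sigma> * of_bool (monochromatic \<sigma> f)) / Z_Ising V E (X (Suc k)) l
          \<le> D / 2 * (cr r (Suc k) + \<delta>) * n"
          unfolding D_def cr_def n_def using l by (intro monochromatic_sum_le X1 bad) auto
        then have "e * ((\<Sum>f\<in>E. \<Sum>\<sigma>\<in>spins V. ising_weight V E (X (Suc k)) l \<sigma> * of_bool (monochromatic \<sigma> f)) / Z_Ising V E (X (Suc k)) l)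
          \<le> e * (D / 2 * (cr r (Suc k) + \<delta>) * n)" using e0 by (rule mult_left_mono)
        moreover have "ln (Z_Ising V E (X (Suc k)) l) - ln (Z_Ising V E (X k) l) \<le>
          e * ((\<Sum>f\<in>E. \<Sum>\<sigma>\<in>spins V. ising_weight V E (X (Suc k)) l \<sigma> * of_bool (monochromatic \<sigma> f)) / Z_Ising V E (X (Suc k)) l)"
          unfolding XS by (rule Z_Ising_increment[OF X1 l0 e0])
        ultimately show ?thesis by linarith
      qed
      have pr: "ising_pressure (X k) l d + D / 2 * e * c k - (D * e)\<^sup>2 \<le> ising_pressure (X (Suc k)) l d"
      proof -
        have "D / 2 * e * c k - (D * e)\<^sup>2 \<le> ising_bethe (X k * (1 + e)) l d (s k) (t k) - ising_bethe (X k) l d (s k) (t k)"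
          unfolding D_def c_def using De by (intro ising_bethe_increment[OF X1 l0 d st(1-4) e0]) (simp add: D_def)
        moreover have "ising_bethe (X (Suc k)) l d (s k) (t k) \<le> ising_pressure (X (Suc k)) l d"
          using st(1,2)[of k] by (intro ising_bethe_le_pressure X1 l0 d) auto
        ultimately show ?thesis unfolding XS st(5) by linarith
      qed
      have n0: "0 \<le> n" by (simp add: n_def)
      have "D / 2 * e * (cr r (Suc k) + \<delta>) \<le> D / 2 * e * (c (Suc k) + 2 * \<delta>)"
        using r[OF Suc.prems] D e0 by (intro mult_left_mono) auto
      then have "(ising_pressure (X k) l d + D / 2 * e * (c k - c 0) + real k * R) + D / 2 * e * (cr r (Suc k) + \<delta>)
        \<le> ising_pressure (X (Suc k)) l d + D / 2 * e * (c (Suc k) - c 0) + real (Suc k) * R"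
        using pr unfolding R_def by (simp add: algebra_simps add_divide_distrib diff_divide_distrib)
      from mult_left_mono[OF this n0]
      have "n * (ising_pressure (X k) l d + D / 2 * e * (c k - c 0) + real k * R) + e * (D / 2 * (cr r (Suc k) + \<delta>) * n)
        \<le> n * (ising_pressure (X (Suc k)) l d + D / 2 * e * (c (Suc k) - c 0) + real (Suc k) * R)"
        by (simp add: algebra_simps add_divide_distrib diff_divide_distrib)
      then show ?case using Suc inc by linarith
    qed
    have "D / 2 * e * (c N - c 0) \<le> D / 2 * e * 1"
      using D e0 c[of N] c[of 0] by (intro mult_left_mono) auto
    moreover have "real N * R \<le> K * D * \<delta> + K * D\<^sup>2 * e"
    proof -
      have "real N * R = (real N * e) * (D * \<delta> + D\<^sup>2 * e)" by (simp add: R_def power2_eq_square algebra_simps)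
      also have "\<dots> \<le> K * (D * \<delta> + D\<^sup>2 * e)" using Ne D \<delta> e0 by (intro mult_right_mono) auto
      finally show ?thesis by (simp add: algebra_simps)
    qed
    ultimately have "D / 2 * e * (c N - c 0) + real N * R \<le> \<eta>"
      using e\<eta> \<delta>\<eta> by (simp add: G_def algebra_simps diff_divide_distrib)
    then have "n * (ising_pressure x l d + D / 2 * e * (c N - c 0) + real N * R) \<le> n * (ising_pressure x l d + \<eta>)"
      by (intro mult_left_mono) (auto simp: n_def)
    then show ?thesis using claim[of N] unfolding XN n_def by linarith
  qed
  then show ?thesis using \<delta> by blast
qed

theorem Ising_pressure_limit:
  assumes x: "1 \<le> x" and l: "0 < l" and d: "0 < d" and \<eta>: "0 < \<eta>"
  shows "\<exists>r \<delta>. 0 < \<delta> \<and> (\<forall>(V::'v set) E. regular V E d \<longrightarrow>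
    real (card {v \<in> V. \<not> tree_at E v (Suc r)}) \<le> \<delta> * real (card V) \<longrightarrow>
    \<bar>ln (Z_Ising V E x l) - real (card V) * ising_pressure x l d\<bar> \<le> real (card V) * \<eta>)"
proof -
  have ge1: "\<exists>r \<delta>. 0 < \<delta> \<and> (\<forall>(V::'v set) E. regular V E d \<longrightarrow>
    real (card {v \<in> V. \<not> tree_at E v (Suc r)}) \<le> \<delta> * real (card V) \<longrightarrow>
    ln (Z_Ising V E x l) \<le> real (card V) * (ising_pressure x l d + \<eta>))" if l1: "1 \<le> l" for l
  proof (cases "l = 1")
    case False
    then show ?thesis using l1 by (intro Z_Ising_le_pressure_strict[OF x _ d \<eta>]) simp
  next
    case True
    \<comment> \<open>Half of \<open>\<eta>\<close> pays for this change of the field, the other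
      half for the estimate at \<open>l'\<close>.\<close>
    define l' where "l' = exp (\<eta> / 2)"
    have l': "1 < l'" "ln l' = \<eta> / 2" using \<eta> by (auto simp: l'_def)
    have "0 < \<eta> / 2" using \<eta> by simp
    from Z_Ising_le_pressure_strict[OF x l'(1) d this, where 'v = 'v]
    obtain r \<delta> where r: "0 < \<delta>" "\<And>(V::'v set) E. regular V E d \<Longrightarrow>
      real (card {v \<in> V. \<not> tree_at E v (Suc r)}) \<le> \<delta> * real (card V) \<Longrightarrow>
      ln (Z_Ising V E x l') \<le> real (card V) * (ising_pressure x l' d + \<eta> / 2)" by blast
    have p: "ising_pressure x l' d + \<eta> / 2 \<le> ising_pressure x l d + \<eta>"
      using ising_pressure_field_le[OF x _ d, of l'] l' True by simp
    have "ln (Z_Ising V E x l) \<le> real (card V) * (ising_pressure x l d + \<eta>)"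
      if reg: "regular V E d" and bad: "real (card {v \<in> V. \<not> tree_at E v (Suc r)}) \<le> \<delta> * real (card V)"
      for V :: "'v set" and E
    proof -
      interpret regular V E d by (rule reg)
      have "Z_Ising V E x l \<le> Z_Ising V E x l'" using x l' True by (intro Z_Ising_field_mono) auto
      then have "ln (Z_Ising V E x l) \<le> ln (Z_Ising V E x l')"
        using Z_Ising_pos[of x l] x l1 by (intro ln_mono) auto
      also have "\<dots> \<le> real (card V) * (ising_pressure x l' d + \<eta> / 2)" by (rule r(2)[OF reg bad])
      also have "\<dots> \<le> real (card V) * (ising_pressure x l d + \<eta>)" using p by (intro mult_left_mono) auto
      finally show ?thesis .
    qed
    then show ?thesis using r(1) by blast
  qed
  have up: "\<exists>r \<delta>. 0 < \<delta> \<and> (\<forall>(V::'v set) E. regular V E d \<longrightarrow>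
    real (card {v \<in> V. \<not> tree_at E v (Suc r)}) \<le> \<delta> * real (card V) \<longrightarrow>
    ln (Z_Ising V E x l) \<le> real (card V) * (ising_pressure x l d + \<eta>))"
  proof (cases "1 \<le> l")
    case False
    then have l1: "1 \<le> 1 / l" using l by simp
    from ge1[OF this] obtain r \<delta> where r: "0 < \<delta>" "\<And>(V::'v set) E. regular V E d \<Longrightarrow>
      real (card {v \<in> V. \<not> tree_at E v (Suc r)}) \<le> \<delta> * real (card V) \<Longrightarrow>
      ln (Z_Ising V E x (1 / l)) \<le> real (card V) * (ising_pressure x (1 / l) d + \<eta>)" by blast
    have "ln (Z_Ising V E x l) \<le> real (card V) * (ising_pressure x l d + \<eta>)"
      if reg: "regular V E d" and bad: "real (card {v \<in> V. \<not> tree_at E v (Suc r)}) \<le> \<delta> * real (card V)"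
      for V :: "'v set" and E
    proof -
      interpret regular V E d by (rule reg)
      have "ln (Z_Ising V E x l) = real (card V) * ln l + ln (Z_Ising V E x (1 / l))"
        using Z_Ising_pos[of x "1 / l"] x l by (subst Z_Ising_flip[OF l]) (simp add: ln_mult ln_realpow)
      then show ?thesis using r(2)[OF reg bad] ising_pressure_swap[OF x l d] by (simp add: algebra_simps)
    qed
    then show ?thesis using r(1) by blast
  qed (rule ge1)
  then obtain r \<delta> where r: "0 < \<delta>" "\<And>(V::'v set) E. regular V E d \<Longrightarrow>
      real (card {v \<in> V. \<not> tree_at E v (Suc r)}) \<le> \<delta> * real (card V) \<Longrightarrow>
      ln (Z_Ising V E x l) \<le> real (card V) * (ising_pressure x l d + \<eta>)" by blast
  have "\<bar>ln (Z_Ising V E x l) - real (card V) * ising_pressure x l d\<bar> \<le> real (card V) * \<eta>"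
    if reg: "regular V E d" and bad: "real (card {v \<in> V. \<not> tree_at E v (Suc r)}) \<le> \<delta> * real (card V)"
    for V :: "'v set" and E
  proof -
    interpret regular V E d by (rule reg)
    have "0 \<le> real (card V) * \<eta>" using \<eta> by simp
    then show ?thesis using r(2)[OF reg bad] Z_Ising_ge_pressure[OF x l d] by (simp add: algebra_simps)
  qed
  then show ?thesis using r(1) by blast
qed

section \<open>From the Potts model to the Ising model\<close>

text \<open>Contract the edges one after another: a contraction merges at most two classes and so
  removes at most one representative. Colouring the points of \<open>R\<close> freely then produces
  many colourings that are constant on every edge.\<close>

lemma edge_retraction:
  assumes "finite F" "finite T" "\<And>e. e \<in> F \<Longrightarrow> e \<subseteq> T \<and> card e = 2"
  shows "\<exists>\<rho> R. R \<subseteq> T \<and> \<rho> ` T \<subseteq> R \<and> (\<forall>r\<in>R. \<rho> r = r) \<and> (\<forall>e\<in>F. monochromatic \<rho> e) \<and>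
    card T \<le> card R + card F"
  using assms(1,3)
proof (induction F rule: finite_induct)
  case empty
  then show ?case by (intro exI[of _ id] exI[of _ T]) auto
next
  case (insert e F)
  then obtain \<rho> R where \<rho>: "R \<subseteq> T" "\<rho> ` T \<subseteq> R" "\<And>r. r \<in> R \<Longrightarrow> \<rho> r = r"
    "\<And>e. e \<in> F \<Longrightarrow> monochromatic \<rho> e" "card T \<le> card R + card F" by auto
  obtain a b where ab: "e = {a, b}" "a \<in> T" "b \<in> T"
    using insert.prems[of e] by (auto simp: card_2_iff)
  show ?case
  proof (cases "\<rho> a = \<rho> b")
    case True
    then have "monochromatic \<rho> e" by (auto simp: ab monochromatic_def)
    then show ?thesis using \<rho> insert.hyps by (intro exI[of _ \<rho>] exI[of _ R]) auto
  next
    case False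
    \<comment> \<open>The class of \<open>a\<close> is absorbed by the class of \<open>b\<close>,
      and \<open>\<rho> a\<close> is no longer a representative.\<close>
    define \<rho>' where "\<rho>' = (\<lambda>u. if \<rho> u = \<rho> a then \<rho> b else \<rho> u)"
    have R: "\<rho> a \<in> R" "\<rho> b \<in> R" "finite R" using \<rho> ab assms(2) finite_subset by auto
    have 1: "R - {\<rho> a} \<subseteq> T" using \<rho>(1) by auto
    have 2: "\<rho>' ` T \<subseteq> R - {\<rho> a}" using \<rho>(2) R False by (auto simp: \<rho>'_def)
    have 3: "\<forall>r\<in>R - {\<rho> a}. \<rho>' r = r" using \<rho>(3) by (auto simp: \<rho>'_def)
    have 4: "monochromatic \<rho>' f" if "f \<in> insert e F" for f
    proof (cases "f = e")
      case True
      then show ?thesis by (auto simp: ab monochromatic_def \<rho>'_def)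
    next
      case False
      then have "monochromatic \<rho> f" using that \<rho>(4) by blast
      then show ?thesis unfolding monochromatic_def \<rho>'_def by metis
    qed
    have 5: "card T \<le> card (R - {\<rho> a}) + card (insert e F)"
    proof -
      have "card R = Suc (card (R - {\<rho> a}))" using R by (metis card_Suc_Diff1)
      then show ?thesis using \<rho>(5) insert.hyps by simp
    qed
    show ?thesis using 1 2 3 5
      by (intro exI[of _ \<rho>'] exI[of _ "R - {\<rho> a}"] conjI ballI[OF 4])
  qed
qed

section \<open>Components of an edge subset\<close>

definition component :: "'v set set \<Rightarrow> 'v \<Rightarrow> 'v set" where
  "component A v = {u. (v, u) \<in> {(a, b). {a, b} \<in> A}\<^sup>*}"

lemma component_self: "v \<in> component A v"
  by (simp add: component_def)

lemma component_eq:
  assumes "u \<in> component A v"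
  shows "component A u = component A v"
proof -
  let ?r = "{(a, b). {a, b} \<in> A}\<^sup>*"
  have "sym {(a, b). {a, b} \<in> A}" by (auto simp: sym_def insert_commute)
  then have s: "sym ?r" by (rule sym_rtrancl)
  have vu: "(v, u) \<in> ?r" using assms by (simp add: component_def)
  then have uv: "(u, v) \<in> ?r" using s by (rule symD[rotated])
  show ?thesis
    using rtrancl_trans[OF vu] rtrancl_trans[OF uv] by (auto simp: component_def)
qed

lemma component_edge: "{a, b} \<in> A \<Longrightarrow> component A a = component A b"
  by (rule component_eq[symmetric]) (auto simp: component_def)

lemma component_constant:
  assumes "\<And>e. e \<in> A \<Longrightarrow> monochromatic \<sigma> e" "u \<in> component A v"
  shows "\<sigma> u = \<sigma> v"
proof -
  have "(v, u) \<in> {(a, b). {a, b} \<in> A}\<^sup>*" using assms(2) by (simp add: component_def)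
  then show ?thesis
  proof induction
    case (step y z)
    have "{y, z} \<in> A" using step by simp
    then have "monochromatic \<sigma> {y, z}" by (rule assms(1))
    then have "\<sigma> z = \<sigma> y" unfolding monochromatic_def by blast
    then show ?case using step by simp
  qed simp
qed

lemma component_subset_closed:
  assumes "v \<in> T" "\<And>a b. {a, b} \<in> A \<Longrightarrow> a \<in> T \<Longrightarrow> b \<in> T"
  shows "component A v \<subseteq> T"
proof
  fix u assume "u \<in> component A v"
  then have "(v, u) \<in> {(a, b). {a, b} \<in> A}\<^sup>*" by (simp add: component_def)
  then show "u \<in> T" by induction (use assms in auto)
qed

lemma hop_subset_component: "hop A v k \<subseteq> component A v"
proof (induction k)
  case (Suc k)
  show ?case
  proof
    fix u assume "u \<in> hop A v (Suc k)"
    then have "u \<in> hop A v k \<union> {u. \<exists>w\<in>hop A v k. {w, u} \<in> A}" by (simp only: hop.simps)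
    then show "u \<in> component A v"
    proof (elim UnE CollectE bexE)
      fix w assume w: "w \<in> hop A v k" "{w, u} \<in> A"
      have "component A w = component A v" using Suc w(1) by (intro component_eq) auto
      moreover have "component A w = component A u" using w(2) by (rule component_edge)
      ultimately show ?thesis using component_self[of u A] by simp
    qed (use Suc in auto)
  qed
qed (simp add: component_self)

text \<open>Until the component is exhausted every step of \<open>hop\<close> adds a vertex, so the
  ball of radius \<open>k\<close> has at least \<open>k + 1\<close> of them; at \<open>k = K\<close>
  this exceeds the size of the component.\<close>

lemma component_subset_hop:
  assumes fin: "finite (component A v)" and K: "card (component A v) \<le> K"
  shows "component A v \<subseteq> hop A v K"
proof -
  have "component A v \<subseteq> hop A v k \<or> k + 1 \<le> card (hop A v k)" for k
  proof (induction k)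
    case (Suc k)
    show ?case
    proof (cases "component A v \<subseteq> hop A v k")
      case True
      then show ?thesis using hop_Suc_subset[of A v k] by blast
    next
      case False
      have "hop A v k \<noteq> hop A v (Suc k)"
      proof
        assume eq: "hop A v k = hop A v (Suc k)"
        have "component A v \<subseteq> hop A v k"
          by (rule component_subset_closed) (use center_in_hop hop_adjacent[of _ A v k] eq in auto)
        then show False using False by simp
      qed
      then have "hop A v k \<subset> hop A v (Suc k)" using hop_Suc_subset[of A v k] by blast
      moreover have "finite (hop A v (Suc k))" using fin hop_subset_component finite_subset by metis
      ultimately have "card (hop A v k) < card (hop A v (Suc k))" by (intro psubset_card_mono)
      then show ?thesis using Suc False by auto
    qed
  qed simp
  moreover have "card (hop A v K) \<le> K"
    using card_mono[OF fin hop_subset_component[of A v K]] K by simp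
  ultimately show ?thesis by (metis Suc_eq_plus1 Suc_n_not_le_n le_trans)
qed

context regular
begin

lemma component_subset_V:
  assumes "A \<subseteq> E" "v \<in> V"
  shows "component A v \<subseteq> V"
  by (rule component_subset_closed) (use assms edge(1) in blast)+

lemma hop_edge_is_parent_edge:
  assumes "tree_at E v R" "k \<le> R" "e \<in> E" "e \<subseteq> hop E v k"
  shows "\<exists>j<k. \<exists>w\<in>hop E v (Suc j) - hop E v j. e = {parent v j w, w}"
  using assms(2,4)
proof (induction k)
  case 0
  then have "card e \<le> card {v}" by (intro card_mono) auto
  then show ?case using edge(2)[OF assms(3)] by simp
next
  case (Suc k)
  have "e \<in> {e \<in> E. e \<subseteq> hop E v (Suc k)}" using Suc.prems assms(3) by simp
  also have "\<dots> = {e \<in> E. e \<subseteq> hop E v k} \<union> (\<lambda>w. {parent v k w, w}) ` (hop E v (Suc k) - hop E v k)"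
    using Suc.prems by (intro hop_edges_Suc[OF assms(1)]) simp
  finally show ?case
  proof
    assume "e \<in> {e \<in> E. e \<subseteq> hop E v k}"
    then have "\<exists>j<k. \<exists>w\<in>hop E v (Suc j) - hop E v j. e = {parent v j w, w}"
      using Suc by simp
    then show ?thesis using less_SucI by metis
  qed auto
qed

text \<open>Every edge inside the ball is the parent edge of its outer end, which is never the
  centre, so the edges are an image of \<open>C - {v}\<close>. \<open>lev\<close> recovers the
  sphere from the vertex and thereby makes this assignment a function.\<close>

lemma card_edges_in_tree_ball:
  assumes tree: "tree_at E v R" and C: "C \<subseteq> hop E v R" "finite C" "v \<in> C"
  shows "card {e \<in> E. e \<subseteq> C} + 1 \<le> card C"
proof -
  define lev where "lev = (\<lambda>w. LEAST j. w \<in> hop E v (Suc j))"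
  have "{e \<in> E. e \<subseteq> C} \<subseteq> (\<lambda>w. {parent v (lev w) w, w}) ` (C - {v})"
  proof
    fix e assume e: "e \<in> {e \<in> E. e \<subseteq> C}"
    then have "e \<subseteq> hop E v R" using C(1) by auto
    then obtain j w where w: "w \<in> hop E v (Suc j) - hop E v j" "e = {parent v j w, w}"
      using hop_edge_is_parent_edge[OF tree order_refl, of e] e by auto
    have "lev w = j"
      unfolding lev_def
    proof (rule Least_equality)
      fix i assume "w \<in> hop E v (Suc i)"
      then show "j \<le> i" using w hop_mono[of "Suc i" j E v] by (metis DiffD2 not_less_eq_eq subsetD)
    qed (use w in simp)
    moreover have "w \<noteq> v" using w center_in_hop by (metis DiffD2)
    ultimately show "e \<in> (\<lambda>w. {parent v (lev w) w, w}) ` (C - {v})" using e w by auto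
  qed
  then have "card {e \<in> E. e \<subseteq> C} \<le> card ((\<lambda>w. {parent v (lev w) w, w}) ` (C - {v}))"
    using C(2) by (intro card_mono) auto
  also have "\<dots> \<le> card (C - {v})" using C(2) by (intro card_image_le) auto
  finally have "card {e \<in> E. e \<subseteq> C} \<le> card C - 1" using C by simp
  moreover have "0 < card C" using C by (auto simp: card_gt_0_iff)
  ultimately show ?thesis by linarith
qed

section \<open>Colourings that are constant on components\<close>

text \<open>For \<open>A \<subseteq> E\<close> and \<open>S \<subseteq> V\<close> this says that
  \<open>S\<close> is a union of components of \<open>A\<close>.\<close>

definition closed_under :: "'v set set \<Rightarrow> 'v set \<Rightarrow> bool" where
  "closed_under A S \<longleftrightarrow> (\<forall>e\<in>A. e \<subseteq> S \<or> e \<subseteq> V - S)"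

text \<open>\<open>S\<close> plays the part of the colour \<open>1\<close>. The remaining factor is
  \<open>m ^ (k - e)\<close> for \<open>k\<close> vertices and \<open>e\<close> edges outside
  \<open>S\<close>, written as a quotient since \<open>e\<close> may exceed \<open>k\<close> in the
  presence of cycles.\<close>

definition two_spin_count :: "real \<Rightarrow> real \<Rightarrow> 'v set set \<Rightarrow> real" where
  "two_spin_count B m A = (\<Sum>S\<in>{S \<in> Pow V. closed_under A S}.
     exp (B * real (card S)) * (m ^ card (V - S) / m ^ card {e \<in> A. e \<subseteq> V - S}))"

definition constant_colourings :: "nat \<Rightarrow> 'v set set \<Rightarrow> ('v \<Rightarrow> nat) set" where
  "constant_colourings q A = {\<sigma> \<in> V \<rightarrow>\<^sub>E {1..q}. \<forall>e\<in>A. monochromatic \<sigma> e}"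

definition colouring_count :: "real \<Rightarrow> nat \<Rightarrow> 'v set set \<Rightarrow> real" where
  "colouring_count B q A = (\<Sum>\<sigma>\<in>constant_colourings q A. exp (B * real (card {v \<in> V. \<sigma> v = 1})))"

lemma finite_constant_colourings: "finite (constant_colourings q A)"
  unfolding constant_colourings_def
  by (rule finite_subset[OF _ finite_PiE[OF finite_V, of "\<lambda>_. {1..q}"]]) auto

text \<open>For each \<open>S\<close> a retraction of the complement along its edges supplies enough
  colourings whose colour-\<open>1\<close> class is exactly \<open>S\<close>. Cycles only make the
  quotient smaller than the true number.\<close>

lemma two_spin_count_le_colouring_count:
  assumes A: "A \<subseteq> E" and q: "2 \<le> q"
  shows "two_spin_count B (real q - 1) A \<le> colouring_count B q A"
proof -
  define m where "m = real q - 1"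
  have m: "1 \<le> m" using q by (simp add: m_def)
  let ?one = "\<lambda>\<sigma>. {v \<in> V. \<sigma> v = (1::nat)}"
  let ?CC = "constant_colourings q A"
  have fA: "finite A" using A finite_E finite_subset by blast
  have count: "m ^ card (V - S) / m ^ card {e \<in> A. e \<subseteq> V - S} \<le> real (card {\<sigma> \<in> ?CC. ?one \<sigma> = S})"
    if S: "S \<subseteq> V" "closed_under A S" for S
  proof -
    define T where "T = V - S"
    define F where "F = {e \<in> A. e \<subseteq> T}"
    have "\<exists>\<rho> R. R \<subseteq> T \<and> \<rho> ` T \<subseteq> R \<and> (\<forall>r\<in>R. \<rho> r = r) \<and> (\<forall>e\<in>F. monochromatic \<rho> e) \<and>
        card T \<le> card R + card F"
      by (rule edge_retraction) (use fA finite_V A edge(2) in \<open>auto simp: F_def T_def\<close>)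
    then obtain \<rho> R where \<rho>: "R \<subseteq> T" "\<rho> ` T \<subseteq> R" "\<And>r. r \<in> R \<Longrightarrow> \<rho> r = r"
      "\<And>e. e \<in> F \<Longrightarrow> monochromatic \<rho> e" "card T \<le> card R + card F" by blast
    define col where "col = (\<lambda>g. \<lambda>v\<in>V. if v \<in> S then 1 else g (\<rho> v) :: nat)"
    have finR: "finite R" using \<rho>(1) finite_V by (auto simp: T_def intro: finite_subset)
    have inj: "inj_on col (R \<rightarrow>\<^sub>E {2..q})"
    proof (rule inj_onI)
      fix g h assume gh: "g \<in> R \<rightarrow>\<^sub>E {2..q}" "h \<in> R \<rightarrow>\<^sub>E {2..q}" "col g = col h"
      show "g = h"
      proof (rule PiE_ext[OF gh(1,2)])
        fix r assume r: "r \<in> R"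
        then have "r \<in> T" using \<rho>(1) by auto
        then show "g r = h r" using fun_cong[OF gh(3), of r] \<rho>(3)[OF r] by (simp add: col_def T_def)
      qed
    qed
    have range: "col ` (R \<rightarrow>\<^sub>E {2..q}) \<subseteq> {\<sigma> \<in> ?CC. ?one \<sigma> = S}"
    proof
      fix \<sigma> assume "\<sigma> \<in> col ` (R \<rightarrow>\<^sub>E {2..q})"
      then obtain g where g: "g \<in> R \<rightarrow>\<^sub>E {2..q}" "\<sigma> = col g" by auto
      have gT: "g (\<rho> v) \<in> {2..q}" if "v \<in> T" for v
      proof -
        have "\<rho> v \<in> R" using \<rho>(2) that by auto
        then show ?thesis using g(1) by (rule PiE_mem[rotated])
      qed
      have "\<sigma> \<in> V \<rightarrow>\<^sub>E {1..q}"
      proof (rule PiE_I)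
        fix v assume v: "v \<in> V"
        show "\<sigma> v \<in> {1..q}" using gT[of v] v q by (cases "v \<in> S") (auto simp: g(2) col_def T_def)
      qed (simp add: g(2) col_def)
      moreover have "monochromatic \<sigma> e" if e: "e \<in> A" for e
      proof -
        have "e \<subseteq> S \<or> e \<subseteq> T" using S(2) e by (auto simp: closed_under_def T_def)
        then show ?thesis
        proof
          assume "e \<subseteq> S"
          then show ?thesis using S(1) by (auto simp: monochromatic_def g(2) col_def)
        next
          assume eT: "e \<subseteq> T"
          then have mono: "monochromatic \<rho> e" using e by (intro \<rho>(4)) (simp add: F_def)
          have col: "\<sigma> u = g (\<rho> u)" if "u \<in> e" for u
            using eT that by (auto simp: g(2) col_def T_def)
          show ?thesis
            unfolding monochromatic_def
          proof (intro ballI)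
            fix u v assume uv: "u \<in> e" "v \<in> e"
            then have "\<rho> u = \<rho> v" using mono unfolding monochromatic_def by blast
            then show "\<sigma> u = \<sigma> v" by (simp only: col[OF uv(1)] col[OF uv(2)])
          qed
        qed
      qed
      moreover have "?one \<sigma> = S"
      proof -
        have "\<sigma> v = 1 \<longleftrightarrow> v \<in> S" if "v \<in> V" for v
          using gT[of v] that by (auto simp: g(2) col_def T_def)
        then show ?thesis using S(1) by auto
      qed
      ultimately show "\<sigma> \<in> {\<sigma> \<in> ?CC. ?one \<sigma> = S}" by (simp add: constant_colourings_def)
    qed
    have c1: "card (R \<rightarrow>\<^sub>E {2..q}) \<le> card {\<sigma> \<in> ?CC. ?one \<sigma> = S}"
      using finite_constant_colourings by (intro card_inj_on_le[OF inj range]) auto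
    have c2: "card (R \<rightarrow>\<^sub>E {2..q}) = (q - 1) ^ card R" using finR q by (simp add: card_PiE)
    have c3: "real ((q - 1) ^ card R) = m ^ card R" using q by (simp add: m_def of_nat_diff)
    have "m ^ card R \<le> real (card {\<sigma> \<in> ?CC. ?one \<sigma> = S})"
      using c1 unfolding c3[symmetric] c2[symmetric] by (rule of_nat_mono)
    moreover have "m ^ card T / m ^ card F \<le> m ^ card R"
    proof -
      have "m ^ card T \<le> m ^ card R * m ^ card F"
        using power_increasing[OF \<rho>(5) m] by (simp add: power_add)
      then show ?thesis using m by (simp add: pos_divide_le_eq)
    qed
    ultimately show ?thesis by (simp add: T_def F_def)
  qed
  have "two_spin_count B m A \<le> (\<Sum>S\<in>{S \<in> Pow V. closed_under A S}. exp (B * real (card S)) * real (card {\<sigma> \<in> ?CC. ?one \<sigma> = S}))"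
    unfolding two_spin_count_def using count by (intro sum_mono mult_left_mono) auto
  also have "\<dots> \<le> (\<Sum>S\<in>Pow V. exp (B * real (card S)) * real (card {\<sigma> \<in> ?CC. ?one \<sigma> = S}))"
    using finite_V by (intro sum_mono2) auto
  also have "\<dots> = (\<Sum>S\<in>Pow V. \<Sum>\<sigma>\<in>{\<sigma> \<in> ?CC. ?one \<sigma> = S}. exp (B * real (card (?one \<sigma>))))"
    by (intro sum.cong refl) (simp add: mult.commute)
  also have "\<dots> = colouring_count B q A"
    unfolding colouring_count_def
    by (rule sum.group) (use finite_constant_colourings finite_V in auto)
  finally show ?thesis by (simp add: m_def)
qed

text \<open>The condition refers to the whole component, so that the set is a union of
  components.\<close>

definition big_vertices :: "nat \<Rightarrow> 'v set set \<Rightarrow> 'v set" where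
  "big_vertices K A = {v \<in> V. \<not> (card (component A v) \<le> K \<and> (\<forall>u\<in>component A v. tree_at E u K))}"

lemma finite_component: "A \<subseteq> E \<Longrightarrow> v \<in> V \<Longrightarrow> finite (component A v)"
  using component_subset_V finite_V finite_subset by metis

lemma sum_card_components:
  assumes A: "A \<subseteq> E" and T: "T \<subseteq> V" "\<And>v. v \<in> T \<Longrightarrow> component A v \<subseteq> T"
  shows "(\<Sum>C\<in>component A ` T. card C) = card T"
proof -
  have "\<Union> (component A ` T) = T" using T component_self[of _ A] by blast
  moreover have "disjnt C C'" if CC: "C \<in> component A ` T" "C' \<in> component A ` T" "C \<noteq> C'" for C C'
  proof (rule ccontr)
    assume "\<not> disjnt C C'"
    then obtain u where "u \<in> C" "u \<in> C'" by (auto simp: disjnt_def)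
    moreover obtain v v' where "C = component A v" "C' = component A v'" using CC by auto
    ultimately show False using CC(3) component_eq[of u A v] component_eq[of u A v'] by simp
  qed
  then have "pairwise disjnt (component A ` T)" by (intro pairwiseI)
  moreover have "finite C" if "C \<in> component A ` T" for C
    using that finite_component[OF A] T(1) by auto
  ultimately show ?thesis using card_Union_disjoint[of "component A ` T"] by simp
qed

text \<open>A big component either has more than \<open>K\<close> vertices, and at most
  \<open>card V / (K + 1)\<close> disjoint sets do, or contains a vertex without a tree ball to
  which it can be charged.\<close>

lemma card_big_components:
  assumes A: "A \<subseteq> E"
  shows "real (card (component A ` big_vertices K A)) \<le>
    real (card V) / real (K + 1) + real (card {v \<in> V. \<not> tree_at E v K})"
proof -
  let ?L = "{C \<in> component A ` V. K < card C}" and ?B = "{v \<in> V. \<not> tree_at E v K}"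
  have fin: "finite ?L" "finite ?B" using finite_V by auto
  have "component A ` big_vertices K A \<subseteq> ?L \<union> component A ` ?B"
  proof
    fix C assume "C \<in> component A ` big_vertices K A"
    then obtain v where v: "v \<in> V" "C = component A v" "\<not> (card C \<le> K \<and> (\<forall>u\<in>C. tree_at E u K))"
      by (auto simp: big_vertices_def)
    show "C \<in> ?L \<union> component A ` ?B"
    proof (cases "card C \<le> K")
      case True
      then obtain u where u: "u \<in> C" "\<not> tree_at E u K" using v(3) by auto
      then have "C = component A u" using v(2) by (simp add: component_eq)
      moreover have "u \<in> V" using u(1) component_subset_V[OF A v(1)] v(2) by blast
      ultimately show ?thesis using u(2) by blast
    qed (use v in auto)
  qed
  then have "card (component A ` big_vertices K A) \<le> card (?L \<union> component A ` ?B)"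
    using fin by (intro card_mono) auto
  also have "\<dots> \<le> card ?L + card (component A ` ?B)" by (rule card_Un_le)
  also have "\<dots> \<le> card ?L + card ?B" using fin by (intro add_left_mono card_image_le)
  finally have 1: "real (card (component A ` big_vertices K A)) \<le> real (card ?L) + real (card ?B)"
    by (simp only: of_nat_add[symmetric] of_nat_le_iff)
  have "(K + 1) * card ?L = (\<Sum>C\<in>?L. K + 1)" by simp
  also have "\<dots> \<le> (\<Sum>C\<in>?L. card C)" by (intro sum_mono) auto
  also have "\<dots> \<le> (\<Sum>C\<in>component A ` V. card C)" using finite_V by (intro sum_mono2) auto
  also have "\<dots> = card V" using component_subset_V[OF A] by (intro sum_card_components[OF A]) auto
  finally have "card ?L * (K + 1) \<le> card V" by (simp only: mult.commute)
  then have "real (card ?L) * real (K + 1) \<le> real (card V)"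
    by (simp only: of_nat_mult[symmetric] of_nat_le_iff)
  moreover have "0 < real (K + 1)" by simp
  ultimately have "real (card ?L) \<le> real (card V) / real (K + 1)" by (simp only: pos_le_divide_eq)
  then show ?thesis using 1 by linarith
qed

text \<open>A component with at most \<open>K\<close> vertices lies in a ball of radius
  \<open>K\<close>, here a tree, so it has fewer edges than vertices. This reverses the inequality
  of \<open>edge_retraction\<close>.\<close>

lemma card_small_components:
  assumes A: "A \<subseteq> E" and T: "T \<subseteq> V" "T \<inter> big_vertices K A = {}" "\<And>v. v \<in> T \<Longrightarrow> component A v \<subseteq> T"
  shows "card (component A ` T) + card {e \<in> A. e \<subseteq> T} \<le> card T"
proof -
  let ?CT = "component A ` T"
  have fT: "finite T" using T(1) finite_V finite_subset by blast
  have fA: "finite A" using A finite_E finite_subset by blast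
  have one: "card {e \<in> A. e \<subseteq> C} + 1 \<le> card C" if C: "C \<in> ?CT" for C
  proof -
    obtain v where v: "v \<in> T" "C = component A v" using C by auto
    have vV: "v \<in> V" using v T(1) by auto
    have "v \<notin> big_vertices K A" using v T(2) by auto
    then have small: "card C \<le> K" "tree_at E v K"
      using vV v(2) component_self[of v A] by (auto simp: big_vertices_def)
    have fC: "finite C" using finite_component[OF A vV] v by simp
    have "C \<subseteq> hop A v K" using component_subset_hop fC small v by metis
    also have "\<dots> \<subseteq> hop E v K" by (rule hop_mono_edges[OF A])
    finally have "card {e \<in> E. e \<subseteq> C} + 1 \<le> card C"
      using small fC v component_self[of v A] by (intro card_edges_in_tree_ball) auto
    moreover have "card {e \<in> A. e \<subseteq> C} \<le> card {e \<in> E. e \<subseteq> C}"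
      using A finite_E by (intro card_mono) auto
    ultimately show ?thesis by linarith
  qed
  have "{e \<in> A. e \<subseteq> T} \<subseteq> (\<Union>C\<in>?CT. {e \<in> A. e \<subseteq> C})"
  proof
    fix e assume e: "e \<in> {e \<in> A. e \<subseteq> T}"
    then have "e \<in> E" using A by auto
    then obtain a b where ab: "e = {a, b}" by (rule edge_cases)
    have "component A a = component A b" using e ab by (intro component_edge) auto
    then have "e \<subseteq> component A a" using component_self[of a A] component_self[of b A] ab by auto
    moreover have "a \<in> T" using e ab by auto
    ultimately show "e \<in> (\<Union>C\<in>?CT. {e \<in> A. e \<subseteq> C})" using e by auto
  qed
  then have "card {e \<in> A. e \<subseteq> T} \<le> card (\<Union>C\<in>?CT. {e \<in> A. e \<subseteq> C})"
    using fT fA by (intro card_mono) auto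
  also have "\<dots> \<le> (\<Sum>C\<in>?CT. card {e \<in> A. e \<subseteq> C})" using fT by (intro card_UN_le) auto
  finally have "card ?CT + card {e \<in> A. e \<subseteq> T} \<le> (\<Sum>C\<in>?CT. card {e \<in> A. e \<subseteq> C} + 1)"
    by (simp add: sum.distrib del: One_nat_def)
  also have "\<dots> \<le> (\<Sum>C\<in>?CT. card C)" by (rule sum_mono[OF one])
  also have "\<dots> = card T" using T by (intro sum_card_components[OF A]) auto
  finally show ?thesis .
qed

text \<open>A colouring is sent to the set \<open>Sp \<sigma>\<close> of its colour-\<open>1\<close>
  vertices together with all big vertices, as if these had colour \<open>1\<close>. As
  \<open>B \<ge> 0\<close> this does not lower the weight. It forgets at most \<open>q\<close>
  choices per big component, and the components outside \<open>Sp \<sigma>\<close> are trees with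
  \<open>q - 1\<close> choices each.\<close>

lemma colouring_count_le_two_spin_count:
  assumes A: "A \<subseteq> E" and q: "2 \<le> q" and B: "0 \<le> B"
  shows "colouring_count B q A \<le>
    real q ^ card (component A ` big_vertices K A) * two_spin_count B (real q - 1) A"
proof -
  define m where "m = real q - 1"
  have m: "1 \<le> m" using q by (simp add: m_def)
  let ?CC = "constant_colourings q A" and ?L = "big_vertices K A"
  let ?one = "\<lambda>\<sigma>. {v \<in> V. \<sigma> v = (1::nat)}"
  define Sp where "Sp = (\<lambda>\<sigma>. ?L \<union> ?one \<sigma>)"
  define nb where "nb = card (component A ` ?L)"
  have LV: "?L \<subseteq> V" by (auto simp: big_vertices_def)
  have const: "\<sigma> u = \<sigma> v" if "\<sigma> \<in> ?CC" "u \<in> component A v" for \<sigma> u v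
    using that by (intro component_constant[of A]) (auto simp: constant_colourings_def)
  have closed: "component A v \<subseteq> V - Sp \<sigma>" if \<sigma>: "\<sigma> \<in> ?CC" and v: "v \<in> V - Sp \<sigma>" for \<sigma> v
  proof
    fix u assume u: "u \<in> component A v"
    have "u \<in> V" using component_subset_V[OF A, of v] u v by auto
    moreover have "\<sigma> u = \<sigma> v" by (rule const[OF \<sigma> u])
    moreover have "u \<notin> ?L" using component_eq[OF u] v \<open>u \<in> V\<close> by (simp add: Sp_def big_vertices_def)
    ultimately show "u \<in> V - Sp \<sigma>" using v by (auto simp: Sp_def)
  qed
  have closed_under: "closed_under A (Sp \<sigma>)" if \<sigma>: "\<sigma> \<in> ?CC" for \<sigma>
    unfolding closed_under_def
  proof
    fix e assume e: "e \<in> A"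
    then have "e \<in> E" using A by auto
    then obtain a b where ab: "e = {a, b}" "a \<in> V" "b \<in> V" by (rule edge_cases)
    have eq: "component A a = component A b" using e ab by (intro component_edge) auto
    then have mem: "a \<in> component A b" "b \<in> component A a" using component_self[of a A] component_self[of b A] by simp_all
    show "e \<subseteq> Sp \<sigma> \<or> e \<subseteq> V - Sp \<sigma>"
    proof (cases "a \<in> Sp \<sigma>")
      case True
      then have "b \<in> Sp \<sigma>" using closed[OF \<sigma>, of b] mem ab by auto
      then show ?thesis using True ab by auto
    next
      case False
      then have "b \<in> V - Sp \<sigma>" using closed[OF \<sigma>, of a] mem ab by auto
      then show ?thesis using False ab by auto
    qed
  qed
  \<comment> \<open>No colouring is sent to a set that is not closed under \<open>A\<close>, whence
    the \<open>0\<close>.\<close>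
  have count: "real (card {\<sigma> \<in> ?CC. Sp \<sigma> = S}) \<le>
      (if closed_under A S then real q ^ nb * (m ^ card (V - S) / m ^ card {e \<in> A. e \<subseteq> V - S}) else 0)" for S
  proof (cases "{\<sigma> \<in> ?CC. Sp \<sigma> = S} = {}")
    case True
    have "0 \<le> real q ^ nb * (m ^ card (V - S) / m ^ card {e \<in> A. e \<subseteq> V - S})" using m by simp
    then show ?thesis unfolding True by simp
  next
    case False
    then obtain \<tau> where \<tau>: "\<tau> \<in> ?CC" "Sp \<tau> = S" by auto
    define T where "T = V - S"
    have T: "T \<subseteq> V" "T \<inter> ?L = {}" "\<And>v. v \<in> T \<Longrightarrow> component A v \<subseteq> T"
      using closed[OF \<tau>(1)] \<tau>(2) by (auto simp: T_def Sp_def)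
    define val where "val = (\<lambda>(\<sigma>::'v \<Rightarrow> nat) C. \<sigma> (SOME u. u \<in> C))"
    have val: "val \<sigma> (component A v) = \<sigma> v" if "\<sigma> \<in> ?CC" for \<sigma> v
    proof -
      have "(SOME u. u \<in> component A v) \<in> component A v" using component_self by (rule someI)
      then show ?thesis unfolding val_def by (rule const[OF that])
    qed
    \<comment> \<open>A colouring over \<open>S\<close> is determined by one colour per big
      component and one per component of \<open>T\<close>, since the other vertices of
      \<open>S\<close> have colour \<open>1\<close>.\<close>
    define F where "F = (\<lambda>\<sigma>. (\<lambda>C\<in>component A ` ?L. val \<sigma> C, \<lambda>C\<in>component A ` T. val \<sigma> C))"
    let ?P = "(component A ` ?L \<rightarrow>\<^sub>E {1..q}) \<times> (component A ` T \<rightarrow>\<^sub>E {2..q})"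
    have inj: "inj_on F {\<sigma> \<in> ?CC. Sp \<sigma> = S}"
    proof (rule inj_onI)
      fix \<sigma> \<sigma>' assume \<sigma>: "\<sigma> \<in> {\<sigma> \<in> ?CC. Sp \<sigma> = S}" "\<sigma>' \<in> {\<sigma> \<in> ?CC. Sp \<sigma> = S}" and eq: "F \<sigma> = F \<sigma>'"
      have c: "\<sigma> \<in> ?CC" "\<sigma>' \<in> ?CC" "\<sigma> \<in> V \<rightarrow>\<^sub>E {1..q}" "\<sigma>' \<in> V \<rightarrow>\<^sub>E {1..q}"
        using \<sigma> by (auto simp: constant_colourings_def)
      have eq1: "(\<lambda>C\<in>component A ` ?L. val \<sigma> C) = (\<lambda>C\<in>component A ` ?L. val \<sigma>' C)"
        and eq2: "(\<lambda>C\<in>component A ` T. val \<sigma> C) = (\<lambda>C\<in>component A ` T. val \<sigma>' C)"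
        using eq by (simp_all only: F_def prod.inject)
      show "\<sigma> = \<sigma>'"
      proof (rule PiE_ext[OF c(3,4)])
        fix v assume v: "v \<in> V"
        consider "v \<in> ?L" | "v \<in> T" | "v \<in> S" "v \<notin> ?L" using v by (auto simp: T_def)
        then show "\<sigma> v = \<sigma>' v"
        proof cases
          case 1
          then show ?thesis using fun_cong[OF eq1, of "component A v"] val c by simp
        next
          case 2
          then show ?thesis using fun_cong[OF eq2, of "component A v"] val c by simp
        next
          case 3
          have "v \<in> Sp \<sigma>" "v \<in> Sp \<sigma>'" using 3 \<sigma> by simp_all
          then show ?thesis using 3(2) by (simp add: Sp_def)
        qed
      qed
    qed
    have range: "F ` {\<sigma> \<in> ?CC. Sp \<sigma> = S} \<subseteq> ?P"
    proof
      fix f assume "f \<in> F ` {\<sigma> \<in> ?CC. Sp \<sigma> = S}"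
      then obtain \<sigma> where \<sigma>: "\<sigma> \<in> ?CC" "Sp \<sigma> = S" "f = F \<sigma>" by auto
      have c: "\<sigma> v \<in> {1..q}" if "v \<in> V" for v
        using \<sigma>(1) that by (auto simp: constant_colourings_def)
      have "\<sigma> v \<in> {2..q}" if "v \<in> T" for v
      proof -
        have "\<sigma> v \<noteq> 1" "v \<in> V" using that \<sigma>(2) by (auto simp: T_def Sp_def)
        then show ?thesis using c[of v] by auto
      qed
      then have "val \<sigma> C \<in> {2..q}" if "C \<in> component A ` T" for C
        using that val[OF \<sigma>(1)] by auto
      moreover have "val \<sigma> C \<in> {1..q}" if "C \<in> component A ` ?L" for C
        using that val[OF \<sigma>(1)] c LV by auto
      ultimately show "f \<in> ?P" unfolding \<sigma>(3) F_def by (intro SigmaI restrict_PiE_iff[THEN iffD2]) auto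
    qed
    have fins: "finite (component A ` ?L)" "finite (component A ` T)"
      using LV T(1) finite_V by (auto intro: finite_subset)
    have "card {\<sigma> \<in> ?CC. Sp \<sigma> = S} \<le> card ?P"
      using fins by (intro card_inj_on_le[OF inj range] finite_cartesian_product finite_PiE) auto
    also have "card ?P = q ^ nb * (q - 1) ^ card (component A ` T)"
      using fins q by (simp add: card_cartesian_product card_PiE nb_def)
    finally have "real (card {\<sigma> \<in> ?CC. Sp \<sigma> = S}) \<le> real (q ^ nb * (q - 1) ^ card (component A ` T))"
      by (rule of_nat_mono)
    also have "\<dots> = real q ^ nb * m ^ card (component A ` T)"
      using q by (simp add: m_def of_nat_diff)
    also have "\<dots> \<le> real q ^ nb * (m ^ card T / m ^ card {e \<in> A. e \<subseteq> T})"
    proof (rule mult_left_mono)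
      have "m ^ card (component A ` T) * m ^ card {e \<in> A. e \<subseteq> T} \<le> m ^ card T"
        using power_increasing[OF card_small_components[OF A T] m] by (simp add: power_add)
      then show "m ^ card (component A ` T) \<le> m ^ card T / m ^ card {e \<in> A. e \<subseteq> T}"
        using m by (simp add: pos_le_divide_eq)
    qed simp
    finally show ?thesis using closed_under[OF \<tau>(1)] \<tau>(2) by (simp add: T_def)
  qed
  have "colouring_count B q A \<le> (\<Sum>\<sigma>\<in>?CC. exp (B * real (card (Sp \<sigma>))))"
    unfolding colouring_count_def
  proof (rule sum_mono)
    fix \<sigma>
    have "card (?one \<sigma>) \<le> card (Sp \<sigma>)" using LV finite_V by (intro card_mono) (auto simp: Sp_def intro: finite_subset)
    then show "exp (B * real (card (?one \<sigma>))) \<le> exp (B * real (card (Sp \<sigma>)))"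
      using B by (simp add: mult_left_mono)
  qed
  also have "\<dots> = (\<Sum>S\<in>Pow V. \<Sum>\<sigma>\<in>{\<sigma> \<in> ?CC. Sp \<sigma> = S}. exp (B * real (card (Sp \<sigma>))))"
    by (rule sum.group[symmetric]) (use finite_constant_colourings finite_V LV in \<open>auto simp: Sp_def\<close>)
  also have "\<dots> = (\<Sum>S\<in>Pow V. exp (B * real (card S)) * real (card {\<sigma> \<in> ?CC. Sp \<sigma> = S}))"
    by (intro sum.cong refl) (simp add: mult.commute)
  also have "\<dots> \<le> (\<Sum>S\<in>Pow V. exp (B * real (card S)) *
      (if closed_under A S then real q ^ nb * (m ^ card (V - S) / m ^ card {e \<in> A. e \<subseteq> V - S}) else 0))"
    by (intro sum_mono mult_left_mono count) auto
  also have "\<dots> = (\<Sum>S\<in>Pow V. if closed_under A S then real q ^ nb * (exp (B * real (card S)) *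
      (m ^ card (V - S) / m ^ card {e \<in> A. e \<subseteq> V - S})) else 0)"
    by (intro sum.cong refl) simp
  also have "\<dots> = real q ^ nb * two_spin_count B m A"
    unfolding two_spin_count_def sum_distrib_left
    by (rule sum.inter_filter[symmetric]) (use finite_V in auto)
  finally show ?thesis by (simp add: nb_def m_def)
qed

section \<open>From edge subsets to an Ising partition function\<close>

definition two_spin_sum :: "real \<Rightarrow> real \<Rightarrow> real \<Rightarrow> real" where
  "two_spin_sum w B m = (\<Sum>A\<in>Pow E. w ^ card A * two_spin_count B m A)"

text \<open>The Fortuin-Kasteleyn expansion: a monochromatic edge has weight
  \<open>1 + (exp \<beta> - 1)\<close>, any other edge \<open>1\<close>.\<close>

lemma Z_Potts_expansion:
  "Z_Potts (UGraph V E) q \<beta> B = (\<Sum>A\<in>Pow E. (exp \<beta> - 1) ^ card A * colouring_count B q A)"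
proof -
  let ?w = "exp \<beta> - 1" and ?C = "V \<rightarrow>\<^sub>E {1..q}"
  let ?h = "\<lambda>\<sigma>. exp (B * real (card {v \<in> V. \<sigma> v = (1::nat)}))"
  have fC: "finite ?C" using finite_V by (intro finite_PiE) auto
  have weight: "exp (\<beta> * (\<Sum>e\<in>E. of_bool (\<forall>u\<in>e. \<forall>v\<in>e. \<sigma> u = \<sigma> v)) + B * (\<Sum>v\<in>V. of_bool (\<sigma> v = 1)))
      = (\<Sum>A\<in>Pow E. ?w ^ card A * (if \<forall>e\<in>A. monochromatic \<sigma> e then ?h \<sigma> else 0))" for \<sigma> :: "'v \<Rightarrow> nat"
  proof -
    have B: "(\<Sum>v\<in>V. of_bool (\<sigma> v = 1) :: real) = real (card {v \<in> V. \<sigma> v = 1})"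
      using finite_V by (simp add: of_bool_def flip: sum.inter_filter)
    have "exp (\<beta> * (\<Sum>e\<in>E. of_bool (\<forall>u\<in>e. \<forall>v\<in>e. \<sigma> u = \<sigma> v))) = (\<Prod>e\<in>E. exp (\<beta> * of_bool (monochromatic \<sigma> e)))"
      unfolding sum_distrib_left monochromatic_def by (rule exp_sum[OF finite_E])
    also have "\<dots> = (\<Prod>e\<in>E. ?w * of_bool (monochromatic \<sigma> e) + 1)"
      by (intro prod.cong) auto
    also have "\<dots> = (\<Sum>A\<in>Pow E. (\<Prod>e\<in>A. ?w * of_bool (monochromatic \<sigma> e)) * (\<Prod>e\<in>E - A. 1))"
      by (rule prod_add[OF finite_E])
    also have "\<dots> = (\<Sum>A\<in>Pow E. ?w ^ card A * of_bool (\<forall>e\<in>A. monochromatic \<sigma> e))"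
    proof (rule sum.cong[OF refl])
      fix A assume "A \<in> Pow E"
      then have fA: "finite A" using finite_E finite_subset by blast
      have "(\<Prod>e\<in>A. of_bool (monochromatic \<sigma> e) :: real) = of_bool (\<forall>e\<in>A. monochromatic \<sigma> e)"
        using fA by (induction A rule: finite_induct) auto
      then show "(\<Prod>e\<in>A. ?w * of_bool (monochromatic \<sigma> e)) * (\<Prod>e\<in>E - A. 1) = ?w ^ card A * of_bool (\<forall>e\<in>A. monochromatic \<sigma> e)"
        by (simp add: prod.distrib)
    qed
    finally have P: "exp (\<beta> * (\<Sum>e\<in>E. of_bool (\<forall>u\<in>e. \<forall>v\<in>e. \<sigma> u = \<sigma> v))) =
        (\<Sum>A\<in>Pow E. ?w ^ card A * of_bool (\<forall>e\<in>A. monochromatic \<sigma> e))" .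
    show ?thesis unfolding exp_add P B sum_distrib_right
      by (intro sum.cong refl) auto
  qed
  have "Z_Potts (UGraph V E) q \<beta> B =
      (\<Sum>\<sigma>\<in>?C. \<Sum>A\<in>Pow E. ?w ^ card A * (if \<forall>e\<in>A. monochromatic \<sigma> e then ?h \<sigma> else 0))"
    unfolding Z_Potts_def ugraph.sel weight by (rule refl)
  also have "\<dots> = (\<Sum>A\<in>Pow E. \<Sum>\<sigma>\<in>?C. ?w ^ card A * (if \<forall>e\<in>A. monochromatic \<sigma> e then ?h \<sigma> else 0))"
    by (rule sum.swap)
  also have "\<dots> = (\<Sum>A\<in>Pow E. ?w ^ card A * colouring_count B q A)"
    unfolding colouring_count_def constant_colourings_def
    by (intro sum.cong refl) (simp only: sum.inter_filter[OF fC] sum_distrib_left)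
  finally show ?thesis .
qed

lemma two_spin_sum_bounds:
  assumes q: "2 \<le> q" and \<beta>: "0 \<le> \<beta>" and B: "0 \<le> B"
  shows "two_spin_sum (exp \<beta> - 1) B (real q - 1) \<le> Z_Potts (UGraph V E) q \<beta> B"
    and "Z_Potts (UGraph V E) q \<beta> B \<le>
      real q powr (real (card V) / real (K + 1) + real (card {v \<in> V. \<not> tree_at E v K})) *
      two_spin_sum (exp \<beta> - 1) B (real q - 1)"
proof -
  have w: "0 \<le> exp \<beta> - 1" using \<beta> by simp
  show "two_spin_sum (exp \<beta> - 1) B (real q - 1) \<le> Z_Potts (UGraph V E) q \<beta> B"
    unfolding two_spin_sum_def Z_Potts_expansion
    using w q two_spin_count_le_colouring_count by (intro sum_mono mult_left_mono) auto
  let ?t = "real (card V) / real (K + 1) + real (card {v \<in> V. \<not> tree_at E v K})"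
  have nn: "0 \<le> two_spin_count B (real q - 1) A" for A
    unfolding two_spin_count_def using q by (intro sum_nonneg mult_nonneg_nonneg divide_nonneg_nonneg) auto
  have "colouring_count B q A \<le> real q powr ?t * two_spin_count B (real q - 1) A" if "A \<subseteq> E" for A
  proof -
    have "real q ^ card (component A ` big_vertices K A) = real q powr real (card (component A ` big_vertices K A))"
      using q by (simp add: powr_realpow)
    also have "\<dots> \<le> real q powr ?t"
      using q by (intro powr_mono card_big_components[OF that]) auto
    finally show ?thesis
      using colouring_count_le_two_spin_count[OF that q B, of K] nn[of A]
      by (meson mult_right_mono order_trans)
  qed
  then have "Z_Potts (UGraph V E) q \<beta> B \<le>
      (\<Sum>A\<in>Pow E. (exp \<beta> - 1) ^ card A * (real q powr ?t * two_spin_count B (real q - 1) A))"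
    unfolding Z_Potts_expansion using w by (intro sum_mono mult_left_mono) auto
  also have "\<dots> = real q powr ?t * two_spin_sum (exp \<beta> - 1) B (real q - 1)"
    unfolding two_spin_sum_def sum_distrib_left by (intro sum.cong refl mult.left_commute)
  finally show "Z_Potts (UGraph V E) q \<beta> B \<le> real q powr ?t * two_spin_sum (exp \<beta> - 1) B (real q - 1)" .
qed

text \<open>For fixed \<open>S\<close> the sum over edge subsets is again a product over edges: an
  edge crossing the boundary of \<open>S\<close> can only be left out, and a chosen edge inside
  \<open>V - S\<close> carries one factor \<open>1 / m\<close>.\<close>

lemma two_spin_sum_product:
  assumes m: "0 < m"
  defines "we \<equiv> \<lambda>w S e. if e \<subseteq> S then w else if e \<subseteq> V - S then w / m else 0 :: real"
  shows "two_spin_sum w B m = (\<Sum>S\<in>Pow V. exp (B * real (card S)) * m ^ card (V - S) * (\<Prod>e\<in>E. we w S e + 1))"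
proof -
  have prod: "(\<Prod>e\<in>A. we w S e) = (if closed_under A S then w ^ card A / m ^ card {e \<in> A. e \<subseteq> V - S} else 0)"
    if A: "A \<subseteq> E" for A S
  proof -
    have fA: "finite A" using A finite_E finite_subset by blast
    show ?thesis
    proof (cases "closed_under A S")
      case True
      have "(\<Prod>e\<in>A. we w S e) = (\<Prod>e\<in>A. w * (if e \<subseteq> V - S then 1 / m else 1))"
      proof (rule prod.cong[OF refl])
        fix e assume e: "e \<in> A"
        have "e \<noteq> {}" using edge(2)[of e] A e by auto
        then show "we w S e = w * (if e \<subseteq> V - S then 1 / m else 1)"
          using True e by (auto simp: we_def closed_under_def)
      qed
      also have "\<dots> = w ^ card A * (\<Prod>e\<in>{e \<in> A. e \<subseteq> V - S}. 1 / m)"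
        unfolding prod.inter_filter[OF fA] by (simp only: prod.distrib prod_constant)
      also have "\<dots> = w ^ card A / m ^ card {e \<in> A. e \<subseteq> V - S}" by (simp add: power_one_over)
      finally show ?thesis using True by simp
    next
      case False
      then obtain e where "e \<in> A" "\<not> e \<subseteq> S" "\<not> e \<subseteq> V - S" by (auto simp: closed_under_def)
      then have "(\<Prod>e\<in>A. we w S e) = 0" using fA by (intro prod_zero) (auto simp: we_def)
      then show ?thesis using False by simp
    qed
  qed
  have fP: "finite (Pow V)" using finite_V by simp
  have "two_spin_sum w B m = (\<Sum>A\<in>Pow E. \<Sum>S\<in>Pow V. exp (B * real (card S)) * m ^ card (V - S) * (\<Prod>e\<in>A. we w S e))"
    unfolding two_spin_sum_def two_spin_count_def sum.inter_filter[OF fP] sum_distrib_left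
    by (intro sum.cong refl) (simp add: prod)
  also have "\<dots> = (\<Sum>S\<in>Pow V. \<Sum>A\<in>Pow E. exp (B * real (card S)) * m ^ card (V - S) * (\<Prod>e\<in>A. we w S e))"
    by (rule sum.swap)
  also have "\<dots> = (\<Sum>S\<in>Pow V. exp (B * real (card S)) * m ^ card (V - S) * (\<Prod>e\<in>E. we w S e + 1))"
    by (intro sum.cong refl) (simp add: prod_add[OF finite_E] sum_distrib_left)
  finally show ?thesis .
qed

lemma bij_spins_Pow: "bij_betw (\<lambda>\<sigma>. {v \<in> V. \<sigma> v = (1::real)}) (spins V) (Pow V)"
proof (rule bij_betwI[where g = "\<lambda>S. \<lambda>v\<in>V. if v \<in> S then 1 else -1"])
  fix \<sigma> assume \<sigma>: "\<sigma> \<in> spins V"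
  have "(\<lambda>v\<in>V. if v \<in> {v \<in> V. \<sigma> v = 1} then 1 else - 1) v = \<sigma> v" for v
  proof (cases "v \<in> V")
    case True
    then show ?thesis using spin_cases[OF \<sigma> True] by auto
  next
    case False
    then show ?thesis using \<sigma> by (simp add: PiE_def extensional_def)
  qed
  then show "(\<lambda>v\<in>V. if v \<in> {v \<in> V. \<sigma> v = 1} then 1 else - 1) = \<sigma>" by (rule ext)
qed auto

text \<open>The bond matrix with diagonal entries \<open>1 + w\<close>, \<open>1 + w / m\<close> and
  off-diagonal entries \<open>1\<close> is \<open>1 / D\<close> times the Ising bond matrix
  multiplied from both sides by the diagonal matrix with entries \<open>D\<close> and
  \<open>1\<close>. The factors \<open>D\<close> at the edge ends are collected at the vertices,
  where regularity turns them into \<open>D ^ d\<close> in the field.\<close>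

lemma two_spin_sum_eq_Ising:
  assumes w: "0 \<le> w" and m: "0 < m" and D: "0 < D" "x * D = 1 + w" "x = D * (1 + w / m)"
    and l: "l = exp B / m * D ^ d"
  shows "two_spin_sum w B m = m ^ card V / D ^ card E * Z_Ising V E x l"
proof -
  let ?we = "\<lambda>S e. if e \<subseteq> S then w else if e \<subseteq> V - S then w / m else 0"
  let ?S = "\<lambda>\<sigma>. {v \<in> V. \<sigma> v = (1::real)}"
  define dw where "dw = (\<lambda>s::real. if s = 1 then D else 1)"
  have "exp (B * real (card (?S \<sigma>))) * m ^ card (V - ?S \<sigma>) * (\<Prod>e\<in>E. ?we (?S \<sigma>) e + 1)
      = m ^ card V / D ^ card E * ising_weight V E x l \<sigma>" if \<sigma>: "\<sigma> \<in> spins V" for \<sigma>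
  proof -
    have "exp (B * real (card (?S \<sigma>))) * m ^ card (V - ?S \<sigma>) = m ^ card V * (exp B / m) ^ card (?S \<sigma>)"
    proof -
      have "card V = card (?S \<sigma>) + card (V - ?S \<sigma>)"
        using finite_V card_Diff_subset[of "?S \<sigma>" V] card_mono[of V "?S \<sigma>"] by auto
      then show ?thesis using m by (simp add: power_add power_divide exp_of_nat2_mult)
    qed
    also have "(exp B / m) ^ card (?S \<sigma>) = (\<Prod>v\<in>V. if \<sigma> v = 1 then exp B / m else 1)"
      using finite_V by (simp flip: prod.inter_filter)
    finally have 1: "exp (B * real (card (?S \<sigma>))) * m ^ card (V - ?S \<sigma>) =
        m ^ card V * (\<Prod>v\<in>V. if \<sigma> v = 1 then exp B / m else 1)" .
    have "(\<Prod>e\<in>E. ?we (?S \<sigma>) e + 1) = (\<Prod>e\<in>E. 1 / D * (bond_weight x \<sigma> e * (\<Prod>v\<in>e. dw (\<sigma> v))))"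
    proof (rule prod.cong[OF refl])
      fix e assume "e \<in> E"
      then obtain a b where ab: "e = {a, b}" "a \<noteq> b" "a \<in> V" "b \<in> V" by (rule edge_cases)
      have Dx: "1 + w = 1 / D * (x * (D * D))" "1 + w / m = 1 / D * (x * (1 * 1))" "1 = 1 / D * (1 * (D * 1))"
        using D by (auto simp: field_simps)
      have prodab: "(\<Prod>v\<in>{a, b}. dw (\<sigma> v)) = dw (\<sigma> a) * dw (\<sigma> b)" using ab(2) by simp
      consider "\<sigma> a = 1" "\<sigma> b = 1" | "\<sigma> a = -1" "\<sigma> b = -1" | "\<sigma> a = 1" "\<sigma> b = -1" | "\<sigma> a = -1" "\<sigma> b = 1"
        using spin_cases[OF \<sigma> ab(3)] spin_cases[OF \<sigma> ab(4)] by blast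
      then show "?we (?S \<sigma>) e + 1 = 1 / D * (bond_weight x \<sigma> e * (\<Prod>v\<in>e. dw (\<sigma> v)))"
        unfolding ab(1) bond_weight_pair prodab using ab(3,4) Dx
        by cases (simp_all add: dw_def)
    qed
    also have "\<dots> = (1 / D) ^ card E * ((\<Prod>e\<in>E. bond_weight x \<sigma> e) * (\<Prod>v\<in>V. dw (\<sigma> v) ^ d))"
    proof -
      have "(\<Prod>e\<in>E. \<Prod>v\<in>e. dw (\<sigma> v)) = (\<Prod>v\<in>V. dw (\<sigma> v) ^ d)"
        unfolding prod_edges[OF order_refl] using degree by (intro prod.cong) auto
      then show ?thesis by (simp only: prod.distrib prod_constant)
    qed
    finally have 2: "(\<Prod>e\<in>E. ?we (?S \<sigma>) e + 1) =
        (1 / D) ^ card E * ((\<Prod>e\<in>E. bond_weight x \<sigma> e) * (\<Prod>v\<in>V. dw (\<sigma> v) ^ d))" .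
    have 3: "(\<Prod>v\<in>V. field_weight l (\<sigma> v)) = (\<Prod>v\<in>V. if \<sigma> v = 1 then exp B / m else 1) * (\<Prod>v\<in>V. dw (\<sigma> v) ^ d)"
      unfolding prod.distrib[symmetric] by (intro prod.cong) (auto simp: field_weight_def dw_def l)
    show ?thesis unfolding 1 2 ising_weight_def 3 by (simp add: power_one_over)
  qed
  then show ?thesis
    unfolding two_spin_sum_product[OF m] Z_Ising_def sum_distrib_left
    by (subst sum.reindex_bij_betw[OF bij_spins_Pow, symmetric]) (intro sum.cong refl)
qed

theorem ln_Z_Potts_Ising:
  assumes q: "2 \<le> q" and \<beta>: "0 \<le> \<beta>" and B: "0 \<le> B"
    and D: "0 < D" "x * D = exp \<beta>" "x = D * (1 + (exp \<beta> - 1) / (real q - 1))"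
    and l: "l = exp B / (real q - 1) * D ^ d"
  shows "\<bar>ln (Z_Potts (UGraph V E) q \<beta> B) -
      (real (card V) * (ln (real q - 1) - real d / 2 * ln D) + ln (Z_Ising V E x l))\<bar>
    \<le> (real (card V) / real (K + 1) + real (card {v \<in> V. \<not> tree_at E v K})) * ln (real q)"
proof -
  define m where "m = real q - 1"
  have m: "0 < m" using q by (simp add: m_def)
  let ?TS = "two_spin_sum (exp \<beta> - 1) B m" and ?Z = "Z_Potts (UGraph V E) q \<beta> B"
  let ?t = "real (card V) / real (K + 1) + real (card {v \<in> V. \<not> tree_at E v K})"
  have x: "0 < x" unfolding D(3) using D(1) m \<beta> by (intro mult_pos_pos add_pos_nonneg) (auto simp: m_def)
  have l0: "0 < l" unfolding l using m D(1) by (simp add: m_def)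
  have TS: "?TS = m ^ card V / D ^ card E * Z_Ising V E x l"
    by (rule two_spin_sum_eq_Ising) (use \<beta> m D l in \<open>auto simp: m_def\<close>)
  have ZI: "0 < Z_Ising V E x l" using x l0 by (rule Z_Ising_pos)
  then have TSpos: "0 < ?TS" unfolding TS using m D(1) by simp
  have "ln ?TS = real (card V) * ln m - real (card E) * ln D + ln (Z_Ising V E x l)"
    unfolding TS using m D(1) ZI by (simp add: ln_mult ln_div ln_realpow)
  also have "real (card E) = real d * real (card V) / 2" using card_E by simp
  finally have lnTS: "ln ?TS = real (card V) * (ln m - real d / 2 * ln D) + ln (Z_Ising V E x l)"
    by (simp add: algebra_simps)
  have le: "?TS \<le> ?Z" "?Z \<le> real q powr ?t * ?TS"
    unfolding m_def using two_spin_sum_bounds[OF q \<beta> B] by auto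
  have "ln ?TS \<le> ln ?Z" using le TSpos by simp
  moreover have "ln ?Z \<le> ?t * ln (real q) + ln ?TS"
  proof -
    have "ln ?Z \<le> ln (real q powr ?t * ?TS)" using le TSpos by simp
    then show ?thesis using TSpos q by (simp add: ln_mult ln_powr)
  qed
  moreover have "0 \<le> ?t * ln (real q)" using q by (intro mult_nonneg_nonneg add_nonneg_nonneg) auto
  ultimately show ?thesis unfolding m_def[symmetric] lnTS[symmetric] by linarith
qed

end

section \<open>The Bethe prediction of the Potts model\<close>

text \<open>For nonnegative numbers with prescribed sum and sum of squares, the sum of the \<open>d\<close>-th powers is
  largest when all but the largest number coincide: the majorant below touches \<open>y ^ d\<close> at \<open>b\<close> and
  crosses it at \<open>a\<close>.\<close>

lemma power_quadratic_majorant: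
  fixes a b :: real
  assumes "0 \<le> a" "0 \<le> b"
  obtains S S' where "b ^ d = a ^ d + (b - a) * S"
    "\<And>y. 0 \<le> y \<Longrightarrow> y \<le> a \<Longrightarrow> y ^ d \<le> a ^ d + (y - a) * (S + S' * (y - b))"
proof -
  define Q where "Q = (\<lambda>y. \<Sum>i<d. a ^ (d - Suc i) * y ^ i)"
  define S' where "S' = (\<Sum>i<d. a ^ (d - Suc i) * (real i * b ^ (i - 1)))"
  have Q: "y ^ d = a ^ d + (y - a) * Q y" for y
    using power_diff_sumr2[of y d a] by (simp add: Q_def)
  have "y ^ d \<le> a ^ d + (y - a) * (Q b + S' * (y - b))" if y: "0 \<le> y" "y \<le> a" for y
  proof -
    have "Q b + S' * (y - b) = (\<Sum>i<d. a ^ (d - Suc i) * (b ^ i + real i * b ^ (i - 1) * (y - b)))"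
      unfolding Q_def S'_def sum_distrib_right sum.distrib[symmetric]
      by (intro sum.cong refl) (simp add: algebra_simps)
    also have "\<dots> \<le> Q y"
      unfolding Q_def using assms y by (intro sum_mono mult_left_mono power_tangent) auto
    finally have "(y - a) * Q y \<le> (y - a) * (Q b + S' * (y - b))"
      using y by (intro mult_left_mono_neg) auto
    then show ?thesis using Q[of y] by simp
  qed
  then show ?thesis using that Q by blast
qed

lemma sum_color_one:
  fixes f :: "nat \<Rightarrow> real"
  assumes "1 \<le> q"
  shows "(\<Sum>s=1..q. f s) = f 1 + (\<Sum>s=2..q. f s)"
  using assms by (simp add: sum.atLeast_Suc_atMost numeral_2_eq_2)

text \<open>\<open>a\<close> is the mean \<open>1 / q\<close> plus the largest deviation compatible
  with the sum of squares; Cauchy-Schwarz on the other \<open>q - 1\<close> coordinates shows that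
  no \<open>\<nu> s\<close> deviates more. The sum of squares is at most \<open>1\<close>, which
  gives \<open>a \<le> 1\<close> and so \<open>b \<ge> 0\<close>.\<close>

lemma extremal_two_valued_vector:
  fixes \<nu> :: "nat \<Rightarrow> real"
  assumes q: "2 \<le> q" and \<nu>: "\<And>s. s \<in> {1..q} \<Longrightarrow> 0 \<le> \<nu> s" "(\<Sum>s=1..q. \<nu> s) = 1"
  defines "m \<equiv> real q - 1"
  obtains a b where "0 \<le> b" "0 \<le> a" "a + m * b = 1" "a\<^sup>2 + m * b\<^sup>2 = (\<Sum>s=1..q. (\<nu> s)\<^sup>2)"
    "\<And>s. s \<in> {1..q} \<Longrightarrow> \<nu> s \<le> a"
proof -
  define s2 where "s2 = (\<Sum>s=1..q. (\<nu> s)\<^sup>2)"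
  have m: "1 \<le> m" "real q = m + 1" using q by (auto simp: m_def)
  define \<theta> where "\<theta> = (s2 - 1 / real q) * m / real q"
  have dev: "(\<nu> s - 1 / real q)\<^sup>2 \<le> \<theta>" if s: "s \<in> {1..q}" for s
  proof -
    have "(\<Sum>t\<in>{1..q} - {s}. \<nu> t)\<^sup>2 \<le> (\<Sum>t\<in>{1..q} - {s}. (\<nu> t)\<^sup>2) * (\<Sum>t\<in>{1..q} - {s}. 1\<^sup>2)"
      using Cauchy_Schwarz_ineq_sum[of \<nu> "\<lambda>_. 1" "{1..q} - {s}"] by simp
    moreover have "(\<Sum>t\<in>{1..q} - {s}. \<nu> t) = 1 - \<nu> s" "(\<Sum>t\<in>{1..q} - {s}. (\<nu> t)\<^sup>2) = s2 - (\<nu> s)\<^sup>2"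
      using s \<nu>(2) by (simp_all add: sum_diff1 s2_def)
    moreover have "(\<Sum>t\<in>{1..q} - {s}. 1\<^sup>2) = m"
      using s q by (simp add: m_def of_nat_diff)
    ultimately have ineq: "(1 - \<nu> s)\<^sup>2 \<le> (s2 - (\<nu> s)\<^sup>2) * m" by simp
    have "real q * real q * (\<theta> - (\<nu> s - 1 / real q)\<^sup>2) = real q * ((s2 - (\<nu> s)\<^sup>2) * m - (1 - \<nu> s)\<^sup>2)"
    proof -
      have "0 < real q" using q by simp
      then have "real q * real q * (\<theta> - (\<nu> s - 1 / real q)\<^sup>2) =
          (real q * s2 - 1) * m - (real q * \<nu> s - 1)\<^sup>2"
        by (simp add: \<theta>_def power2_eq_square field_simps)
      then show ?thesis unfolding m(2) by (simp add: power2_eq_square algebra_simps)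
    qed
    also have "\<dots> \<ge> 0" using ineq by (intro mult_nonneg_nonneg) auto
    finally have "0 \<le> (real q * real q) * (\<theta> - (\<nu> s - 1 / real q)\<^sup>2)" .
    moreover have "0 < real q * real q" using q by simp
    ultimately have "0 \<le> \<theta> - (\<nu> s - 1 / real q)\<^sup>2" by (simp only: zero_le_mult_iff) linarith
    then show ?thesis by simp
  qed
  have \<theta>0: "0 \<le> \<theta>" by (rule order_trans[OF zero_le_power2 dev[of 1]]) (use q in simp)
  define a where "a = 1 / real q + sqrt \<theta>"
  define b where "b = (1 - a) / m"
  have le: "\<nu> s \<le> a" if "s \<in> {1..q}" for s
    using real_le_rsqrt[OF dev[OF that]] by (simp add: a_def)
  have a0: "0 \<le> a" using \<theta>0 by (simp add: a_def)
  have ab: "a + m * b = 1" using m by (simp add: b_def)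
  have s2: "a\<^sup>2 + m * b\<^sup>2 = s2"
  proof -
    have "real q * (m * (a\<^sup>2 + m * b\<^sup>2)) = real q * (m * a\<^sup>2 + (m * b)\<^sup>2)"
      by (simp add: power2_eq_square algebra_simps)
    also have "m * b = 1 - a" using ab by simp
    also have "real q * (m * a\<^sup>2 + (1 - a)\<^sup>2) = (real q * a - 1)\<^sup>2 + m"
      unfolding m(2) by (simp add: power2_eq_square algebra_simps)
    also have "real q * a - 1 = real q * sqrt \<theta>" using q by (simp add: a_def distrib_left)
    also have "(real q * sqrt \<theta>)\<^sup>2 + m = real q * real q * \<theta> + m"
      using \<theta>0 by (simp add: power_mult_distrib power2_eq_square)
    also have "real q * real q * \<theta> = (real q * s2 - 1) * m"
      using q by (simp add: \<theta>_def field_simps)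
    finally have "real q * (m * (a\<^sup>2 + m * b\<^sup>2)) = real q * (m * s2)" by (simp add: algebra_simps)
    then show ?thesis using q m by simp
  qed
  have "a \<le> 1"
  proof -
    have "s2 \<le> (\<Sum>s=1..q. \<nu> s)"
      unfolding s2_def
    proof (rule sum_mono)
      fix s assume s: "s \<in> {1..q}"
      have "\<nu> s \<le> (\<Sum>s=1..q. \<nu> s)" using s \<nu>(1) by (intro member_le_sum) auto
      then show "(\<nu> s)\<^sup>2 \<le> \<nu> s" using \<nu> s by (simp add: power2_eq_square mult_left_le)
    qed
    then have "s2 \<le> 1" using \<nu> by simp
    then have "m * (a\<^sup>2 + m * b\<^sup>2) \<le> m * 1" unfolding s2 using m by (intro mult_left_mono) auto
    moreover have "m * (a\<^sup>2 + m * b\<^sup>2) = m * a\<^sup>2 + (m * b)\<^sup>2" by (simp add: power2_eq_square algebra_simps)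
    moreover have "m * b = 1 - a" using ab by simp
    ultimately have "m * a\<^sup>2 + (1 - a)\<^sup>2 \<le> m" by simp
    then have "(a - 1) * ((m + 1) * a + (m - 1)) \<le> 0" by (simp add: power2_eq_square algebra_simps)
    moreover have "0 < (m + 1) * a + (m - 1)" if "1 < a"
      using that m by (intro add_pos_nonneg mult_pos_pos) auto
    ultimately show ?thesis by (metis diff_gt_0_iff_gt linorder_not_less mult_pos_pos)
  qed
  then have "0 \<le> b" using m by (simp add: b_def)
  then show ?thesis using that[of b a] a0 ab s2 le unfolding s2_def by blast
qed

lemma sum_exp_match:
  fixes \<nu> :: "nat \<Rightarrow> real"
  assumes "s \<in> {1..q}"
  shows "(\<Sum>t=1..q. exp (\<beta> * of_bool (s = t)) * \<nu> t) = (\<Sum>t=1..q. \<nu> t) + (exp \<beta> - 1) * \<nu> s"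
proof -
  have "(\<Sum>t=1..q. exp (\<beta> * of_bool (s = t)) * \<nu> t) = (\<Sum>t=1..q. \<nu> t + (if t = s then (exp \<beta> - 1) * \<nu> t else 0))"
    by (intro sum.cong) (auto simp: algebra_simps)
  also have "\<dots> = (\<Sum>t=1..q. \<nu> t) + (exp \<beta> - 1) * \<nu> s"
    using assms by (simp add: sum.distrib)
  finally show ?thesis .
qed

text \<open>The second logarithm depends on \<open>\<nu>\<close> only through the sum of squares.
  Fixing that sum leaves a weighted sum of \<open>d\<close>-th powers to be maximised.\<close>

lemma Bethe_functional_eq:
  fixes \<beta> :: real
  assumes \<nu>: "(\<Sum>s=1..q. \<nu> s) = 1"
  defines "w \<equiv> exp \<beta> - 1"
  shows "Bethe_functional d q \<beta> B \<nu> =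
    ln (\<Sum>s=1..q. exp (B * of_bool (s = 1)) * (1 + w * \<nu> s) ^ d) - real d / 2 * ln (1 + w * (\<Sum>s=1..q. (\<nu> s)\<^sup>2))"
proof -
  have 1: "(\<Sum>s=1..q. exp (B * of_bool (s = 1)) * (\<Sum>t=1..q. exp (\<beta> * of_bool (s = t)) * \<nu> t) ^ d) =
      (\<Sum>s=1..q. exp (B * of_bool (s = 1)) * (1 + w * \<nu> s) ^ d)"
    by (intro sum.cong refl) (simp only: sum_exp_match \<nu> w_def)
  have "(\<Sum>s=1..q. \<Sum>t=1..q. exp (\<beta> * of_bool (s = t)) * \<nu> s * \<nu> t) =
      (\<Sum>s=1..q. \<nu> s * (\<Sum>t=1..q. exp (\<beta> * of_bool (s = t)) * \<nu> t))"
    by (simp add: sum_distrib_left mult_ac)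
  also have "\<dots> = (\<Sum>s=1..q. \<nu> s * (1 + w * \<nu> s))"
    by (intro sum.cong refl) (simp only: sum_exp_match \<nu> w_def)
  also have "\<dots> = 1 + w * (\<Sum>s=1..q. (\<nu> s)\<^sup>2)"
    using \<nu> by (simp add: distrib_left sum.distrib sum_distrib_left power2_eq_square mult_ac)
  finally show ?thesis unfolding Bethe_functional_def 1 by simp
qed

definition two_valued_bethe :: "nat \<Rightarrow> nat \<Rightarrow> real \<Rightarrow> real \<Rightarrow> real \<Rightarrow> real \<Rightarrow> real" where
  "two_valued_bethe d q w B a b = ln (exp B * (1 + w * a) ^ d + (real q - 1) * (1 + w * b) ^ d)
     - real d / 2 * ln (1 + w * (a\<^sup>2 + (real q - 1) * b\<^sup>2))"

lemma Bethe_functional_two_valued: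
  assumes q: "2 \<le> q" and ab: "a + (real q - 1) * b = 1"
    and \<nu>: "\<nu> 1 = a" "\<And>s. s \<in> {2..q} \<Longrightarrow> \<nu> s = b"
  shows "(\<Sum>s=1..q. \<nu> s) = 1"
    and "Bethe_functional d q \<beta> B \<nu> = two_valued_bethe d q (exp \<beta> - 1) B a b"
proof -
  have sum: "(\<Sum>s=1..q. f s (\<nu> s)) = f 1 a + (\<Sum>s=2..q. f s b)" for f :: "nat \<Rightarrow> real \<Rightarrow> real"
    using q \<nu> by (subst sum_color_one) auto
  have c: "real (q - 1) = real q - 1" using q by (simp add: of_nat_diff)
  show 1: "(\<Sum>s=1..q. \<nu> s) = 1" using sum[of "\<lambda>_ y. y"] ab q by (simp add: c)
  have "(\<Sum>s=2..q. exp (B * of_bool (s = 1)) * (1 + (exp \<beta> - 1) * b) ^ d) = (real q - 1) * (1 + (exp \<beta> - 1) * b) ^ d"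
    using q by (simp add: c)
  then show "Bethe_functional d q \<beta> B \<nu> = two_valued_bethe d q (exp \<beta> - 1) B a b"
    unfolding Bethe_functional_eq[OF 1] two_valued_bethe_def
    using sum[of "\<lambda>s y. exp (B * of_bool (s = 1)) * (1 + (exp \<beta> - 1) * y) ^ d"] sum[of "\<lambda>_ y. y\<^sup>2"] q
    by (simp add: c)
qed

text \<open>A quadratic majorant summed over the colours sees only the sum and the sum of squares,
  which agree with those of \<open>(a, b, ..., b)\<close>, and at that vector it is exact. The extra
  weight \<open>exp B - 1\<close> of the colour \<open>1\<close> is handled by
  \<open>\<nu> 1 \<le> a\<close>.\<close>

lemma Bethe_functional_le_two_valued:
  assumes q: "2 \<le> q" and \<beta>: "0 \<le> \<beta>" and B: "0 \<le> B"
    and \<nu>: "\<And>s. s \<in> {1..q} \<Longrightarrow> 0 \<le> \<nu> s" "(\<Sum>s=1..q. \<nu> s) = 1"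
  obtains a b where "0 \<le> a" "0 \<le> b" "a + (real q - 1) * b = 1"
    "Bethe_functional d q \<beta> B \<nu> \<le> two_valued_bethe d q (exp \<beta> - 1) B a b"
proof -
  define w m where "w = exp \<beta> - 1" and "m = real q - 1"
  have w: "0 \<le> w" using \<beta> by (simp add: w_def)
  obtain a b where ab: "0 \<le> b" "0 \<le> a" "a + m * b = 1" "a\<^sup>2 + m * b\<^sup>2 = (\<Sum>s=1..q. (\<nu> s)\<^sup>2)"
    "\<And>s. s \<in> {1..q} \<Longrightarrow> \<nu> s \<le> a"
    using extremal_two_valued_vector[OF q \<nu>] unfolding m_def by metis
  define A C where "A = 1 + w * a" and "C = 1 + w * b"
  have AC: "0 \<le> A" "0 \<le> C" using w ab by (auto simp: A_def C_def)
  obtain S S' where S: "C ^ d = A ^ d + (C - A) * S"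
    "\<And>y. 0 \<le> y \<Longrightarrow> y \<le> A \<Longrightarrow> y ^ d \<le> A ^ d + (y - A) * (S + S' * (y - C))"
    using power_quadratic_majorant[OF AC] by metis
  define Y where "Y = (\<lambda>s. 1 + w * \<nu> s)"
  have Y: "0 \<le> Y s" "Y s \<le> A" if "s \<in> {1..q}" for s
    using that w \<nu>(1) ab(5) by (auto simp: Y_def A_def mult_left_mono)
  have "(\<Sum>s=1..q. Y s ^ d) \<le> (\<Sum>s=1..q. A ^ d + (Y s - A) * (S + S' * (Y s - C)))"
    using S(2) Y by (intro sum_mono) auto
  also have "\<dots> = A ^ d + m * C ^ d"
  proof -
    have "(Y s - A) * (S + S' * (Y s - C)) = w * S * (\<nu> s - a) + w\<^sup>2 * S' * ((\<nu> s)\<^sup>2 - (a + b) * \<nu> s + a * b)" for s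
      by (simp add: Y_def A_def C_def power2_eq_square algebra_simps)
    then have "(\<Sum>s=1..q. A ^ d + (Y s - A) * (S + S' * (Y s - C))) =
        (\<Sum>s=1..q. A ^ d + w * S * (\<nu> s - a) + w\<^sup>2 * S' * ((\<nu> s)\<^sup>2 - (a + b) * \<nu> s + a * b))"
      by (simp only: add.assoc)
    also have "\<dots> = real q * A ^ d + w * S * ((\<Sum>s=1..q. \<nu> s) - real q * a) +
        w\<^sup>2 * S' * ((\<Sum>s=1..q. (\<nu> s)\<^sup>2) - (a + b) * (\<Sum>s=1..q. \<nu> s) + real q * (a * b))"
      by (simp add: sum.distrib sum_subtractf flip: sum_distrib_left)
    also have "\<dots> = (m + 1) * A ^ d + w * S * ((a + m * b) - (m + 1) * a) +
        w\<^sup>2 * S' * ((a\<^sup>2 + m * b\<^sup>2) - (a + b) * (a + m * b) + (m + 1) * (a * b))"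
      unfolding ab(3,4) \<nu>(2) by (simp add: m_def)
    also have "\<dots> = A ^ d + m * (A ^ d + (C - A) * S)"
      by (simp add: A_def C_def power2_eq_square algebra_simps)
    finally show ?thesis unfolding S(1) .
  qed
  finally have 1: "(\<Sum>s=1..q. Y s ^ d) \<le> A ^ d + m * C ^ d" .
  have "(\<Sum>s=1..q. exp (B * of_bool (s = 1)) * Y s ^ d) = (\<Sum>s=1..q. Y s ^ d) + (exp B - 1) * Y 1 ^ d"
    using q by (subst (1 2) sum_color_one) (auto simp: algebra_simps intro!: sum.cong)
  also have "\<dots> \<le> (A ^ d + m * C ^ d) + (exp B - 1) * A ^ d"
    using Y[of 1] q B 1 by (intro add_mono mult_left_mono power_mono) auto
  finally have le: "(\<Sum>s=1..q. exp (B * of_bool (s = 1)) * Y s ^ d) \<le> exp B * A ^ d + m * C ^ d"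
    by (simp add: algebra_simps)
  have pos: "0 < (\<Sum>s=1..q. exp (B * of_bool (s = 1)) * Y s ^ d)"
  proof (rule sum_pos)
    show "0 < exp (B * of_bool (s = 1)) * Y s ^ d" if "s \<in> {1..q}" for s
      using w \<nu>(1)[OF that] by (intro mult_pos_pos zero_less_power) (auto simp: Y_def intro: add_pos_nonneg)
  qed (use q in auto)
  have "ln (\<Sum>s=1..q. exp (B * of_bool (s = 1)) * Y s ^ d) \<le> ln (exp B * A ^ d + m * C ^ d)"
    using le pos by simp
  then have "Bethe_functional d q \<beta> B \<nu> \<le> two_valued_bethe d q w B a b"
    unfolding Bethe_functional_eq[OF \<nu>(2)] two_valued_bethe_def w_def[symmetric] m_def[symmetric] ab(4)
    by (simp add: A_def C_def Y_def)
  then show ?thesis using that[of a b] ab unfolding w_def m_def by blast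
qed

text \<open>The first coordinate is rescaled by the factor \<open>D\<close> that equalises the
  bonds, and the \<open>q - 1\<close> equal coordinates are merged into their total mass.\<close>

lemma two_valued_bethe_Ising:
  assumes q: "2 \<le> q" and w: "0 \<le> w" and D: "0 < D" "x * D = 1 + w" "x = D * (1 + w / (real q - 1))"
    and l: "l = exp B / (real q - 1) * D ^ d"
    and ab: "0 \<le> a" "0 \<le> b" "a + (real q - 1) * b = 1"
  shows "two_valued_bethe d q w B a b =
    ln (real q - 1) - real d / 2 * ln D + ising_bethe x l d (D * a) ((real q - 1) * b)"
proof -
  define m where "m = real q - 1"
  have m: "0 < m" using q by (simp add: m_def)
  have pos: "0 < exp B * (1 + w * a) ^ d + m * (1 + w * b) ^ d" "0 < 1 + w * (a\<^sup>2 + m * b\<^sup>2)"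
    using w ab(1,2) m by (auto intro!: add_pos_nonneg mult_pos_pos zero_less_power mult_nonneg_nonneg)
  have ab': "a + m * b = 1" using ab(3) by (simp add: m_def)
  have mx: "m * x = D * (m + w)" unfolding D(3) m_def[symmetric] using m by (simp add: field_simps)
  have 1: "x * (D * a) + m * b = 1 + w * a"
  proof -
    have "x * (D * a) + m * b = (x * D) * a + m * b" by (simp only: mult.assoc)
    also have "\<dots> = (a + m * b) + w * a" unfolding D(2) by (simp add: algebra_simps)
    finally show ?thesis unfolding ab' .
  qed
  have 2: "D * a + x * (m * b) = D * (1 + w * b)"
  proof -
    have "D * a + x * (m * b) = D * a + (m * x) * b" by (simp only: mult_ac)
    also have "\<dots> = D * ((a + m * b) + w * b)" unfolding mx by (simp add: algebra_simps)
    finally show ?thesis unfolding ab' .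
  qed
  have "ising_num x l d (D * a) (m * b) = D ^ d / m * (exp B * (1 + w * a) ^ d + m * (1 + w * b) ^ d)"
    unfolding ising_num_def 1 2 l m_def[symmetric] power_mult_distrib using m by (simp add: field_simps)
  then have N: "ln (ising_num x l d (D * a) (m * b)) =
      real d * ln D - ln m + ln (exp B * (1 + w * a) ^ d + m * (1 + w * b) ^ d)"
    using pos(1) m D(1) by (simp add: ln_mult ln_div ln_realpow)
  have "ising_form x (D * a) (m * b) = D * a * (x * (D * a) + m * b) + m * b * (D * a + x * (m * b))"
    by (simp add: ising_form_def power2_eq_square algebra_simps)
  also have "\<dots> = D * ((a + m * b) + w * (a\<^sup>2 + m * b\<^sup>2))"
    unfolding 1 2 by (simp add: power2_eq_square algebra_simps)
  finally have "ising_form x (D * a) (m * b) = D * (1 + w * (a\<^sup>2 + m * b\<^sup>2))" unfolding ab' .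
  then have F: "ln (ising_form x (D * a) (m * b)) = ln D + ln (1 + w * (a\<^sup>2 + m * b\<^sup>2))"
    using pos(2) D(1) by (simp add: ln_mult)
  show ?thesis
    unfolding two_valued_bethe_def ising_bethe_def m_def[symmetric] N F by (simp add: algebra_simps)
qed

text \<open>The upper bound goes through the comparison with two-valued vectors. It is attained at a
  fixed point, because the Ising maximiser solves the Ising recursion and its pullback solves the
  Potts recursion.\<close>

theorem Bethe_prediction_eq_Ising:
  assumes q: "2 \<le> q" and d: "0 < d" and \<beta>: "0 \<le> \<beta>" and B: "0 \<le> B" and x: "1 \<le> x"
    and D: "0 < D" "x * D = exp \<beta>" "x = D * (1 + (exp \<beta> - 1) / (real q - 1))"
    and l: "l = exp B / (real q - 1) * D ^ d"
  shows "Bethe_prediction d q \<beta> B = ln (real q - 1) - real d / 2 * ln D + ising_pressure x l d"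
proof -
  define w m where "w = exp \<beta> - 1" and "m = real q - 1"
  have w: "0 \<le> w" using \<beta> by (simp add: w_def)
  have m: "0 < m" using q by (simp add: m_def)
  have l0: "0 < l" unfolding l m_def[symmetric] using m D(1) by simp
  have Dw: "x * D = 1 + w" "x = D * (1 + w / (real q - 1))" "l = exp B / (real q - 1) * D ^ d"
    using D l by (auto simp: w_def)
  note iso = two_valued_bethe_Ising[OF q w D(1) Dw]
  let ?P = "ln m - real d / 2 * ln D + ising_pressure x l d"
  have upper: "Bethe_functional d q \<beta> B \<nu> \<le> ?P" if "\<nu> \<in> BP_fixed_points d q \<beta> B" for \<nu>
  proof -
    have prob: "\<nu> \<in> {1..q} \<rightarrow>\<^sub>E {0..}" "(\<Sum>s=1..q. \<nu> s) = 1"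
      using that by (simp_all only: BP_fixed_points_def prob_vectors_def mem_Collect_eq)
    have "0 \<le> \<nu> s" if "s \<in> {1..q}" for s using PiE_mem[OF prob(1) that] by simp
    from Bethe_functional_le_two_valued[OF q \<beta> B this prob(2), where d = d] obtain a b where ab:
      "0 \<le> a" "0 \<le> b" "a + m * b = 1" "Bethe_functional d q \<beta> B \<nu> \<le> two_valued_bethe d q w B a b"
      unfolding w_def m_def by metis
    have "0 < D * a + m * b"
    proof (cases "a = 0")
      case True
      then show ?thesis using ab by simp
    next
      case False
      then show ?thesis using ab m D(1) by (intro add_pos_nonneg) auto
    qed
    then have "ising_bethe x l d (D * a) (m * b) \<le> ising_pressure x l d"
      using ab m D(1) by (intro ising_bethe_le_pressure[OF x l0 d]) auto
    then show ?thesis using ab(4) iso[of a b] ab(1-3) by (simp add: m_def)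
  qed
  obtain s t z where st: "0 < s" "0 < t" "0 < z" "ising_fixed x l d s t z"
    "ising_bethe x l d s t = ising_pressure x l d"
    using ising_pressure_attained[OF x l0 d] by blast
  \<comment> \<open>The scale for which the pulled-back vector has total mass
    \<open>1\<close>.\<close>
  define c where "c = 1 / (s / D + t)"
  have c: "0 < c" unfolding c_def using st D(1) by (intro divide_pos_pos add_pos_pos) auto
  define a b where "a = c * s / D" and "b = c * t / m"
  have ab: "0 < a" "0 < b" using c st D(1) m by (auto simp: a_def b_def)
  have sc: "D * a = c * s" "m * b = c * t" using D(1) m by (auto simp: a_def b_def)
  have sum1: "a + m * b = 1"
  proof -
    have "0 < s / D + t" using st D(1) by (intro add_pos_pos) auto
    then have "c * (s / D + t) = 1" by (simp add: c_def)
    then show ?thesis unfolding sc(2) by (simp add: a_def distrib_left)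
  qed
  have mx: "m * x = D * (m + w)" unfolding Dw(2) m_def[symmetric] using m by (simp add: field_simps)
  have 1: "c * (x * s + t) = 1 + w * a"
  proof -
    have "c * (x * s + t) = x * (c * s) + c * t" by (simp add: algebra_simps)
    also have "\<dots> = (x * D) * a + m * b" unfolding sc[symmetric] by simp
    also have "\<dots> = (a + m * b) + w * a" unfolding Dw(1) by (simp add: algebra_simps)
    finally show ?thesis unfolding sum1 .
  qed
  have 2: "c * (s + x * t) = D * (1 + w * b)"
  proof -
    have "c * (s + x * t) = c * s + x * (c * t)" by (simp add: algebra_simps)
    also have "\<dots> = D * a + (m * x) * b" unfolding sc[symmetric] by simp
    also have "\<dots> = D * ((a + m * b) + w * b)" unfolding mx by (simp add: algebra_simps)
    finally show ?thesis unfolding sum1 .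
  qed
  define k where "k = d - 1"
  have dk: "D ^ d = D ^ k * D" using d by (simp add: k_def power_eq_if)
  define z' where "z' = m * z * c ^ k / (c * D ^ k)"
  have z': "0 < z'" using m st c D(1) by (simp add: z'_def)
  have fp1: "exp B * (1 + w * a) ^ k = z' * a"
  proof -
    have "l * (x * s + t) ^ k = z * s" using st(4) by (simp add: ising_fixed_def k_def)
    then have "l * (c * (x * s + t)) ^ k = c ^ k * (z * s)" by (simp add: power_mult_distrib)
    then have "exp B / m * (D ^ k * D) * (1 + w * a) ^ k = c ^ k * (z * s)"
      unfolding 1 Dw(3) dk m_def[symmetric] .
    then have "exp B * (1 + w * a) ^ k = m * (c ^ k * (z * s)) / (D ^ k * D)"
      using m D(1) by (simp add: field_simps)
    also have "\<dots> = z' * a" using c D(1) by (simp add: z'_def a_def)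
    finally show ?thesis .
  qed
  have fp2: "(1 + w * b) ^ k = z' * b"
  proof -
    have "(s + x * t) ^ k = z * t" using st(4) by (simp add: ising_fixed_def k_def)
    then have "(c * (s + x * t)) ^ k = c ^ k * (z * t)" by (simp add: power_mult_distrib)
    then have "D ^ k * (1 + w * b) ^ k = c ^ k * (z * t)" unfolding 2 by (simp add: power_mult_distrib)
    then have "(1 + w * b) ^ k = c ^ k * (z * t) / D ^ k" using D(1) by (simp add: field_simps)
    also have "\<dots> = z' * b" using c D(1) m by (simp add: z'_def b_def)
    finally show ?thesis .
  qed
  define \<nu> where "\<nu> = (\<lambda>s\<in>{1..q}. if s = 1 then a else b)"
  have \<nu>s: "\<nu> 1 = a" "\<And>s. s \<in> {2..q} \<Longrightarrow> \<nu> s = b" using q by (auto simp: \<nu>_def)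
  have "a + (real q - 1) * b = 1" using sum1 by (simp add: m_def)
  note two_val = Bethe_functional_two_valued[of q a b \<nu>, OF q this \<nu>s(1)]
  have sum\<nu>: "(\<Sum>s=1..q. \<nu> s) = 1"
    by (rule two_val(1)) (rule \<nu>s(2))
  have val: "Bethe_functional d q \<beta> B \<nu> = ?P"
  proof -
    have "Bethe_functional d q \<beta> B \<nu> = two_valued_bethe d q w B a b"
      unfolding w_def by (rule two_val(2)) (rule \<nu>s(2))
    also have "\<dots> = ln m - real d / 2 * ln D + ising_bethe x l d (c * s) (c * t)"
      unfolding sc[symmetric] m_def using ab sum1 by (intro iso) (auto simp: m_def)
    also have "ising_bethe x l d (c * s) (c * t) = ising_pressure x l d"
      using ising_bethe_scale[OF x l0, of s t c d] st c by simp
    finally show ?thesis .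
  qed
  have mem: "\<nu> \<in> BP_fixed_points d q \<beta> B"
    unfolding BP_fixed_points_def prob_vectors_def
  proof (intro CollectI conjI exI[of _ z'] ballI)
    show "\<nu> \<in> {1..q} \<rightarrow>\<^sub>E {0..}" unfolding \<nu>_def using ab by (intro restrict_PiE_iff[THEN iffD2]) auto
    fix s assume s: "s \<in> {1..q}"
    have "(\<Sum>t=1..q. exp (\<beta> * of_bool (s = t)) * \<nu> t) = 1 + w * \<nu> s"
      unfolding sum_exp_match[OF s] sum\<nu> w_def ..
    moreover have "\<nu> s = 1 / z' * exp (B * of_bool (s = 1)) * (1 + w * \<nu> s) ^ k"
    proof (cases "s = 1")
      case True
      then show ?thesis using fp1 z' \<nu>s(1) by simp
    next
      case False
      then have "\<nu> s = b" using s by (intro \<nu>s(2)) auto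
      then show ?thesis using fp2 z' False by simp
    qed
    ultimately show "\<nu> s = 1 / z' * exp (B * of_bool (s = 1)) *
        (\<Sum>t=1..q. exp (\<beta> * of_bool (s = t)) * \<nu> t) ^ (d - 1)"
      by (simp only: k_def)
  qed (use z' sum\<nu> in auto)
  have "Bethe_prediction d q \<beta> B = Bethe_functional d q \<beta> B \<nu>"
    unfolding Bethe_prediction_def
  proof (rule cSup_eq_maximum)
    show "Bethe_functional d q \<beta> B \<nu> \<in> Bethe_functional d q \<beta> B ` BP_fixed_points d q \<beta> B"
      by (rule imageI[OF mem])
    show "y \<le> Bethe_functional d q \<beta> B \<nu>"
      if "y \<in> Bethe_functional d q \<beta> B ` BP_fixed_points d q \<beta> B" for y
      using that upper unfolding val by blast
  qed
  then show ?thesis unfolding val by (simp add: m_def)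
qed

section \<open>The limit of the pressure per particle\<close>

lemma regular_if_regular_graph:
  assumes "regular_graph d n G"
  shows "regular (verts G) (edges G) d"
  using assms unfolding regular_graph_def finite_simple_graph_def degree_in_def
  by unfold_locales auto

lemma card_not_tree_at_le:
  assumes G: "regular_graph d n G" and tree: "1 - \<delta> \<le> tree_proportion R G" and r: "r \<le> R"
  shows "real (card {v \<in> verts G. \<not> tree_at (edges G) v r}) \<le> \<delta> * real n"
proof (cases "n = 0")
  \<comment> \<open>For \<open>n = 0\<close> the proportion is a division by zero and carries no
    information, but there are no vertices either.\<close>
  case True
  then have "verts G = {}" using G by (auto simp: regular_graph_def finite_simple_graph_def)
  then show ?thesis using True by simp
next
  case False
  let ?V = "verts G" and ?good = "{v \<in> verts G. tree_graph (neighbourhood G v R)}"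
  have V: "finite ?V" "card ?V = n" and edge: "\<And>e. e \<in> edges G \<Longrightarrow> e \<subseteq> ?V \<and> card e = 2"
    using G by (auto simp: regular_graph_def finite_simple_graph_def)
  have "{v \<in> ?V. \<not> tree_at (edges G) v r} \<subseteq> ?V - ?good"
  proof
    fix v assume v: "v \<in> {v \<in> ?V. \<not> tree_at (edges G) v r}"
    have "tree_at (edges G) v R" if "tree_graph (neighbourhood G v R)"
      using v edge that by (intro tree_at_if_tree_graph) auto
    then show "v \<in> ?V - ?good" using v tree_at_mono[OF _ r, of "edges G" v] by auto
  qed
  then have "card {v \<in> ?V. \<not> tree_at (edges G) v r} \<le> card (?V - ?good)"
    using V by (intro card_mono) auto
  also have "\<dots> = n - card ?good" using V by (subst card_Diff_subset) auto
  finally have "real (card {v \<in> ?V. \<not> tree_at (edges G) v r}) \<le> real n - real (card ?good)"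
    using V card_mono[of ?V ?good] by (simp add: of_nat_diff)
  moreover have "(1 - \<delta>) * real n \<le> real (card ?good)"
  proof -
    have "0 < real n" using False by simp
    moreover have "1 - \<delta> \<le> real (card ?good) / real n" using tree V by (simp add: tree_proportion_def)
    ultimately show ?thesis by (simp only: pos_le_divide_eq)
  qed
  ultimately show ?thesis by (simp add: algebra_simps)
qed

theorem Potts_pressure_approximation:
  assumes d: "0 < d" and q: "2 \<le> q" and \<beta>: "0 \<le> \<beta>" and B: "0 \<le> B" and \<epsilon>: "0 < \<epsilon>"
  shows "\<exists>R \<delta>. 0 < \<delta> \<and> (\<forall>n (G::'v ugraph). 0 < n \<longrightarrow> regular_graph d n G \<longrightarrow> 1 - \<delta> \<le> tree_proportion R G \<longrightarrow>
    \<bar>1 / real n * ln (Z_Potts G q \<beta> B) - Bethe_prediction d q \<beta> B\<bar> \<le> \<epsilon>)"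
proof -
  define p p' where "p = exp \<beta>" and "p' = 1 + (exp \<beta> - 1) / (real q - 1)"
  have p: "1 \<le> p" "1 \<le> p'" using \<beta> q by (auto simp: p_def p'_def)
  \<comment> \<open>The positive solution of \<open>x * D = p\<close> and \<open>x = D * p'\<close>,
    the two conditions for equal diagonal entries.\<close>
  define D where "D = sqrt (p / p')"
  define x where "x = D * p'"
  define l where "l = exp B / (real q - 1) * D ^ d"
  have D: "0 < D" using p by (simp add: D_def)
  have D2: "D * D = p / p'" using p by (simp add: D_def)
  have xD: "x * D = exp \<beta>"
  proof -
    have "x * D = (D * D) * p'" by (simp add: x_def)
    then show ?thesis unfolding D2 using p by (simp add: p_def)
  qed
  have x1: "1 \<le> x"
  proof -
    have "x * x = (x * D) * p'" by (simp add: x_def)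
    also have "\<dots> = p * p'" unfolding xD p_def ..
    finally have "1 \<le> x * x" using p mult_mono[of 1 p 1 p'] by simp
    moreover have "0 \<le> x" using D p by (simp add: x_def)
    ultimately show ?thesis using power2_le_imp_le[of 1 x] by (simp add: power2_eq_square)
  qed
  have l0: "0 < l" using D q by (simp add: l_def)
  have xp: "x = D * (1 + (exp \<beta> - 1) / (real q - 1))" by (simp add: x_def p'_def)
  have \<epsilon>2: "0 < \<epsilon> / 2" using \<epsilon> by simp
  obtain r \<delta>1 where r: "0 < \<delta>1" "\<And>(V::'v set) E. regular V E d \<Longrightarrow>
      real (card {v \<in> V. \<not> tree_at E v (Suc r)}) \<le> \<delta>1 * real (card V) \<Longrightarrow>
      \<bar>ln (Z_Ising V E x l) - real (card V) * ising_pressure x l d\<bar> \<le> real (card V) * (\<epsilon> / 2)"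
    using Ising_pressure_limit[OF x1 l0 d \<epsilon>2, where 'v = 'v] by blast
  define L where "L = ln (real q)"
  have L: "0 < L" using q by (simp add: L_def)
  \<comment> \<open>\<open>K\<close> bounds the error from large components and
    \<open>\<delta>2\<close> the one from bad vertices, each by \<open>\<epsilon> / 4\<close> per
    vertex; the other half of \<open>\<epsilon>\<close> goes to the Ising limit.\<close>
  obtain K :: nat where K: "4 * L / \<epsilon> \<le> real K" using real_arch_simple by blast
  define \<delta>2 where "\<delta>2 = \<epsilon> / (4 * L)"
  have \<delta>2: "0 < \<delta>2" using \<epsilon> L by (simp add: \<delta>2_def)
  have K': "L / real (K + 1) \<le> \<epsilon> / 4"
  proof -
    have "4 * L \<le> real K * \<epsilon>" using K \<epsilon> by (simp add: pos_divide_le_eq)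
    also have "\<dots> \<le> real (K + 1) * \<epsilon>" using \<epsilon> by (intro mult_right_mono) auto
    finally have "L \<le> \<epsilon> / 4 * real (K + 1)" by (simp add: mult.commute)
    moreover have "0 < real (K + 1)" by simp
    ultimately show ?thesis by (simp only: pos_divide_le_eq)
  qed
  have "\<bar>1 / real n * ln (Z_Potts G q \<beta> B) - Bethe_prediction d q \<beta> B\<bar> \<le> \<epsilon>"
    if n: "0 < n" and G: "regular_graph d n G" and tree: "1 - min \<delta>1 \<delta>2 \<le> tree_proportion (max (Suc r) K) G"
    for n and G :: "'v ugraph"
  proof -
    interpret regular "verts G" "edges G" d by (rule regular_if_regular_graph[OF G])
    have cV: "card (verts G) = n" using G by (simp add: regular_graph_def)
    have n0: "0 < real n" using n by simp
    have bad: "real (card {v \<in> verts G. \<not> tree_at (edges G) v k}) \<le> min \<delta>1 \<delta>2 * real n"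
      if "k \<le> max (Suc r) K" for k
      by (rule card_not_tree_at_le[OF G tree that])
    have "min \<delta>1 \<delta>2 * real n \<le> \<delta>1 * real n" "min \<delta>1 \<delta>2 * real n \<le> \<delta>2 * real n"
      using n0 by (auto intro: mult_right_mono)
    then have bad1: "real (card {v \<in> verts G. \<not> tree_at (edges G) v (Suc r)}) \<le> \<delta>1 * real n"
      and bad2: "real (card {v \<in> verts G. \<not> tree_at (edges G) v K}) \<le> \<delta>2 * real n"
      using bad[of "Suc r"] bad[of K] by linarith+
    have I: "\<bar>ln (Z_Ising (verts G) (edges G) x l) - real n * ising_pressure x l d\<bar> \<le> real n * (\<epsilon> / 2)"
      using r(2)[OF regular_axioms] bad1 unfolding cV by blast
    have P: "\<bar>ln (Z_Potts G q \<beta> B) -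
        (real n * (ln (real q - 1) - real d / 2 * ln D) + ln (Z_Ising (verts G) (edges G) x l))\<bar>
      \<le> (real n / real (K + 1) + real (card {v \<in> verts G. \<not> tree_at (edges G) v K})) * L"
      using ln_Z_Potts_Ising[OF q \<beta> B D xD xp l_def, of K] unfolding cV L_def ugraph.collapse .
    have "(real n / real (K + 1) + real (card {v \<in> verts G. \<not> tree_at (edges G) v K})) * L
        \<le> (real n / real (K + 1) + \<delta>2 * real n) * L"
      using bad2 L by (intro mult_right_mono) auto
    also have "\<dots> = real n * (L / real (K + 1) + \<delta>2 * L)" by (simp add: algebra_simps)
    also have "\<dots> \<le> real n * (\<epsilon> / 4 + \<epsilon> / 4)"
    proof (intro mult_left_mono add_mono K')
      show "\<delta>2 * L \<le> \<epsilon> / 4" using L by (simp add: \<delta>2_def)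
    qed simp
    finally have P': "(real n / real (K + 1) + real (card {v \<in> verts G. \<not> tree_at (edges G) v K})) * L
        \<le> real n * (\<epsilon> / 2)" by simp
    have "Bethe_prediction d q \<beta> B = ln (real q - 1) - real d / 2 * ln D + ising_pressure x l d"
      by (rule Bethe_prediction_eq_Ising[OF q d \<beta> B x1 D xD xp l_def])
    then have "real n * Bethe_prediction d q \<beta> B =
        real n * (ln (real q - 1) - real d / 2 * ln D) + real n * ising_pressure x l d"
      by (simp only: distrib_left)
    moreover have "real n * \<epsilon> = real n * (\<epsilon> / 2) + real n * (\<epsilon> / 2)" by simp
    ultimately have "\<bar>ln (Z_Potts G q \<beta> B) - real n * Bethe_prediction d q \<beta> B\<bar> \<le> real n * \<epsilon>"
      using P P' I by linarith
    then have "\<bar>ln (Z_Potts G q \<beta> B) - real n * Bethe_prediction d q \<beta> B\<bar> / real n \<le> \<epsilon>"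
      using n0 by (simp only: pos_divide_le_eq mult.commute)
    moreover have "1 / real n * ln (Z_Potts G q \<beta> B) - Bethe_prediction d q \<beta> B =
        (ln (Z_Potts G q \<beta> B) - real n * Bethe_prediction d q \<beta> B) / real n"
      using n0 by (simp add: diff_divide_distrib)
    ultimately show ?thesis by (simp only: abs_divide abs_of_nat)
  qed
  moreover have "0 < min \<delta>1 \<delta>2" using r(1) \<delta>2 by simp
  ultimately show ?thesis by blast
qed

section \<open>Deterministic and random graph sequences\<close>

lemma eventually_at_top_along:
  "eventually P (at_top_along I) \<longleftrightarrow> (\<forall>\<^sub>F n in at_top. n \<in> I \<longrightarrow> P n)"
  unfolding at_top_along_def by (rule eventually_inf_principal)

lemma eventually_at_top_along_mem: "\<forall>\<^sub>F n in at_top_along I. n \<in> I \<and> 0 < n"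
  unfolding eventually_at_top_along using eventually_gt_at_top[of "0::nat"]
  by eventually_elim simp

theorem corollary1p15:
  fixes d q :: nat
  assumes "3 \<le> d" and "3 \<le> q"
  shows
    "(\<forall>(I :: nat set) (G :: nat \<Rightarrow> 'v ugraph).
        infinite I \<longrightarrow>
        (\<forall>n\<in>I. regular_graph d n (G n)) \<longrightarrow>
        converges_to_regular_tree I G \<longrightarrow>
        (\<forall>\<beta> B :: real. 0 \<le> \<beta> \<longrightarrow> 0 \<le> B \<longrightarrow>
          ((\<lambda>n. 1 / real n * ln (Z_Potts (G n) q \<beta> B)) \<longlongrightarrow> Bethe_prediction d q \<beta> B)
            (at_top_along I))) \<and>
     (\<forall>(I :: nat set) (M :: nat \<Rightarrow> 'w measure) (G :: nat \<Rightarrow> 'w \<Rightarrow> 'v ugraph).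
        infinite I \<longrightarrow>
        (\<forall>n\<in>I. random_regular_graph d n (M n) (G n)) \<longrightarrow>
        converges_to_regular_tree_in_probability M I G \<longrightarrow>
        (\<forall>\<beta> B :: real. 0 \<le> \<beta> \<longrightarrow> 0 \<le> B \<longrightarrow>
          tendsto_in_probability M (\<lambda>n \<omega>. 1 / real n * ln (Z_Potts (G n \<omega>) q \<beta> B))
            (Bethe_prediction d q \<beta> B) (at_top_along I)))"
proof (intro conjI allI impI)
  have d: "0 < d" and q: "2 \<le> q" using assms by auto
  {
    fix I :: "nat set" and G :: "nat \<Rightarrow> 'v ugraph" and \<beta> B :: real
    assume reg: "\<forall>n\<in>I. regular_graph d n (G n)" and conv: "converges_to_regular_tree I G"
      and \<beta>: "0 \<le> \<beta>" and B: "0 \<le> B"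
    show "((\<lambda>n. 1 / real n * ln (Z_Potts (G n) q \<beta> B)) \<longlongrightarrow> Bethe_prediction d q \<beta> B) (at_top_along I)"
    proof (rule tendstoI)
      fix \<epsilon> :: real assume "0 < \<epsilon>"
      \<comment> \<open>Half of \<open>\<epsilon>\<close>, because the approximation is not strict
        and the limit asks for a strict inequality.\<close>
      then have "0 < \<epsilon> / 2" by simp
      from Potts_pressure_approximation[OF d q \<beta> B this, where 'v = 'v] obtain R \<delta> where R: "0 < \<delta>"
        "\<And>n (G::'v ugraph). 0 < n \<Longrightarrow> regular_graph d n G \<Longrightarrow> 1 - \<delta> \<le> tree_proportion R G \<Longrightarrow>
          \<bar>1 / real n * ln (Z_Potts G q \<beta> B) - Bethe_prediction d q \<beta> B\<bar> \<le> \<epsilon> / 2" by blast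
      have "((\<lambda>n. tree_proportion R (G n)) \<longlongrightarrow> 1) (at_top_along I)"
        using conv by (simp add: converges_to_regular_tree_def)
      then have "\<forall>\<^sub>F n in at_top_along I. 1 - \<delta> < tree_proportion R (G n)"
        by (rule order_tendstoD) (use R(1) in simp)
      then show "\<forall>\<^sub>F n in at_top_along I. dist (1 / real n * ln (Z_Potts (G n) q \<beta> B)) (Bethe_prediction d q \<beta> B) < \<epsilon>"
        using eventually_at_top_along_mem[of I]
      proof eventually_elim
        case (elim n)
        then have "\<bar>1 / real n * ln (Z_Potts (G n) q \<beta> B) - Bethe_prediction d q \<beta> B\<bar> \<le> \<epsilon> / 2"
          using reg by (intro R(2)) auto
        then show ?case using \<open>0 < \<epsilon>\<close> by (simp add: dist_real_def)
      qed
    qed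
  next
    fix I :: "nat set" and M :: "nat \<Rightarrow> 'w measure" and G :: "nat \<Rightarrow> 'w \<Rightarrow> 'v ugraph" and \<beta> B :: real
    assume reg: "\<forall>n\<in>I. random_regular_graph d n (M n) (G n)"
      and conv: "converges_to_regular_tree_in_probability M I G" and \<beta>: "0 \<le> \<beta>" and B: "0 \<le> B"
    show "tendsto_in_probability M (\<lambda>n \<omega>. 1 / real n * ln (Z_Potts (G n \<omega>) q \<beta> B))
        (Bethe_prediction d q \<beta> B) (at_top_along I)"
      unfolding tendsto_in_probability_def
    proof (intro allI impI)
      fix \<epsilon> :: real assume "0 < \<epsilon>"
      from Potts_pressure_approximation[OF d q \<beta> B this, where 'v = 'v] obtain R \<delta> where R: "0 < \<delta>"
        "\<And>n (G::'v ugraph). 0 < n \<Longrightarrow> regular_graph d n G \<Longrightarrow> 1 - \<delta> \<le> tree_proportion R G \<Longrightarrow>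
          \<bar>1 / real n * ln (Z_Potts G q \<beta> B) - Bethe_prediction d q \<beta> B\<bar> \<le> \<epsilon>" by blast
      let ?A = "\<lambda>n. {\<omega> \<in> space (M n). \<epsilon> < \<bar>1 / real n * ln (Z_Potts (G n \<omega>) q \<beta> B) - Bethe_prediction d q \<beta> B\<bar>}"
      \<comment> \<open>For positive \<open>n\<close> in \<open>I\<close> a deviation of the
        pressure forces, outside a null set, a deviation of the tree proportion by more than
        \<open>\<delta>\<close>. Every set of graphs is measurable in the count space, so
        \<open>?C n\<close> is an event.\<close>
      let ?C = "\<lambda>n. {\<omega> \<in> space (M n). \<delta> < \<bar>tree_proportion R (G n \<omega>) - 1\<bar>}"
      have lim: "((\<lambda>n. measure (M n) (?C n)) \<longlongrightarrow> 0) (at_top_along I)"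
        using conv R(1) by (simp add: converges_to_regular_tree_in_probability_def tendsto_in_probability_def)
      have le: "\<forall>\<^sub>F n in at_top_along I. measure (M n) (?A n) \<le> measure (M n) (?C n)"
        using eventually_at_top_along_mem[of I]
      proof eventually_elim
        case (elim n)
        then have rr: "random_regular_graph d n (M n) (G n)" using reg by blast
        then interpret prob_space "M n" by (simp add: random_regular_graph_def)
        have "G n -` {g. \<delta> < \<bar>tree_proportion R g - 1\<bar>} \<inter> space (M n) \<in> sets (M n)"
          using rr by (intro measurable_sets[of _ _ "count_space UNIV"]) (auto simp: random_regular_graph_def)
        also have "G n -` {g. \<delta> < \<bar>tree_proportion R g - 1\<bar>} \<inter> space (M n) = ?C n" by auto
        finally have C: "?C n \<in> sets (M n)" .
        have "AE \<omega> in M n. regular_graph d n (G n \<omega>)" using rr by (simp add: random_regular_graph_def)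
        then have "AE \<omega> in M n. \<omega> \<in> ?A n \<longrightarrow> \<omega> \<in> ?C n"
        proof eventually_elim
          case (elim \<omega>)
          show ?case
          proof
            assume \<omega>: "\<omega> \<in> ?A n"
            then have "\<not> 1 - \<delta> \<le> tree_proportion R (G n \<omega>)"
              using R(2)[of n "G n \<omega>"] elim \<open>n \<in> I \<and> 0 < n\<close> by auto
            then show "\<omega> \<in> ?C n" using \<omega> by auto
          qed
        qed
        then show ?case using C by (rule finite_measure_mono_AE)
      qed
      show "((\<lambda>n. measure (M n) (?A n)) \<longlongrightarrow> 0) (at_top_along I)"
        by (rule tendsto_sandwich[OF _ le tendsto_const lim]) simp
    qed
  }
qed

end
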